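(* Let $d>1$ be odd, $0\le r_0<r_1\le\infty$, and let $f:A(r_0,r_1)\to\mathbb{C}$ be polyharmonic of infinite order and type $\tau<1/(2r_0)$. Then for each $k\in\mathbb{N}_0$, $l=1,\dots,a_k$, there exist complex numbers $a_{k,l,j}$, $j\in\mathbb{N}_0$, such that the power series $f^{(1)}_{k,l}(z)=\sum_{j=0}^\infty a_{k,l,2j}z^{2j}$ and $f^{(2)}_{k,l}(z)=\sum_{j=0}^\infty a_{k,l,2j+1}z^{2j}$ have radius of convergence at least $1/(2\tau)$, and the series $$z^k\sum_{j=0}^\infty a_{k,l,2j}z^{2j}+z^{-k-d+2}\sum_{j=0}^\infty a_{k,l,2j+1}z^{2j}$$ converges absolutely and uniformly on compact subsets of $\{z\in\mathbb{C}:0<|z|<1/(2\tau)\}$ and its sum agrees with $f_{k,l}(r)$ for $r\in(r_0,\min\{r_1,1/(2\tau)\})$ (so it is an analytic extension of $f_{k,l}$).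
   Context: Conventions: $1/(2\tau)=\infty$ if $\tau=0$, $1/(2r_0)=\infty$ if $r_0=0$. $A(r_0,r_1)=\{x\in\mathbb{R}^d: r_0<|x|<r_1\}$. A function $f:G\to\mathbb{C}$ on a domain $G\subset\mathbb{R}^d$ is polyharmonic of infinite order and type $\tau\ge0$ if $f\in C^\infty(G)$ and for every compact $K\subset G$ and every $\varepsilon>0$ there is $C_{K,\varepsilon}>0$ with $\max_{x\in K}|\Delta^p f(x)|\le C_{K,\varepsilon}(2p)!(\tau+\varepsilon)^{2p}$ for all $p\in\mathbb{N}_0$. $Y_{k,l}$, $l=1,\dots,a_k$, is an orthonormal basis (in $L^2(\mathbb{S}^{d-1},d\theta)$) of harmonic homogeneous polynomials of degree $k$; $f_{k,l}(r)=\int_{\mathbb{S}^{d-1}}f(r\theta)\overline{Y_{k,l}(\theta)}d\theta$. *)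

theory Defs
  imports "HOL-Analysis.Analysis"
begin

definition inv2 :: "real \<Rightarrow> ereal" where
  "inv2 t = (if t = 0 then \<infinity> else ereal (1 / (2 * t)))"

definition annulus :: "real \<Rightarrow> ereal \<Rightarrow> 'a::euclidean_space set" where
  "annulus r0 r1 = {x. r0 < norm x \<and> ereal (norm x) < r1}"

definition partial :: "'a::euclidean_space \<Rightarrow> ('a \<Rightarrow> complex) \<Rightarrow> 'a \<Rightarrow> complex" where
  "partial i g x = vector_derivative (\<lambda>t. g (x + t *\<^sub>R i)) (at 0)"

fun partials :: "'a::euclidean_space list \<Rightarrow> ('a \<Rightarrow> complex) \<Rightarrow> 'a \<Rightarrow> complex" where
  "partials [] g = g"
| "partials (i # is) g = partial i (partials is g)"

definition smooth_on :: "'a::euclidean_space set \<Rightarrow> ('a \<Rightarrow> complex) \<Rightarrow> bool" where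
  "smooth_on G g \<longleftrightarrow>
     (\<forall>is. set is \<subseteq> Basis \<longrightarrow>
        continuous_on G (partials is g) \<and>
        (\<forall>x\<in>G. \<forall>i\<in>Basis. (\<lambda>t. partials is g (x + t *\<^sub>R i)) differentiable (at 0)))"

definition lap :: "('a::euclidean_space \<Rightarrow> complex) \<Rightarrow> 'a \<Rightarrow> complex" where
  "lap g x = (\<Sum>i\<in>Basis. partial i (partial i g) x)"

definition polyharmonic_inf :: "'a::euclidean_space set \<Rightarrow> real \<Rightarrow> ('a \<Rightarrow> complex) \<Rightarrow> bool" where
  "polyharmonic_inf G \<tau> g \<longleftrightarrow> 0 \<le> \<tau> \<and> smooth_on G g \<and>
     (\<forall>K. compact K \<and> K \<subseteq> G \<longrightarrow>
        (\<forall>\<epsilon>>0. \<exists>C>0. \<forall>p::nat. \<forall>x\<in>K.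
            norm ((lap ^^ p) g x) \<le> C * fact (2 * p) * (\<tau> + \<epsilon>) ^ (2 * p)))"

text \<open>Integral over the unit sphere w.r.t. the (unnormalised) surface measure d theta,
  via polar coordinates: int_S g d theta = d * int_{unit ball} g(x/|x|) dx.\<close>
definition sphere_integral :: "('a::euclidean_space \<Rightarrow> complex) \<Rightarrow> complex" where
  "sphere_integral g = of_nat DIM('a) * integral (ball 0 1) (\<lambda>x. g (x /\<^sub>R norm x))"

definition mono_exps :: "nat \<Rightarrow> ('a::euclidean_space \<Rightarrow> nat) set" where
  "mono_exps k = {\<alpha>. (\<forall>i. i \<notin> Basis \<longrightarrow> \<alpha> i = 0) \<and> sum \<alpha> Basis = k}"

definition monomial :: "('a::euclidean_space \<Rightarrow> nat) \<Rightarrow> 'a \<Rightarrow> complex" where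
  "monomial \<alpha> x = (\<Prod>i\<in>Basis. complex_of_real (x \<bullet> i) ^ \<alpha> i)"

definition harm_hom_poly :: "nat \<Rightarrow> ('a::euclidean_space \<Rightarrow> complex) \<Rightarrow> bool" where
  "harm_hom_poly k p \<longleftrightarrow>
     (\<exists>c. \<forall>x. p x = (\<Sum>\<alpha>\<in>mono_exps k. c \<alpha> * monomial \<alpha> x)) \<and> (\<forall>x. lap p x = 0)"

definition sph_ONB :: "nat \<Rightarrow> nat \<Rightarrow> (nat \<Rightarrow> 'a::euclidean_space \<Rightarrow> complex) \<Rightarrow> bool" where
  "sph_ONB k n Y \<longleftrightarrow>
     (\<forall>l\<in>{1..n}. harm_hom_poly k (Y l)) \<and>
     (\<forall>l\<in>{1..n}. \<forall>l'\<in>{1..n}.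
        sphere_integral (\<lambda>\<theta>. Y l \<theta> * cnj (Y l' \<theta>)) = (if l = l' then 1 else 0)) \<and>
     (\<forall>p. harm_hom_poly k p \<longrightarrow>
        (\<exists>c. \<forall>\<theta>\<in>sphere 0 1. p \<theta> = (\<Sum>l\<in>{1..n}. c l * Y l \<theta>)))"

definition sph_coeff :: "('a::euclidean_space \<Rightarrow> complex) \<Rightarrow> ('a \<Rightarrow> complex) \<Rightarrow> real \<Rightarrow> complex" where
  "sph_coeff f Y r = sphere_integral (\<lambda>\<theta>. f (r *\<^sub>R \<theta>) * cnj (Y \<theta>))"

end

theory Submission
  imports Defs "HOL-Complex_Analysis.Complex_Analysis"
begin

text \<open>The functions \<open>g\<^sub>p(r) = r\<^sup>-\<^sup>k (\<Delta>\<^sup>p f)\<^sub>k\<^sub>l(r)\<close> satisfy \<open>g\<^sub>p'' + (2m/r) g\<^sub>p' = g\<^sub>p\<^sub>+\<^sub>1\<close> with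
  \<open>2m = 2k + d - 1\<close>, and \<open>m\<close> is an integer because \<open>d\<close> is odd. Hence the parameter can be lowered to
  \<open>0\<close>: if \<open>g\<close> solves the equations with \<open>m + 1\<close>, then \<open>h\<close> with \<open>h\<^sub>p' = r g\<^sub>p\<close> solves them with \<open>m\<close>.
  For \<open>m = 0\<close> they say \<open>g\<^sub>p\<close> is the \<open>2p\<close>-th derivative of \<open>g\<^sub>0\<close>, so the growth bound makes \<open>g\<^sub>0\<close>
  holomorphic on a disc of radius \<open>1/\<tau>\<close> around any \<open>\<rho> < 1/(2\<tau>)\<close>, hence on the disc of radius
  \<open>1/(2\<tau>)\<close> around the origin. Going back up multiplies the coefficients of \<open>r\<^sup>2\<^sup>m g\<^sub>0(r)\<close> by
  \<open>n - 2m\<close>, which kills the even powers below \<open>2m\<close> and leaves the two series of the theorem.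
  The equation for the \<open>g\<^sub>p\<close> is first obtained in weak form, from Green's identity and polar coordinates.\<close>

text \<open>The bound on \<Delta>^p f controls the functions g_p but not their derivatives, while
  both the lowering of m and the Taylor series need the derivatives too. They are recovered by
  Landau interpolation between g_p and g_(p+1); the loss is a factor linear in the order, which
  leaves radii of convergence unchanged. A disc of radius 1/\<tau> about \<rho> contains the disc of
  radius 1/\<tau> - \<rho> about 0, and this exceeds 1/(2 \<tau>) because \<rho> < 1/(2 \<tau>). The
  bound \<tau> < 1/(2 r0) is what allows such a \<rho> inside the annulus. The exponents come from
  r^k g_0(r) = r^(k - 2m) \<Sum> b_n r^n with 2m = 2k + d - 1: n = 2m + 2j gives k + 2j, and n = 2j
  + 1 gives 2j - k - d + 2. The weak form spares all angular derivatives: testing against q(x)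
  \<phi>(|x|), with q the conjugate of Y_kl, moves the Laplacian onto a product for which only
  homogeneity and harmonicity of q matter.\<close>

section \<open>Interpolation of first derivatives\<close>

lemma norm_diff_le_of_vector_derivative:
  fixes f :: "real \<Rightarrow> 'b::real_normed_vector"
  assumes "convex S"
    and f: "\<And>x. x \<in> S \<Longrightarrow> (f has_vector_derivative f' x) (at x within S)"
    and B: "\<And>x. x \<in> S \<Longrightarrow> norm (f' x) \<le> B"
    and "x \<in> S" "y \<in> S"
  shows "norm (f x - f y) \<le> B * norm (x - y)"
proof (rule differentiable_bound[OF \<open>convex S\<close>])
  show "onorm (\<lambda>h. h *\<^sub>R f' z) \<le> B" if "z \<in> S" for z
    using B[OF that] by (intro onorm_le) (auto simp: mult.commute[of B] intro!: mult_left_mono)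
qed (use assms in \<open>auto simp: has_vector_derivative_def\<close>)

text \<open>With M the maximum of the norm of \<open>u1\<close>, the increment of \<open>u\<close>
  over an interval of length \<delta> gives \<delta> M \<le> 2 M0 + \<delta>^2 (M1 + N M / A). The
  last term comes from the first-order part of the equation and is absorbed because \<delta> is
  small.\<close>

lemma landau_bound:
  fixes u u1 u2 :: "real \<Rightarrow> 'b::real_normed_vector"
  assumes "0 < A" "A < B" "0 \<le> N" "0 < \<delta>" "2 * \<delta> \<le> B - A" "2 * N * \<delta> \<le> A"
    and u: "\<And>s. s \<in> {A..B} \<Longrightarrow> (u has_vector_derivative u1 s) (at s)"
    and u1: "\<And>s. s \<in> {A..B} \<Longrightarrow> (u1 has_vector_derivative (u2 s - (N / s) *\<^sub>R u1 s)) (at s)"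
    and M0: "\<And>s. s \<in> {A..B} \<Longrightarrow> norm (u s) \<le> M0"
    and M1: "\<And>s. s \<in> {A..B} \<Longrightarrow> norm (u2 s) \<le> M1"
    and s: "s \<in> {A..B}"
  shows "norm (u1 s) \<le> 4 * M0 / \<delta> + 2 * \<delta> * M1"
proof -
  have "continuous_on {A..B} u1"
    using u1 by (intro continuous_on_vector_derivative) (auto intro: has_vector_derivative_at_within)
  hence "continuous_on {A..B} (\<lambda>s. norm (u1 s))"
    by (rule continuous_on_norm)
  then obtain t where t: "t \<in> {A..B}" "\<And>s. s \<in> {A..B} \<Longrightarrow> norm (u1 s) \<le> norm (u1 t)"
    using continuous_attains_sup[of "{A..B}" "\<lambda>s. norm (u1 s)"] \<open>A < B\<close> by auto
  \<comment> \<open>Near its maximum \<open>u1\<close> is almost constant, so the increment of \<open>u\<close> bounds it.\<close>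
  define M where "M = norm (u1 t)"
  define c where "c = (if t + \<delta> \<le> B then t else t - \<delta>)"
  have c: "A \<le> c" "c + \<delta> \<le> B" "c \<le> t" "t \<le> c + \<delta>"
    using t(1) assms(4,5) by (auto simp: c_def)
  have M1_nonneg: "0 \<le> M1" and M_nonneg: "0 \<le> M"
    using order_trans[OF norm_ge_zero M1[OF s]] by (auto simp: M_def)
  have der: "norm (u2 x - (N / x) *\<^sub>R u1 x) \<le> M1 + N / A * M" if x: "x \<in> {A..B}" for x
  proof -
    have "norm ((N / x) *\<^sub>R u1 x) \<le> N / A * M"
      using x \<open>0 < A\<close> \<open>0 \<le> N\<close> t(2)[OF x] by (auto simp: M_def intro!: frac_le mult_left_mono)
    thus ?thesis
      using norm_triangle_ineq4[of "u2 x" "(N / x) *\<^sub>R u1 x"] M1[OF x] by linarith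
  qed
  have diff: "norm (u1 x - u1 t) \<le> \<delta> * (M1 + N / A * M)" if x: "x \<in> {c..c+\<delta>}" for x
  proof -
    have "norm (u1 x - u1 t) \<le> (M1 + N / A * M) * norm (x - t)"
      by (rule norm_diff_le_of_vector_derivative[where S = "{c..c+\<delta>}" and
            f' = "\<lambda>y. u2 y - (N / y) *\<^sub>R u1 y"])
         (use c x der u1 in \<open>auto intro: has_vector_derivative_at_within\<close>)
    also have "\<dots> = norm (x - t) * (M1 + N / A * M)" by (rule mult.commute)
    also have "\<dots> \<le> \<delta> * (M1 + N / A * M)"
      using x c M1_nonneg M_nonneg \<open>0 < A\<close> \<open>0 \<le> N\<close> by (intro mult_right_mono) auto
    finally show ?thesis by simp
  qed
  have "norm (u (c + \<delta>) - u c - (c + \<delta> - c) *\<^sub>R u1 t) \<le> norm (c + \<delta> - c) * (\<delta> * (M1 + N / A * M))"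
    by (rule vector_differentiable_bound_linearization[where S = "{c..c+\<delta>}"])
       (use c diff u in \<open>auto simp: closed_segment_eq_real_ivl intro: has_vector_derivative_at_within\<close>)
  hence "norm (\<delta> *\<^sub>R u1 t) \<le> norm (u (c + \<delta>) - u c) + \<delta> * (\<delta> * (M1 + N / A * M))"
    using norm_triangle_sub[of "\<delta> *\<^sub>R u1 t" "u (c + \<delta>) - u c"] \<open>0 < \<delta>\<close>
    by (simp add: norm_minus_commute)
  also have "norm (u (c + \<delta>) - u c) \<le> M0 + M0"
    using norm_triangle_ineq4[of "u (c + \<delta>)" "u c"] M0[of "c+\<delta>"] M0[of c] c \<open>0 < \<delta>\<close> by auto
  finally have "\<delta> * M \<le> 2 * M0 + \<delta> * \<delta> * M1 + \<delta> * M * (N * \<delta> / A)"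
    using \<open>0 < \<delta>\<close> by (simp add: M_def algebra_simps)
  \<comment> \<open>Here \<open>2 * N * \<delta> \<le> A\<close> enters: the first-order term takes
    at most half of the left side.\<close>
  also have "\<delta> * M * (N * \<delta> / A) \<le> \<delta> * M * (1 / 2)"
    using assms(1,4,6) M_nonneg by (intro mult_left_mono) (auto simp: field_simps)
  finally have "M \<le> 4 * M0 / \<delta> + 2 * \<delta> * M1"
    using \<open>0 < \<delta>\<close> by (simp add: field_simps)
  thus ?thesis using t(2)[OF s] by (simp add: M_def)
qed

section \<open>Towers of Bessel equations and their power series\<close>

text \<open>Closed intervals with endpoints in an interval \<open>I\<close> exhaust its compact
  subsets, so this is the growth condition of \<open>polyharmonic_inf\<close> carried over to
  functions of the radius.\<close>

definition factorial_growth :: "real \<Rightarrow> real set \<Rightarrow> (nat \<Rightarrow> real \<Rightarrow> complex) \<Rightarrow> bool" where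
  "factorial_growth \<tau> I g \<longleftrightarrow> (\<forall>x\<in>I. \<forall>y\<in>I. \<forall>\<epsilon>>0. \<exists>C>0. \<forall>p. \<forall>r\<in>{x..y}.
     norm (g p r) \<le> C * fact (2 * p) * (\<tau> + \<epsilon>) ^ (2 * p))"

text \<open>g'' + (2m/r) g' is the radial Laplacian in dimension 2m + 1, so each level is the radial
  Laplacian of the level below. Dividing a coefficient of degree k by r^k amounts to passing from
  dimension d to dimension d + 2k.\<close>

definition bessel_tower ::
  "nat \<Rightarrow> real \<Rightarrow> real set \<Rightarrow> (nat \<Rightarrow> real \<Rightarrow> complex) \<Rightarrow> (nat \<Rightarrow> real \<Rightarrow> complex) \<Rightarrow> bool" where
  "bessel_tower m \<tau> I g g' \<longleftrightarrow> factorial_growth \<tau> I g \<and>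
     (\<forall>p. \<forall>r\<in>I. (g p has_vector_derivative g' p r) (at r) \<and>
        (g' p has_vector_derivative (g (Suc p) r - (2 * real m / r) *\<^sub>R g' p r)) (at r))"

lemma interval_extend_right:
  fixes I :: "real set"
  assumes "open I" "x \<in> I"
  obtains y where "y \<in> I" "x < y"
proof -
  obtain e where e: "e > 0" "cball x e \<subseteq> I"
    using assms open_contains_cball by blast
  have "x + e \<in> cball x e" using e by (simp add: dist_real_def)
  thus thesis using that[of "x + e"] e by auto
qed

text \<open>Landau's estimate with \<open>g p\<close> as function and \<open>g (Suc p)\<close> as
  second-order term. The factorial of level p + 1 is one step larger than the (2p + 1)! of an odd
  derivative; this is the linear loss seen later.\<close>

lemma bessel_tower_derivative_growth:
  assumes T: "bessel_tower m \<tau> I g g'" and I: "open I" "is_interval I" "I \<subseteq> {0<..}"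
    and xy: "x \<in> I" "y \<in> I" and \<epsilon>: "0 < \<epsilon>" and \<tau>: "0 \<le> \<tau>"
  shows "\<exists>C>0. \<forall>p. \<forall>r\<in>{x..y}. norm (g' p r) \<le> C * fact (2 * p + 2) * (\<tau> + \<epsilon>) ^ (2 * p + 2)"
proof -
  \<comment> \<open>The interval x..y may be a single point, but the estimate needs positive length,
    so the right end is moved to a larger \<open>y'\<close>.\<close>
  have "max x y \<in> I" using xy by (auto simp: max_def)
  then obtain y' where y': "y' \<in> I" "max x y < y'"
    using interval_extend_right[OF I(1)] by metis
  have sub: "{x..y'} \<subseteq> I"
    using I(2) xy y'(1) by (meson atLeastAtMost_iff is_interval_1 subsetI)
  have "0 < x" using xy I by auto
  obtain C where C: "C > 0"
    "\<And>p r. r \<in> {x..y'} \<Longrightarrow> norm (g p r) \<le> C * fact (2 * p) * (\<tau> + \<epsilon>) ^ (2 * p)"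
    using T xy y' \<epsilon> unfolding bessel_tower_def factorial_growth_def by meson
  define q where "q = \<tau> + \<epsilon>"
  have q: "q > 0" using \<tau> \<epsilon> by (simp add: q_def)
  \<comment> \<open>With N = 2m the estimate asks for 4 m \<delta> \<le> x; the added 1 keeps the
    denominator positive when m = 0.\<close>
  define \<delta> where "\<delta> = min ((y' - x) / 2) (x / (4 * real m + 1))"
  have "0 < x / (4 * real m + 1)" using \<open>0 < x\<close> by (simp add: add_nonneg_pos)
  hence \<delta>: "0 < \<delta>" using y' by (simp add: \<delta>_def)
  have \<delta>1: "2 * \<delta> \<le> y' - x"
  proof -
    have "\<delta> \<le> (y' - x) / 2" unfolding \<delta>_def by (rule min.cobounded1)
    thus ?thesis by simp
  qed
  have "\<delta> * (4 * real m + 1) \<le> x"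
    using min.cobounded2[of "(y' - x) / 2" "x / (4 * real m + 1)"]
    unfolding \<delta>_def[symmetric] by (simp add: pos_le_divide_eq add_nonneg_pos)
  hence \<delta>2: "2 * (2 * real m) * \<delta> \<le> x" using \<delta> by (simp add: algebra_simps)
  define K where "K = 4 * C / \<delta> / q\<^sup>2 + 2 * \<delta> * C"
  have "norm (g' p r) \<le> K * fact (2 * p + 2) * (\<tau> + \<epsilon>) ^ (2 * p + 2)" if r: "r \<in> {x..y}" for p r
  proof -
    define X Y where "X = (fact (2 * p) :: real)" and "Y = (fact (2 * p + 2) :: real)"
    have "X \<le> Y" unfolding X_def Y_def by (rule fact_mono) simp
    have "norm (g' p r) \<le> 4 * (C * X * q ^ (2 * p)) / \<delta> + 2 * \<delta> * (C * Y * q ^ (2 * p + 2))"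
      by (rule landau_bound[where N = "2 * real m" and u = "g p" and ?u2.0 = "g (Suc p)" and A = x and B = y'])
         (use \<open>0 < x\<close> y' \<delta> \<delta>1 \<delta>2 C(2) C(2)[of _ "Suc p"] sub r T in
           \<open>auto simp: bessel_tower_def X_def Y_def q_def simp del: fact_Suc power_Suc\<close>)
    also have "C * X * q ^ (2 * p) \<le> C * Y * q ^ (2 * p)"
      using C(1) q \<open>X \<le> Y\<close> by (intro mult_right_mono mult_left_mono) auto
    also have "4 * (C * Y * q ^ (2 * p)) / \<delta> + 2 * \<delta> * (C * Y * q ^ (2 * p + 2)) = K * Y * q ^ (2 * p + 2)"
      using q \<delta> by (simp add: K_def power_add divide_simps) (simp add: algebra_simps power2_eq_square)
    finally show ?thesis
      using \<delta> by (simp add: q_def Y_def divide_right_mono del: fact_Suc power_Suc)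
  qed
  moreover have "K > 0" using C(1) \<delta> q by (auto simp: K_def intro!: add_nonneg_pos)
  ultimately show ?thesis by blast
qed

text \<open>The Lagrange remainder exists for real functions only. It is applied to the real and the
  imaginary part, with different intermediate points, whence the factor 2.\<close>

lemma taylor_remainder_bound:
  fixes D :: "nat \<Rightarrow> real \<Rightarrow> complex"
  assumes D: "\<And>n t. t \<in> closed_segment x c \<Longrightarrow> (D n has_vector_derivative D (Suc n) t) (at t)"
    and B: "\<And>t. t \<in> closed_segment x c \<Longrightarrow> norm (D n t) \<le> B" and "0 < n"
  shows "norm (D 0 x - (\<Sum>m<n. D m c / fact m * of_real (x - c) ^ m)) \<le> 2 * (B / fact n * \<bar>x - c\<bar> ^ n)"
proof (cases "x = c")
  case True
  hence "(\<Sum>m<n. D m c / fact m * of_real (x - c) ^ m) = (\<Sum>m<n. if m = 0 then D m c else 0)"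
    by (intro sum.cong) auto
  with \<open>0 < n\<close> True show ?thesis by (simp add: sum.delta power_0_left)
next
  case False
  have part: "\<bar>L (D 0 x - (\<Sum>m<n. D m c / fact m * of_real (x - c) ^ m))\<bar> \<le> B / fact n * \<bar>x - c\<bar> ^ n"
    if L: "bounded_linear L" and nL: "\<And>z. \<bar>L z\<bar> \<le> norm z" for L :: "complex \<Rightarrow> real"
  proof -
    interpret L: bounded_linear L by fact
    have "\<exists>t. (if x < c then x < t \<and> t < c else c < t \<and> t < x) \<and>
        L (D 0 x) = (\<Sum>m<n. (L (D m c) / fact m) * (x - c) ^ m) + (L (D n t) / fact n) * (x - c) ^ n"
    proof (rule Taylor[where diff = "\<lambda>m t. L (D m t)" and a = "min x c" and b = "max x c"])
      show "\<forall>m t. m < n \<and> min x c \<le> t \<and> t \<le> max x c \<longrightarrow>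
          DERIV (\<lambda>t. L (D m t)) t :> L (D (Suc m) t)"
        unfolding has_real_derivative_iff_has_vector_derivative
        by (intro allI impI L.has_vector_derivative D) (auto simp: closed_segment_eq_real_ivl)
    qed (use False \<open>0 < n\<close> in auto)
    then obtain t where "if x < c then x < t \<and> t < c else c < t \<and> t < x"
      and t2: "L (D 0 x) = (\<Sum>m<n. (L (D m c) / fact m) * (x - c) ^ m) + (L (D n t) / fact n) * (x - c) ^ n"
      by blast
    hence t1: "t \<in> closed_segment x c"
      by (auto simp: closed_segment_eq_real_ivl split: if_splits)
    have "D m c / fact m * of_real (x - c) ^ m = ((x - c) ^ m / fact m) *\<^sub>R D m c" for m
      by (simp add: scaleR_conv_of_real)
    hence "L (D 0 x - (\<Sum>m<n. D m c / fact m * of_real (x - c) ^ m)) = (L (D n t) / fact n) * (x - c) ^ n"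
      using t2 by (simp add: L.diff L.sum L.scaleR mult.commute)
    also have "\<bar>\<dots>\<bar> \<le> B / fact n * \<bar>x - c\<bar> ^ n"
      using B[OF t1] nL[of "D n t"]
      by (auto simp: abs_mult power_abs intro!: mult_right_mono divide_right_mono)
    finally show ?thesis .
  qed
  show ?thesis
    using part[OF bounded_linear_Re abs_Re_le_cmod] part[OF bounded_linear_Im abs_Im_le_cmod]
      cmod_le[of "D 0 x - (\<Sum>m<n. D m c / fact m * of_real (x - c) ^ m)"] by linarith
qed

text \<open>Provides slack, either in the growth rate or in the radius. The product form covers
  \<tau> = 0, where the radius is infinite, without division.\<close>

lemma increase_below_reciprocal:
  fixes x y :: real
  assumes "0 \<le> x" "y * x < 1"
  obtains y' where "y < y'" "y' * x < 1"
proof (cases "x = 0")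
  case True thus thesis using that[of "y + 1"] by simp
next
  case False
  hence "y < 1 / x" using assms by (simp add: field_simps)
  then obtain y' where "y < y'" "y' < 1 / x" using dense by blast
  thus thesis using that[of y'] False assms(1) by (simp add: field_simps)
qed

lemma summable_linear_times_geometric:
  fixes x :: real
  assumes "0 \<le> x" "x < 1"
  shows "summable (\<lambda>n. C * (real n + 2) * x ^ n)"
proof -
  have "summable (\<lambda>n. real (Suc n) * x ^ n)"
    using geometric_deriv_sums[of x] assms by (auto simp: sums_iff)
  moreover have "summable (\<lambda>n. x ^ n)" using assms by (simp add: summable_geometric)
  ultimately have "summable (\<lambda>n. C * (real (Suc n) * x ^ n + x ^ n))"
    by (intro summable_mult summable_add)
  thus ?thesis by (simp add: algebra_simps)
qed

lemma bessel_tower_0_power_series: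
  assumes T: "bessel_tower 0 \<tau> I g g'" and I: "open I" "is_interval I" "I \<subseteq> {0<..}"
    and \<tau>: "0 \<le> \<tau>" and \<rho>: "\<rho> \<in> I" "2 * \<tau> * \<rho> < 1"
  shows "\<exists>b. (\<forall>z. 2 * \<tau> * norm z < 1 \<longrightarrow> summable (\<lambda>n. b n * z ^ n)) \<and>
             (\<forall>r\<in>I. 2 * \<tau> * r < 1 \<longrightarrow> (\<lambda>n. b n * of_real r ^ n) sums g 0 r)"
proof -
  \<comment> \<open>For m = 0 the equations read g_p'' = g_(p+1), so \<open>D n\<close> is the n-th
    derivative of \<open>g 0\<close>.\<close>
  define D where "D n = (if even n then g (n div 2) else g' (n div 2))" for n
  have D: "(D n has_vector_derivative D (Suc n) t) (at t)" if "t \<in> I" for n t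
    using T that by (auto simp: D_def bessel_tower_def elim!: oddE)
  have Dbound: "\<exists>C>0. \<forall>n. \<forall>r\<in>{x..y}. norm (D n r) \<le> C * (real n + 2) * fact n * q ^ n"
    if xy: "x \<in> I" "y \<in> I" and q: "\<tau> < q" for x y q
  proof -
    have q0: "q > 0" using q \<tau> by simp
    obtain C1 where C1: "C1 > 0" "\<And>p r. r\<in>{x..y} \<Longrightarrow> norm (g p r) \<le> C1 * fact (2 * p) * q ^ (2 * p)"
    proof -
      have "0 < q - \<tau>" using q by simp
      from this T xy have "\<exists>C>0. \<forall>p. \<forall>r\<in>{x..y}. norm (g p r) \<le> C * fact (2 * p) * (\<tau> + (q - \<tau>)) ^ (2 * p)"
        unfolding bessel_tower_def factorial_growth_def by blast
      thus thesis using that by auto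
    qed
    obtain C2 where C2: "C2 > 0" "\<And>p r. r\<in>{x..y} \<Longrightarrow> norm (g' p r) \<le> C2 * fact (2 * p + 2) * q ^ (2 * p + 2)"
      using bessel_tower_derivative_growth[OF T I xy _ \<tau>, of "q - \<tau>"] q by auto
    \<comment> \<open>For odd n the available bound is C2 (n + 1)! q^(n+1): one factor q goes into
      the constant, and n + 1 is the source of the linear factor n + 2.\<close>
    define C where "C = max C1 (C2 * q)"
    have "norm (D n r) \<le> C * (real n + 2) * fact n * q ^ n" if r: "r \<in> {x..y}" for n r
    proof (cases "even n")
      case True
      then obtain p where p: "n = 2 * p" by auto
      have "norm (D n r) \<le> C1 * fact n * q ^ n" using C1(2)[OF r] p by (simp add: D_def)
      also have "C1 \<le> C * 1" by (simp add: C_def)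
      also have "\<dots> \<le> C * (real n + 2)" using C1(1) by (intro mult_left_mono) (auto simp: C_def le_max_iff_disj)
      finally show ?thesis using q0 by (auto simp: mult_right_mono)
    next
      case False
      then obtain p where p: "n = 2 * p + 1" using oddE by blast
      have "norm (D n r) \<le> C2 * fact (Suc n) * q ^ (Suc n)" using C2(2)[OF r, of p] p by (simp add: D_def)
      also have "\<dots> = (C2 * q) * (real n + 1) * (fact n * q ^ n)" by (simp add: algebra_simps)
      also have "\<dots> \<le> C * (real n + 2) * (fact n * q ^ n)"
        using q0 C2(1) by (intro mult_right_mono mult_mono) (auto simp: C_def le_max_iff_disj)
      finally show ?thesis by (simp add: mult.assoc)
    qed
    moreover have "C > 0" using C1 by (simp add: C_def less_max_iff_disj)
    ultimately show ?thesis by blast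
  qed
  define e where "e n = D n \<rho> / fact n" for n
  have e_summable: "summable (\<lambda>n. e n * (z - of_real \<rho>) ^ n)" if z: "\<tau> * norm (z - of_real \<rho>) < 1" for z
  proof -
    obtain q where q: "\<tau> < q" "q * norm (z - of_real \<rho>) < 1"
      using increase_below_reciprocal[of "norm (z - of_real \<rho>)" \<tau>] z by auto
    obtain C where C: "\<And>n r. r\<in>{\<rho>..\<rho>} \<Longrightarrow> norm (D n r) \<le> C * (real n + 2) * fact n * q ^ n"
      using Dbound[OF \<rho>(1) \<rho>(1) q(1)] by blast
    have "norm (e n * (z - of_real \<rho>) ^ n) \<le> C * (real n + 2) * (q * norm (z - of_real \<rho>)) ^ n" for n
    proof -
      have "norm (e n) \<le> C * (real n + 2) * q ^ n"
        using C[of \<rho> n] by (simp add: e_def norm_divide field_simps)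
      from mult_right_mono[OF this, of "norm ((z - of_real \<rho>) ^ n)"] show ?thesis
        by (simp add: norm_mult norm_power power_mult_distrib mult.assoc)
    qed
    moreover have "summable (\<lambda>n. C * (real n + 2) * (q * norm (z - of_real \<rho>)) ^ n)"
      using q \<tau> by (intro summable_linear_times_geometric) auto
    ultimately show ?thesis by (rule summable_comparison_test'[rotated])
  qed
  define F where "F z = (\<Sum>n. e n * (z - of_real \<rho>) ^ n)" for z
  define b where "b n = (deriv ^^ n) F 0 / fact n" for n
  have \<rho>0: "\<rho> > 0" using I \<rho> by auto
  have F_sums: "(\<lambda>n. b n * z ^ n) sums F z" if z: "2 * \<tau> * norm z < 1" for z
  proof -
    obtain s where s: "norm z < s" "2 * \<tau> * s < 1"
      using increase_below_reciprocal[of "2 * \<tau>" "norm z"] z \<tau> by (auto simp: mult.commute)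
    \<comment> \<open>Adding 2 \<tau> s < 1 and 2 \<tau> \<rho> < 1 gives \<tau> (s + \<rho>) < 1,
      so the series about \<rho> converges on this disc, which contains the disc of radius s about
      0.\<close>
    have "F holomorphic_on ball (of_real \<rho>) (s + \<rho>)"
    proof (rule power_series_holomorphic)
      fix w assume "w \<in> ball (complex_of_real \<rho>) (s + \<rho>)"
      hence "\<tau> * norm (w - of_real \<rho>) \<le> \<tau> * (s + \<rho>)"
        using \<tau> by (intro mult_left_mono) (auto simp: dist_norm norm_minus_commute)
      also have "\<dots> < 1" using s(2) \<rho>(2) by (simp add: algebra_simps)
      finally show "(\<lambda>n. e n * (w - of_real \<rho>) ^ n) sums F w"
        unfolding F_def using e_summable by (auto intro: summable_sums)
    qed
    moreover have "ball 0 s \<subseteq> ball (complex_of_real \<rho>) (s + \<rho>)"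
    proof
      fix w :: complex assume "w \<in> ball 0 s"
      thus "w \<in> ball (complex_of_real \<rho>) (s + \<rho>)"
        using norm_triangle_ineq4[of "of_real \<rho>" w] \<rho>0 by (simp add: dist_norm)
    qed
    ultimately have "F holomorphic_on ball 0 s" by (rule holomorphic_on_subset)
    from holomorphic_power_series[OF this, of z] show ?thesis
      using s by (simp add: b_def)
  qed
  hence "summable (\<lambda>n. b n * z ^ n)" if "2 * \<tau> * norm z < 1" for z
    using that sums_summable by blast
  moreover have "(\<lambda>n. b n * of_real r ^ n) sums g 0 r" if r: "r \<in> I" "2 * \<tau> * r < 1" for r
  proof -
    have r0: "r > 0" using r I by auto
    have seg: "closed_segment r \<rho> = {min r \<rho>..max r \<rho>}" by (auto simp: closed_segment_eq_real_ivl)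
    have mem: "min r \<rho> \<in> I" "max r \<rho> \<in> I" using r \<rho> by (auto simp: min_def max_def)
    hence segI: "closed_segment r \<rho> \<subseteq> I" unfolding seg using I(2) by (meson atLeastAtMost_iff is_interval_1 subsetI)
    \<comment> \<open>The same sum of two halves makes the Taylor remainder at r tend to 0, so
      \<open>F\<close> is not merely a holomorphic function but agrees with \<open>g 0\<close> at
      r.\<close>
    have "\<tau> * \<bar>r - \<rho>\<bar> < 1"
    proof -
      have "\<tau> * \<bar>r - \<rho>\<bar> \<le> \<tau> * (r + \<rho>)" using r0 \<rho>0 \<tau> by (intro mult_left_mono) auto
      also have "\<dots> < 1" using r \<rho> by (simp add: algebra_simps)
      finally show ?thesis .
    qed
    then obtain q where q: "\<tau> < q" "q * \<bar>r - \<rho>\<bar> < 1"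
      using increase_below_reciprocal[of "\<bar>r - \<rho>\<bar>" \<tau>] by auto
    obtain C where C: "C > 0" "\<And>n t. t\<in>{min r \<rho>..max r \<rho>} \<Longrightarrow> norm (D n t) \<le> C * (real n + 2) * fact n * q ^ n"
      using Dbound[OF mem q(1)] by blast
    have bd: "norm (g 0 r - (\<Sum>m<n. e m * (of_real r - of_real \<rho>) ^ m))
        \<le> 2 * (C * (real n + 2) * (q * \<bar>r - \<rho>\<bar>) ^ n)" if "n > 0" for n
    proof -
      have "norm (D 0 r - (\<Sum>m<n. D m \<rho> / fact m * of_real (r - \<rho>) ^ m))
          \<le> 2 * ((C * (real n + 2) * fact n * q ^ n) / fact n * \<bar>r - \<rho>\<bar> ^ n)"
        by (rule taylor_remainder_bound) (use D segI C that seg in auto)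
      thus ?thesis by (simp add: D_def[of 0] e_def power_mult_distrib mult.assoc)
    qed
    have lim0: "(\<lambda>n. 2 * (C * (real n + 2) * (q * \<bar>r - \<rho>\<bar>) ^ n)) \<longlonglongrightarrow> 0"
      using summable_LIMSEQ_zero[OF summable_linear_times_geometric[of "q * \<bar>r - \<rho>\<bar>" "2 * C"]] q \<tau>
      by (simp add: mult.assoc)
    have "(\<lambda>n. g 0 r - (\<Sum>m<n. e m * (of_real r - of_real \<rho>) ^ m)) \<longlonglongrightarrow> 0"
      by (rule Lim_null_comparison[OF _ lim0]) (use bd in \<open>auto simp: eventually_sequentially intro!: exI[of _ 1]\<close>)
    hence "(\<lambda>n. g 0 r - (g 0 r - (\<Sum>m<n. e m * (of_real r - of_real \<rho>) ^ m))) \<longlonglongrightarrow> g 0 r - 0"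
      by (intro tendsto_diff tendsto_const)
    hence "(\<lambda>n. e n * (of_real r - of_real \<rho>) ^ n) sums g 0 r" by (simp add: sums_def)
    hence "F (of_real r) = g 0 r" by (simp add: F_def sums_iff)
    thus ?thesis using F_sums[of "of_real r"] r r0 by simp
  qed
  ultimately show ?thesis by blast
qed

lemma is_interval_einterval: "is_interval (einterval a b)"
  unfolding is_interval_1
proof (intro ballI allI impI)
  fix x y z :: real assume "x \<in> einterval a b" "y \<in> einterval a b" "x \<le> z \<and> z \<le> y"
  thus "z \<in> einterval a b"
    using less_le_trans[of a "ereal x" "ereal z"] le_less_trans[of "ereal z" "ereal y" b]
    by (auto simp: einterval_iff)
qed

lemma einterval_subset_pos: "0 \<le> a \<Longrightarrow> einterval a b \<subseteq> {0<..}"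
  by (auto simp: einterval_iff dest: le_less_trans)

text \<open>The operator (1/r) d/dr maps solutions with parameter m to solutions with parameter m +
  1; the tower \<open>h\<close> is a preimage under it. Only level 0 requires an integration, since
  every later level is forced by the equation.\<close>

lemma bessel_tower_descent:
  assumes T: "bessel_tower (Suc m) \<tau> (einterval \<alpha> \<beta>) g g'" and \<tau>: "0 \<le> \<tau>"
    and \<alpha>: "0 \<le> \<alpha>" and \<alpha>\<beta>: "\<alpha> < \<beta>"
  shows "\<exists>h h'. bessel_tower m \<tau> (einterval \<alpha> \<beta>) h h' \<and> h' 0 = (\<lambda>r. r *\<^sub>R g 0 r)"
proof -
  define I where "I = einterval \<alpha> \<beta>"
  have I: "open I" "is_interval I" "I \<subseteq> {0<..}"
    using is_interval_einterval einterval_subset_pos[OF \<alpha>] by (auto simp: I_def)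
  have g: "(g p has_vector_derivative g' p r) (at r)"
    and g': "(g' p has_vector_derivative (g (Suc p) r - (2 * real (Suc m) / r) *\<^sub>R g' p r)) (at r)"
    if "r \<in> I" for p r
    using T that by (auto simp: bessel_tower_def I_def)
  have "\<exists>H. \<forall>x. \<alpha> < ereal x \<longrightarrow> ereal x < \<beta> \<longrightarrow> (H has_vector_derivative x *\<^sub>R g 0 x) (at x)"
  proof (rule einterval_antiderivative[OF \<alpha>\<beta>])
    fix x assume "\<alpha> < ereal x" "ereal x < \<beta>"
    hence "isCont (g 0) x"
      using g[of x 0] has_vector_derivative_continuous by (auto simp: I_def einterval_iff)
    thus "isCont (\<lambda>x. x *\<^sub>R g 0 x) x" by (intro continuous_intros)
  qed
  then obtain H where H: "\<And>x. x \<in> I \<Longrightarrow> (H has_vector_derivative x *\<^sub>R g 0 x) (at x)"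
    by (auto simp: I_def einterval_iff)
  \<comment> \<open>With h_p' = r g_p the equation for m gives h_(p+1) = h_p'' + (2m/r) h_p' = (2m +
    1) g_p + r g_p'. Level 0 has no predecessor and uses the primitive \<open>H\<close>.\<close>
  define h where "h = case_nat H (\<lambda>p r. (2 * real m + 1) *\<^sub>R g p r + r *\<^sub>R g' p r)"
  define h' where "h' p r = r *\<^sub>R g p r" for p r
  have "(h p has_vector_derivative h' p r) (at r)" if r: "r \<in> I" for p r
  proof (cases p)
    case 0 thus ?thesis using H[OF r] by (simp add: h_def h'_def)
  next
    case (Suc n)
    have "((\<lambda>r. (2 * real m + 1) *\<^sub>R g n r + r *\<^sub>R g' n r) has_vector_derivative
       ((2 * real m + 1) *\<^sub>R g' n r + (r *\<^sub>R (g (Suc n) r - (2 * real (Suc m) / r) *\<^sub>R g' n r) + 1 *\<^sub>R g' n r))) (at r)"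
      by (intro has_vector_derivative_add has_vector_derivative_scaleR[OF DERIV_ident]
          bounded_linear.has_vector_derivative[OF bounded_linear_scaleR_right] g g' r)
    moreover have "(2 * real m + 1) *\<^sub>R g' n r + (r *\<^sub>R (g (Suc n) r - (2 * real (Suc m) / r) *\<^sub>R g' n r) + 1 *\<^sub>R g' n r)
       = r *\<^sub>R g (Suc n) r"
    proof -
      have "r > 0" using r I by auto
      hence "r *\<^sub>R (g (Suc n) r - (2 * real (Suc m) / r) *\<^sub>R g' n r)
          = r *\<^sub>R g (Suc n) r - (2 * real (Suc m)) *\<^sub>R g' n r"
        by (simp only: scaleR_diff_right scaleR_scaleR) simp
      moreover have "(2 * real m + 1) *\<^sub>R g' n r + ((r *\<^sub>R g (Suc n) r - (2 * real (Suc m)) *\<^sub>R g' n r) + 1 *\<^sub>R g' n r)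
          = r *\<^sub>R g (Suc n) r + ((2 * real m + 1) - 2 * real (Suc m) + 1) *\<^sub>R g' n r"
        unfolding scaleR_add_left scaleR_diff_left by simp
      ultimately show ?thesis by simp
    qed
    ultimately show ?thesis by (simp add: h_def h'_def Suc)
  qed
  moreover have "(h' p has_vector_derivative (h (Suc p) r - (2 * real m / r) *\<^sub>R h' p r)) (at r)"
    if r: "r \<in> I" for p r
  proof -
    have "((\<lambda>r. r *\<^sub>R g p r) has_vector_derivative (r *\<^sub>R g' p r + 1 *\<^sub>R g p r)) (at r)"
      by (intro has_vector_derivative_scaleR[OF DERIV_ident] g r)
    moreover have "r > 0" using r I by auto
    ultimately show ?thesis
      by (simp add: h_def h'_def[abs_def] algebra_simps scaleR_conv_of_real)
  qed
  moreover have "factorial_growth \<tau> I h"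
    unfolding factorial_growth_def
  proof (intro ballI allI impI)
    fix x y \<epsilon> :: real assume xy: "x \<in> I" "y \<in> I" and \<epsilon>: "0 < \<epsilon>"
    define q where "q = \<tau> + \<epsilon>"
    have q: "q > 0" using \<epsilon> \<tau> by (simp add: q_def)
    have sub: "{x..y} \<subseteq> I"
      using I(2) xy by (meson atLeastAtMost_iff is_interval_1 subsetI)
    have pos: "x > 0" "y > 0" using xy I by auto
    have "continuous_on {x..y} H"
      using H sub
      by (intro continuous_on_vector_derivative[where f' = "\<lambda>x. x *\<^sub>R g 0 x"])
         (blast intro: has_vector_derivative_at_within)
    hence "bounded (H ` {x..y})" by (intro compact_imp_bounded compact_continuous_image) auto
    then obtain C0 where C0: "\<And>r. r \<in> {x..y} \<Longrightarrow> norm (H r) \<le> C0"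
      unfolding bounded_iff by blast
    obtain C1 where C1: "C1 > 0" "\<And>p r. r \<in> {x..y} \<Longrightarrow> norm (g p r) \<le> C1 * fact (2 * p) * q ^ (2 * p)"
      using T xy \<epsilon> unfolding bessel_tower_def factorial_growth_def I_def q_def by meson
    obtain C2 where C2: "C2 > 0" "\<And>p r. r\<in>{x..y} \<Longrightarrow> norm (g' p r) \<le> C2 * fact (2 * p + 2) * q ^ (2 * p + 2)"
      using bessel_tower_derivative_growth[OF T[folded I_def] I xy \<epsilon> \<tau>] unfolding q_def by blast
    \<comment> \<open>\<open>h (Suc n)\<close> is built from level n of \<open>g\<close>: the bound
      of \<open>g n\<close> pays \<open>1 / q\<^sup>2\<close> to reach the exponent of level n + 1,
      while the bound of \<open>g' n\<close> already has the factorial and exponent of that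
      level.\<close>
    define K where "K = (2 * real m + 1) * C1 / q\<^sup>2 + y * C2"
    have K: "K > 0" using C1 C2 q pos by (auto simp: K_def intro!: add_pos_nonneg)
    have "norm (h p r) \<le> max \<bar>C0\<bar> K * fact (2 * p) * q ^ (2 * p)" if r: "r \<in> {x..y}" for p r
    proof (cases p)
      case 0
      thus ?thesis using C0[OF r] by (auto simp: h_def le_max_iff_disj)
    next
      case (Suc n)
      define X Y where "X = (fact (2 * n) :: real)" and "Y = (fact (2 * n + 2) :: real)"
      have XY: "0 \<le> X" "X \<le> Y" "0 \<le> Y" unfolding X_def Y_def by (auto intro: fact_mono simp del: fact_Suc)
      have "norm (h p r) \<le> norm ((2 * real m + 1) *\<^sub>R g n r) + norm (r *\<^sub>R g' n r)"
        by (simp add: h_def Suc norm_triangle_ineq del: norm_scaleR)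
      also have "norm ((2 * real m + 1) *\<^sub>R g n r) \<le> (2 * real m + 1) * (C1 * Y * q ^ (2 * n))"
      proof -
        have "norm (g n r) \<le> C1 * X * q ^ (2 * n)" using C1(2)[OF r] by (simp add: X_def)
        also have "\<dots> \<le> C1 * Y * q ^ (2 * n)"
          using C1(1) q XY by (intro mult_right_mono mult_left_mono) auto
        finally show ?thesis by (simp add: mult_left_mono)
      qed
      also have "norm (r *\<^sub>R g' n r) \<le> y * (C2 * Y * q ^ (2 * n + 2))"
      proof -
        have "\<bar>r\<bar> * norm (g' n r) \<le> y * (C2 * Y * q ^ (2 * n + 2))"
          using C2(2)[OF r] r pos unfolding Y_def by (intro mult_mono) auto
        thus ?thesis by simp
      qed
      also have "(2 * real m + 1) * (C1 * Y * q ^ (2 * n)) + y * (C2 * Y * q ^ (2 * n + 2)) = K * Y * q ^ (2 * n + 2)"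
        using q by (simp add: K_def power_add divide_simps) (simp add: algebra_simps power2_eq_square)
      also have "\<dots> \<le> max \<bar>C0\<bar> K * Y * q ^ (2 * n + 2)"
        using q XY by (intro mult_right_mono) auto
      finally show ?thesis by (simp add: Suc Y_def)
    qed
    moreover have "max \<bar>C0\<bar> K > 0" using K by auto
    ultimately show "\<exists>C>0. \<forall>p. \<forall>r\<in>{x..y}. norm (h p r) \<le> C * fact (2 * p) * (\<tau> + \<epsilon>) ^ (2 * p)"
      unfolding q_def by blast
  qed
  ultimately have "bessel_tower m \<tau> I h h'" by (simp add: bessel_tower_def)
  moreover have "h' 0 = (\<lambda>r. r *\<^sub>R g 0 r)" by (simp add: h'_def[abs_def])
  ultimately show ?thesis unfolding I_def by blast
qed

text \<open>The series represents r^(2m) g_0 because the homogeneous equation also has the solution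
  r^(1 - 2m), which is singular at 0. Induction on m: descend one step, expand r^(2m) h_0, and
  recover g_0 by differentiation.\<close>

lemma bessel_tower_power_series:
  assumes "bessel_tower m \<tau> (einterval \<alpha> \<beta>) g g'" and \<tau>: "0 \<le> \<tau>"
    and \<alpha>: "0 \<le> \<alpha>" and \<rho>: "\<alpha> < ereal \<rho>" "ereal \<rho> < \<beta>" "2 * \<tau> * \<rho> < 1"
  shows "\<exists>b. (\<forall>z. 2 * \<tau> * norm z < 1 \<longrightarrow> summable (\<lambda>n. b n * z ^ n)) \<and>
             (\<forall>r\<in>einterval \<alpha> \<beta>. 2 * \<tau> * r < 1 \<longrightarrow> (\<lambda>n. b n * of_real r ^ n) sums (of_real r ^ (2 * m) * g 0 r)) \<and>
             (\<forall>n<2*m. even n \<longrightarrow> b n = 0)"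
  using assms(1)
proof (induction m arbitrary: g g')
  case 0
  have "is_interval (einterval \<alpha> \<beta>)" "einterval \<alpha> \<beta> \<subseteq> {0<..}"
    using is_interval_einterval einterval_subset_pos[OF \<alpha>] by auto
  from bessel_tower_0_power_series[OF 0 open_einterval this \<tau>, of \<rho>] show ?case
    using \<rho> by (auto simp: einterval_iff)
next
  case (Suc m)
  have "\<alpha> < \<beta>" using \<rho> by simp
  then obtain h h' where h: "bessel_tower m \<tau> (einterval \<alpha> \<beta>) h h'" "h' 0 = (\<lambda>r. r *\<^sub>R g 0 r)"
    using bessel_tower_descent[OF Suc.prems \<tau> \<alpha>] by blast
  from Suc.IH[OF h(1)] obtain b where
    b: "\<And>z. 2 * \<tau> * norm z < 1 \<Longrightarrow> summable (\<lambda>n. b n * z ^ n)"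
    and bh: "\<And>r. r \<in> einterval \<alpha> \<beta> \<Longrightarrow> 2 * \<tau> * r < 1 \<Longrightarrow> (\<lambda>n. b n * of_real r ^ n) sums (of_real r ^ (2 * m) * h 0 r)"
    and b0: "\<And>n. n < 2 * m \<Longrightarrow> even n \<Longrightarrow> b n = 0"
    by blast
  define B where "B z = (\<Sum>n. b n * z ^ n)" for z
  have larger: "\<exists>K. norm z < norm K \<and> summable (\<lambda>n. b n * K ^ n)" if z: "2 * \<tau> * norm z < 1" for z
  proof -
    obtain s where s: "norm z < s" "2 * \<tau> * s < 1"
      using increase_below_reciprocal[of "2 * \<tau>" "norm z"] z \<tau> by (auto simp: mult.commute)
    have "s > 0" using s(1) norm_ge_zero[of z] by linarith
    thus ?thesis using s b[of "of_real s"] by (intro exI[of _ "of_real s"]) auto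
  qed
  have dB: "(B has_field_derivative (\<Sum>n. diffs b n * z ^ n)) (at z)"
    and nb: "(\<lambda>n. of_nat n * b n * z ^ n) sums (z * (\<Sum>n. diffs b n * z ^ n))"
    if z: "2 * \<tau> * norm z < 1" for z
  proof -
    obtain K where K: "norm z < norm K" "summable (\<lambda>n. b n * K ^ n)" using larger[OF z] by blast
    show "(B has_field_derivative (\<Sum>n. diffs b n * z ^ n)) (at z)"
      unfolding B_def[abs_def] by (rule termdiffs_strong[OF K(2,1)])
    have "summable (\<lambda>n. diffs b n * z ^ n)"
      by (rule termdiff_converges[OF K(1)]) (metis K(2) powser_inside)
    from sums_mult[OF diffs_equiv[OF this], of z]
    show "(\<lambda>n. of_nat n * b n * z ^ n) sums (z * (\<Sum>n. diffs b n * z ^ n))"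
      by (rule sums_cong[THEN iffD1, rotated]) (auto simp: algebra_simps power_eq_if)
  qed
  \<comment> \<open>From B = r^(2m) h_0 and h_0' = r g_0 follows r B' - 2m B = r^(2m+2) g_0; on
    coefficients the left side multiplies by n - 2m.\<close>
  define b' where "b' n = (of_nat n - of_nat (2 * m)) * b n" for n
  have b': "(\<lambda>n. b' n * z ^ n) sums (z * (\<Sum>n. diffs b n * z ^ n) - of_nat (2 * m) * B z)"
    if z: "2 * \<tau> * norm z < 1" for z
  proof -
    have "(\<lambda>n. b n * z ^ n) sums B z" unfolding B_def using b[OF z] by (rule summable_sums)
    from sums_diff[OF nb[OF z] sums_mult[OF this, of "of_nat (2 * m)"]] show ?thesis
      by (simp add: b'_def algebra_simps)
  qed
  have "(\<lambda>n. b' n * of_real r ^ n) sums (of_real r ^ (2 * Suc m) * g 0 r)"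
    if r: "r \<in> einterval \<alpha> \<beta>" "2 * \<tau> * r < 1" for r
  proof -
    define R where "R = complex_of_real r"
    have r0: "r > 0" using einterval_subset_pos[OF \<alpha>] r(1) by auto
    have R: "2 * \<tau> * norm R < 1" "R \<noteq> 0" using r r0 by (auto simp: R_def)
    have d1: "((\<lambda>x. B (of_real x)) has_vector_derivative (\<Sum>n. diffs b n * R ^ n)) (at r)"
      unfolding R_def by (rule has_vector_derivative_real_field dB)+ (use R in \<open>simp add: R_def\<close>)
    have d2: "((\<lambda>x. of_real x ^ (2 * m) * h 0 x) has_vector_derivative
        (R ^ (2 * m) * (r *\<^sub>R g 0 r) + of_nat (2 * m) * R ^ (2 * m - 1) * h 0 r)) (at r)"
    proof -
      have "((\<lambda>z. z ^ (2 * m)) has_field_derivative (of_nat (2 * m) * R ^ (2 * m - 1))) (at R)"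
        by (auto intro!: derivative_eq_intros)
      hence "((\<lambda>x. complex_of_real x ^ (2 * m)) has_vector_derivative of_nat (2 * m) * R ^ (2 * m - 1)) (at r)"
        using has_vector_derivative_real_field[of "\<lambda>z. z ^ (2 * m)"] unfolding R_def by blast
      moreover have "(h 0 has_vector_derivative r *\<^sub>R g 0 r) (at r)"
        using h(1) r fun_cong[OF h(2), of r] unfolding bessel_tower_def by metis
      ultimately show ?thesis
        unfolding R_def by (rule has_vector_derivative_mult)
    qed
    \<comment> \<open>The identity for \<open>B\<close> must hold on a neighbourhood of r before
      both sides can be differentiated there.\<close>
    obtain S where S: "open S" "r \<in> S" "\<And>x. x \<in> S \<Longrightarrow> B (of_real x) = of_real x ^ (2 * m) * h 0 x"
    proof -
      have "\<forall>\<^sub>F x in nhds r. x \<in> einterval \<alpha> \<beta>" using r open_einterval eventually_nhds by blast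
      moreover have "\<forall>\<^sub>F x in nhds r. x \<in> {x. 2 * \<tau> * x < 1}"
        using r by (intro eventually_nhds_in_open open_Collect_less continuous_intros) auto
      ultimately have "\<forall>\<^sub>F x in nhds r. B (of_real x) = of_real x ^ (2 * m) * h 0 x"
        by eventually_elim (use bh in \<open>auto simp: B_def sums_iff\<close>)
      thus thesis using that unfolding eventually_nhds by blast
    qed
    have eq: "(\<Sum>n. diffs b n * R ^ n) = R ^ (2 * m) * (r *\<^sub>R g 0 r) + of_nat (2 * m) * R ^ (2 * m - 1) * h 0 r"
      by (rule vector_derivative_unique_at[OF has_vector_derivative_transform_within_open[OF d1 S(1,2)] d2]) (rule S(3))
    have BR: "B R = R ^ (2 * m) * h 0 r"
      using bh[OF r] by (simp add: B_def sums_iff R_def)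
    have "R * (\<Sum>n. diffs b n * R ^ n) - of_nat (2 * m) * B R = R ^ (2 * Suc m) * g 0 r"
      unfolding eq BR by (cases m) (auto simp: algebra_simps scaleR_conv_of_real R_def power_eq_if)
    thus ?thesis using b'[OF R(1)] by (simp add: R_def)
  qed
  \<comment> \<open>The only new even index is n = 2m, where the factor vanishes. This also removes
    the integration constant in \<open>h 0\<close>, which contributes a multiple of z^(2m).\<close>
  moreover have "b' n = 0" if "n < 2 * Suc m" "even n" for n
    using that b0[of n] by (cases "n = 2 * m") (auto simp: b'_def elim!: evenE)
  moreover have "summable (\<lambda>n. b' n * z ^ n)" if "2 * \<tau> * norm z < 1" for z
    using b'[OF that] sums_summable by blast
  ultimately show ?case by blast
qed

section \<open>Weak solutions of the radial equation\<close>

text \<open>Test functions are obtained by integration on [A, B] but have to live on the whole line.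
  Vanishing values and slopes at both ends make the two pieces fit differentiably.\<close>

lemma has_vector_derivative_zero_extension:
  fixes f :: "real \<Rightarrow> 'b::real_normed_vector"
  assumes f: "\<And>s. s \<in> {A..B} \<Longrightarrow> (f has_vector_derivative f' s) (at s within {A..B})"
    and "f A = 0" "f B = 0" "f' A = 0" "f' B = 0"
  shows "((\<lambda>s. if s \<in> {A..B} then f s else 0) has_vector_derivative (if s \<in> {A..B} then f' s else 0)) (at s)"
proof -
  have ends: "x = A \<or> x = B" if "x \<in> closure (- {A..B})" "x \<in> {A..B}" for x
    using that by (auto simp: closure_complement interior_atLeastAtMost_real)
  have "{A..B} \<union> closure {A..B} \<inter> closure (- {A..B}) = {A..B}" by auto
  with assms ends show ?thesis
    by (intro has_vector_derivative_If_within_closures[where u = UNIV and T = "- {A..B}", simplified])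
       (auto intro: f has_vector_derivative_const)
qed

lemma continuous_on_zero_extension:
  fixes f :: "real \<Rightarrow> 'b::real_normed_vector"
  assumes f: "continuous_on {A..B} f" and "f A = 0" "f B = 0" "A \<le> B"
  shows "continuous_on UNIV (\<lambda>s. if s \<in> {A..B} then f s else 0)"
proof -
  have "continuous_on ({A..B} \<union> ({..A} \<union> {B..})) (\<lambda>s. if s \<in> {A..B} then f s else 0)"
    by (rule continuous_on_If) (use assms in \<open>auto simp: not_le\<close>)
  moreover have "{A..B} \<union> ({..A} \<union> {B..}) = UNIV" using \<open>A \<le> B\<close> by auto
  ultimately show ?thesis by simp
qed

text \<open>The weight is positive inside, so it loses no information there, and it vanishes at both
  ends, so that test functions carrying it can be continued by zero.\<close>

lemma weighted_integral_eq_0_imp_zero: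
  fixes f :: "real \<Rightarrow> real"
  assumes f: "continuous_on {A..B} f" "\<And>s. s \<in> {A..B} \<Longrightarrow> 0 \<le> f s"
    and int: "integral {A..B} (\<lambda>s. (s - A) * (B - s) * f s) = 0" and s: "s \<in> {A<..<B}"
  shows "f s = 0"
proof -
  have "(\<forall>x\<in>{A..B}. (x - A) * (B - x) * f x = 0)"
    using f int s by (subst (asm) integral_eq_0_iff) (auto intro!: continuous_intros)
  thus ?thesis using s by auto
qed

text \<open>Gram-Schmidt for the weighted inner product: \<open>S\<close> is centred to become
  orthogonal to 1, and \<open>u\<close> is projected onto the resulting pair. Non-constancy of
  \<open>S\<close> keeps the second basis vector nonzero.\<close>

lemma weighted_orthogonal_decomposition:
  fixes u :: "real \<Rightarrow> complex" and S :: "real \<Rightarrow> real"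
  assumes "A < B" and u: "continuous_on {A..B} u" and S: "continuous_on {A..B} S"
    and nonconst: "\<not> (\<exists>c. \<forall>s\<in>{A<..<B}. S s = c)"
  shows "\<exists>c1 c2. integral {A..B} (\<lambda>s. of_real ((s - A) * (B - s)) * (u s - c1 - c2 * of_real (S s))) = 0 \<and>
     integral {A..B} (\<lambda>s. of_real ((s - A) * (B - s)) * (u s - c1 - c2 * of_real (S s)) * of_real (S s)) = 0"
proof -
  define I where "I f = integral {A..B} (\<lambda>s. of_real ((s - A) * (B - s)) * f s)" for f :: "real \<Rightarrow> complex"
  have I_add: "I (\<lambda>s. f s + g s) = I f + I g" and I_diff: "I (\<lambda>s. f s - g s) = I f - I g"
    if "continuous_on {A..B} f" "continuous_on {A..B} g" for f g
    unfolding I_def distrib_left right_diff_distrib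
    by (intro integral_add integral_diff integrable_continuous_interval continuous_intros that)+
  have I_mult: "I (\<lambda>s. c * f s) = c * I f" for c f
    unfolding I_def by (subst mult.left_commute) simp
  have I_real: "I (\<lambda>s. of_real (f s)) = of_real (integral {A..B} (\<lambda>s. (s - A) * (B - s) * f s))"
    if "continuous_on {A..B} f" for f
  proof -
    have "(\<lambda>s. (s - A) * (B - s) * f s) integrable_on {A..B}"
      by (intro integrable_continuous_interval continuous_intros that)
    from integral_linear[OF this bounded_linear_of_real[where ?'a = complex]]
    show ?thesis by (simp add: I_def o_def)
  qed
  \<comment> \<open>The weighted mean of \<open>S\<close>, so that \<open>T\<close> below is
    orthogonal to 1.\<close>
  define c where "c = integral {A..B} (\<lambda>s. (s - A) * (B - s) * S s) / integral {A..B} (\<lambda>s. (s - A) * (B - s) * 1)"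
  define T where "T s = S s - c" for s
  have T: "continuous_on {A..B} T" unfolding T_def by (intro continuous_intros S)
  have I1: "I (\<lambda>_. 1) \<noteq> 0"
  proof
    assume "I (\<lambda>_. 1) = 0"
    hence "integral {A..B} (\<lambda>s. (s - A) * (B - s) * 1) = 0"
      using I_real[of "\<lambda>_. 1"] by simp
    from weighted_integral_eq_0_imp_zero[OF _ _ this, of "(A + B) / 2"] \<open>A < B\<close> show False by simp
  qed
  have IT2: "I (\<lambda>s. of_real ((T s)\<^sup>2)) \<noteq> 0"
  proof
    assume "I (\<lambda>s. of_real ((T s)\<^sup>2)) = 0"
    moreover have T2: "continuous_on {A..B} (\<lambda>s. (T s)\<^sup>2)" by (intro continuous_intros T)
    ultimately have "integral {A..B} (\<lambda>s. (s - A) * (B - s) * (T s)\<^sup>2) = 0"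
      using I_real[OF T2] by simp
    from weighted_integral_eq_0_imp_zero[OF T2 _ this]
    have "(T s)\<^sup>2 = 0" if "s \<in> {A<..<B}" for s using that by simp
    thus False using nonconst by (auto simp: T_def)
  qed
  have cT: "continuous_on {A..B} (\<lambda>s. complex_of_real (T s))" by (intro continuous_intros T)
  have cS: "continuous_on {A..B} (\<lambda>s. complex_of_real (S s))" by (intro continuous_intros S)
  have IT: "I (\<lambda>s. of_real (T s)) = 0"
  proof -
    have "I (\<lambda>s. of_real (T s)) = I (\<lambda>s. of_real (S s)) - of_real c * I (\<lambda>_. 1)"
      using I_diff[OF cS, of "\<lambda>s. of_real c * 1"] by (simp only: I_mult) (simp add: T_def)
    thus ?thesis
      using I1 I_real[OF S] I_real[of "\<lambda>_. 1"] by (simp add: c_def)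
  qed
  define d1 d2 where "d1 = I u / I (\<lambda>_. 1)" and "d2 = I (\<lambda>s. u s * of_real (T s)) / I (\<lambda>s. of_real ((T s)\<^sup>2))"
  define e where "e s = u s - d1 - d2 * of_real (T s)" for s
  have ce: "continuous_on {A..B} e" unfolding e_def by (intro continuous_intros u cT)
  have "I e = I u - d1 * I (\<lambda>_. 1) - d2 * I (\<lambda>s. of_real (T s))"
  proof -
    have "I e = I (\<lambda>s. u s - d1 * 1) - I (\<lambda>s. d2 * of_real (T s))"
      unfolding e_def mult_1_right by (intro I_diff continuous_intros u cT)
    also have "I (\<lambda>s. u s - d1 * 1) = I u - I (\<lambda>s. d1 * 1)"
      by (intro I_diff continuous_intros u)
    finally show ?thesis by (simp only: I_mult)
  qed
  hence Ie: "I e = 0" using IT I1 by (simp add: d1_def)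
  have "I (\<lambda>s. e s * of_real (T s)) = I (\<lambda>s. u s * of_real (T s)) - d1 * I (\<lambda>s. of_real (T s)) - d2 * I (\<lambda>s. of_real ((T s)\<^sup>2))"
  proof -
    have "I (\<lambda>s. e s * of_real (T s)) = I (\<lambda>s. u s * of_real (T s) - d1 * of_real (T s) - d2 * of_real ((T s)\<^sup>2))"
      by (rule arg_cong[where f = I]) (auto simp: e_def algebra_simps power2_eq_square)
    also have "\<dots> = I (\<lambda>s. u s * of_real (T s) - d1 * of_real (T s)) - I (\<lambda>s. d2 * of_real ((T s)\<^sup>2))"
      by (intro I_diff continuous_intros u T)
    also have "I (\<lambda>s. u s * of_real (T s) - d1 * of_real (T s)) = I (\<lambda>s. u s * of_real (T s)) - I (\<lambda>s. d1 * of_real (T s))"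
      by (intro I_diff continuous_intros u T)
    finally show ?thesis by (simp only: I_mult)
  qed
  hence IeT: "I (\<lambda>s. e s * of_real (T s)) = 0" using IT IT2 by (simp add: d2_def)
  have "I (\<lambda>s. e s * of_real (S s)) = I (\<lambda>s. e s * of_real (T s) + of_real c * e s)"
    by (simp add: T_def algebra_simps)
  also have "\<dots> = I (\<lambda>s. e s * of_real (T s)) + I (\<lambda>s. of_real c * e s)"
    by (intro I_add continuous_intros ce T)
  also have "\<dots> = 0" by (simp add: I_mult Ie IeT)
  finally have IeS: "I (\<lambda>s. e s * of_real (S s)) = 0" .
  \<comment> \<open>Translates the projection from the basis 1, \<open>T\<close> back to 1,
    \<open>S\<close>.\<close>
  have e: "e = (\<lambda>s. u s - (d1 - d2 * of_real c) - d2 * of_real (S s))"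
    by (auto simp: e_def T_def algebra_simps)
  show ?thesis
    using Ie IeS unfolding e I_def by (intro exI[of _ "d1 - d2 * of_real c"] exI[of _ d2]) (simp add: mult.assoc)
qed

text \<open>Regularity of weak solutions in one dimension: subtracting a classical solution, one is left
  with \<open>u\<close> orthogonal to every \<open>\<theta>\<close> with vanishing moments against \<open>1\<close> and
  \<open>S = \<integral> s powr (-2m)\<close>; testing with the (weighted, conjugated) part of \<open>u\<close> orthogonal to \<open>1\<close>
  and \<open>S\<close> shows that this part is zero.\<close>

lemma weak_bessel_equation:
  fixes g g1 :: "real \<Rightarrow> complex" and m :: nat
  assumes AB: "0 < A" "A < B"
    and g: "continuous_on {A..B} g" and g1: "continuous_on {A..B} g1"
    and weak: "\<And>\<phi> \<phi>' \<phi>''. (\<And>s. (\<phi> has_vector_derivative \<phi>' s) (at s)) \<Longrightarrow>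
       (\<And>s. (\<phi>' has_vector_derivative \<phi>'' s) (at s)) \<Longrightarrow> continuous_on UNIV \<phi>'' \<Longrightarrow>
       (\<And>s. s \<notin> {A<..<B} \<Longrightarrow> \<phi> s = 0 \<and> \<phi>' s = 0 \<and> \<phi>'' s = 0) \<Longrightarrow>
       integral {A..B} (\<lambda>s. s ^ (2 * m) *\<^sub>R (g1 s * \<phi> s)) =
       integral {A..B} (\<lambda>s. s ^ (2 * m) *\<^sub>R (g s * (\<phi>'' s + (2 * real m / s) *\<^sub>R \<phi>' s)))"
  shows "\<exists>g'. \<forall>s\<in>{A<..<B}. (g has_vector_derivative g' s) (at s) \<and>
     (g' has_vector_derivative (g1 s - (2 * real m / s) *\<^sub>R g' s)) (at s)"
proof -
  define p where "p s = s ^ (2 * m)" for s :: real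
  have p: "p s > 0" if "s \<in> {A..B}" for s using that AB by (simp add: p_def)
  have p0: "p s \<noteq> 0" if "s \<in> {A..B}" for s using p[OF that] by simp
  have cp: "continuous_on {A..B} p" unfolding p_def by (intro continuous_intros)
  have dp: "((\<lambda>s. inverse (p s)) has_field_derivative (- (2 * real m / s) * inverse (p s))) (at s within X)"
    if "s \<in> {A..B}" for s X
  proof -
    have s0: "s \<noteq> 0" using that AB by simp
    have "((\<lambda>s. inverse (p s)) has_field_derivative
        - (inverse (s ^ (2 * m)) * (real (2 * m) * s ^ (2 * m - 1)) * inverse (s ^ (2 * m)))) (at s within X)"
      unfolding p_def using s0 by (auto intro!: derivative_eq_intros)
    moreover have "real (2 * m) * s ^ (2 * m - 1) = 2 * real m / s * s ^ (2 * m)"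
      using s0 by (cases m) auto
    moreover have "- (inverse q * (c * q) * inverse q) = - c * inverse q" if "q \<noteq> 0" for c q :: real
      using that by simp
    ultimately show ?thesis using s0 p0[OF that] by (simp only: p_def not_False_eq_True)
  qed
  \<comment> \<open>\<open>K\<close> is a classical solution: (p K')' = p g1, integrated twice.
    \<open>S\<close> spans, together with 1, the solutions of (p S')' = 0.\<close>
  define V where "V s = integral {A..s} (\<lambda>s. p s *\<^sub>R g1 s)" for s
  define K' where "K' s = inverse (p s) *\<^sub>R V s" for s
  define K where "K s = integral {A..s} K'" for s
  define S where "S s = integral {A..s} (\<lambda>s. inverse (p s))" for s
  have dV: "(V has_vector_derivative p s *\<^sub>R g1 s) (at s within {A..B})" if "s \<in> {A..B}" for s
    unfolding V_def using that by (intro integral_has_vector_derivative continuous_intros cp g1)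
  have cV: "continuous_on {A..B} V"
    by (rule continuous_on_vector_derivative[OF dV])
  have cK': "continuous_on {A..B} K'"
    unfolding K'_def using p0 by (intro continuous_intros cp cV) auto
  have dK: "(K has_vector_derivative K' s) (at s within {A..B})" if "s \<in> {A..B}" for s
    unfolding K_def using that by (intro integral_has_vector_derivative cK')
  have cK: "continuous_on {A..B} K"
    by (rule continuous_on_vector_derivative[OF dK])
  have dS: "(S has_vector_derivative inverse (p s)) (at s within {A..B})" if "s \<in> {A..B}" for s
    unfolding S_def using that p0 by (intro integral_has_vector_derivative continuous_intros cp) auto
  have cS: "continuous_on {A..B} S"
    by (rule continuous_on_vector_derivative[OF dS])
  have int: "s \<in> {A..B}" "at s within {A..B} = at s" if "s \<in> {A<..<B}" for s
    using that by (auto intro!: at_within_interior)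
  have nonconst: "\<not> (\<exists>c. \<forall>s\<in>{A<..<B}. S s = c)"
  proof
    assume "\<exists>c. \<forall>s\<in>{A<..<B}. S s = c"
    then obtain c where c: "\<And>s. s \<in> {A<..<B} \<Longrightarrow> S s = c" by blast
    define t where "t = (A + B) / 2"
    have t: "t \<in> {A<..<B}" using AB by (simp add: t_def)
    have "(S has_vector_derivative inverse (p t)) (at t)" using dS[OF int(1)[OF t]] int(2)[OF t] by simp
    moreover have "(S has_vector_derivative 0) (at t)"
      by (rule has_vector_derivative_transform_within_open[where f = "\<lambda>_. c" and S = "{A<..<B}"])
         (use t c in auto)
    ultimately have "inverse (p t) = 0" by (rule vector_derivative_unique_at)
    thus False using p0 int[OF t] by simp
  qed
  define u where "u s = g s - K s" for s
  have cu: "continuous_on {A..B} u" unfolding u_def by (intro continuous_intros g cK)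
  obtain c1 c2 where
    c: "integral {A..B} (\<lambda>s. of_real ((s - A) * (B - s)) * (u s - c1 - c2 * of_real (S s))) = 0"
       "integral {A..B} (\<lambda>s. of_real ((s - A) * (B - s)) * (u s - c1 - c2 * of_real (S s)) * of_real (S s)) = 0"
    using weighted_orthogonal_decomposition[OF AB(2) cu cS nonconst] by blast
  define e where "e s = u s - c1 - c2 * of_real (S s)" for s
  have ce: "continuous_on {A..B} e" unfolding e_def by (intro continuous_intros cu cS)
  \<comment> \<open>The conjugate turns the integral of \<open>e * \<theta>\<close> into a weighted
    square norm of \<open>e\<close>; the weight makes \<theta>, and hence \<phi>'', vanish at the
    ends.\<close>
  define \<theta> where "\<theta> s = of_real ((s - A) * (B - s)) * cnj (e s)" for s
  have c\<theta>: "continuous_on {A..B} \<theta>" unfolding \<theta>_def by (intro continuous_intros ce)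
  have \<theta>1: "integral {A..B} \<theta> = 0"
  proof -
    have "(\<lambda>s. of_real ((s - A) * (B - s)) * e s) integrable_on {A..B}"
      by (intro integrable_continuous_interval continuous_intros ce)
    from integral_linear[OF this bounded_linear_cnj] c(1) show ?thesis
      by (simp add: o_def \<theta>_def[abs_def] e_def)
  qed
  have \<theta>S: "integral {A..B} (\<lambda>s. S s *\<^sub>R \<theta> s) = 0"
  proof -
    have "(\<lambda>s. of_real ((s - A) * (B - s)) * e s * of_real (S s)) integrable_on {A..B}"
      by (intro integrable_continuous_interval continuous_intros ce cS)
    from integral_linear[OF this bounded_linear_cnj] c(2) show ?thesis
      by (simp add: o_def \<theta>_def[abs_def] e_def scaleR_conv_of_real mult_ac)
  qed
  define W where "W s = integral {A..s} \<theta>" for s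
  have dW: "(W has_vector_derivative \<theta> s) (at s within {A..B})" if "s \<in> {A..B}" for s
    unfolding W_def using that by (intro integral_has_vector_derivative c\<theta>)
  have cW: "continuous_on {A..B} W"
    by (rule continuous_on_vector_derivative[OF dW])
  have W0: "W A = 0" "W B = 0" using \<theta>1 by (auto simp: W_def)
  \<comment> \<open>The test function solves (p \<phi>')' = \<theta>. The vanishing moment against 1
    gives \<phi>'(B) = 0, and the one against \<open>S\<close> gives \<phi>(B) = 0.\<close>
  define \<phi>' where "\<phi>' s = inverse (p s) *\<^sub>R W s" for s
  define \<phi> where "\<phi> s = integral {A..s} \<phi>'" for s
  define \<phi>'' where "\<phi>'' s = inverse (p s) *\<^sub>R \<theta> s - (2 * real m / s) *\<^sub>R \<phi>' s" for s
  have c\<phi>': "continuous_on {A..B} \<phi>'"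
    unfolding \<phi>'_def using p0 by (intro continuous_intros cp cW) auto
  have d\<phi>: "(\<phi> has_vector_derivative \<phi>' s) (at s within {A..B})" if "s \<in> {A..B}" for s
    unfolding \<phi>_def using that by (intro integral_has_vector_derivative c\<phi>')
  have d\<phi>': "(\<phi>' has_vector_derivative \<phi>'' s) (at s within {A..B})" if "s \<in> {A..B}" for s
  proof -
    have "((\<lambda>s. inverse (p s) *\<^sub>R W s) has_vector_derivative
       inverse (p s) *\<^sub>R \<theta> s + (- (2 * real m / s) * inverse (p s)) *\<^sub>R W s) (at s within {A..B})"
      using that by (intro has_vector_derivative_scaleR dp dW)
    thus ?thesis by (simp add: \<phi>'_def[abs_def] \<phi>''_def)
  qed
  have c\<phi>'': "continuous_on {A..B} \<phi>''"
    unfolding \<phi>''_def using p0 AB by (intro continuous_intros cp c\<phi>' c\<theta>) auto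
  have ends: "\<phi>' A = 0" "\<phi>' B = 0" "\<phi>'' A = 0" "\<phi>'' B = 0" "\<phi> A = 0"
    by (auto simp: \<phi>'_def W0 \<phi>''_def \<theta>_def \<phi>_def)
  \<comment> \<open>Integration by parts: the integral of S \<theta> equals minus that of W / p,
    which is -\<phi>(B).\<close>
  have "\<phi> B = 0"
  proof -
    have "((\<lambda>s. S s *\<^sub>R W s - \<phi> s) has_vector_derivative S s *\<^sub>R \<theta> s + inverse (p s) *\<^sub>R W s - \<phi>' s) (at s within {A..B})"
      if "s \<in> {A..B}" for s
      using dS[OF that] that
      by (intro has_vector_derivative_diff has_vector_derivative_scaleR dW d\<phi>)
         (auto simp: has_real_derivative_iff_has_vector_derivative)
    hence "((\<lambda>s. S s *\<^sub>R \<theta> s + inverse (p s) *\<^sub>R W s - \<phi>' s) has_integral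
        (S B *\<^sub>R W B - \<phi> B) - (S A *\<^sub>R W A - \<phi> A)) {A..B}"
      using AB by (intro fundamental_theorem_of_calculus) auto
    hence "((\<lambda>s. S s *\<^sub>R \<theta> s) has_integral - \<phi> B) {A..B}"
      by (simp add: \<phi>'_def W0 ends)
    thus ?thesis using \<theta>S by (simp add: integral_unique)
  qed
  \<comment> \<open>The boundary terms vanish and K' W = V W / p = V \<phi>' cancels the mixed
    terms, so differentiating K W - V \<phi> does two integrations by parts at once.\<close>
  have "integral {A..B} (\<lambda>s. K s * \<theta> s) = integral {A..B} (\<lambda>s. p s *\<^sub>R (g1 s * \<phi> s))"
  proof -
    have "((\<lambda>s. K s * W s - V s * \<phi> s) has_vector_derivative
        (K s * \<theta> s + K' s * W s - (V s * \<phi>' s + (p s *\<^sub>R g1 s) * \<phi> s))) (at s within {A..B})"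
      if "s \<in> {A..B}" for s
      using that by (intro has_vector_derivative_diff has_vector_derivative_mult dK dW dV d\<phi>)
    hence "((\<lambda>s. K s * \<theta> s + K' s * W s - (V s * \<phi>' s + (p s *\<^sub>R g1 s) * \<phi> s)) has_integral
        (K B * W B - V B * \<phi> B) - (K A * W A - V A * \<phi> A)) {A..B}"
      using AB by (intro fundamental_theorem_of_calculus) auto
    hence "((\<lambda>s. K s * \<theta> s - p s *\<^sub>R (g1 s * \<phi> s)) has_integral 0) {A..B}"
      by (simp add: W0 ends \<open>\<phi> B = 0\<close> K'_def \<phi>'_def)
    moreover have "integral {A..B} (\<lambda>s. K s * \<theta> s - p s *\<^sub>R (g1 s * \<phi> s)) =
        integral {A..B} (\<lambda>s. K s * \<theta> s) - integral {A..B} (\<lambda>s. p s *\<^sub>R (g1 s * \<phi> s))"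
      by (intro integral_diff integrable_continuous_interval continuous_intros cK c\<theta> cp g1
          continuous_on_vector_derivative[OF d\<phi>])
    ultimately show ?thesis by (simp add: integral_unique)
  qed
  also have "\<dots> = integral {A..B} (\<lambda>s. g s * \<theta> s)"
  proof -
    define ext where "ext f s = (if s \<in> {A..B} then f s else 0)" for f :: "real \<Rightarrow> complex" and s
    have ext1: "(ext \<phi> has_vector_derivative ext \<phi>' s) (at s)" for s
      unfolding ext_def by (rule has_vector_derivative_zero_extension[OF d\<phi>]) (simp_all add: ends \<open>\<phi> B = 0\<close>)
    have ext2: "(ext \<phi>' has_vector_derivative ext \<phi>'' s) (at s)" for s
      unfolding ext_def by (rule has_vector_derivative_zero_extension[OF d\<phi>']) (simp_all add: ends)
    have ext3: "continuous_on UNIV (ext \<phi>'')"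
      unfolding ext_def using AB ends by (intro continuous_on_zero_extension c\<phi>'') auto
    have "integral {A..B} (\<lambda>s. s ^ (2 * m) *\<^sub>R (g1 s * ext \<phi> s)) =
        integral {A..B} (\<lambda>s. s ^ (2 * m) *\<^sub>R (g s * (ext \<phi>'' s + (2 * real m / s) *\<^sub>R ext \<phi>' s)))"
      by (rule weak[OF ext1 ext2 ext3]) (auto simp: ext_def ends \<open>\<phi> B = 0\<close> le_less)
    moreover have "integral {A..B} (\<lambda>s. s ^ (2 * m) *\<^sub>R (g1 s * ext \<phi> s)) = integral {A..B} (\<lambda>s. p s *\<^sub>R (g1 s * \<phi> s))"
      by (intro integral_cong) (auto simp: ext_def p_def)
    moreover have "integral {A..B} (\<lambda>s. s ^ (2 * m) *\<^sub>R (g s * (ext \<phi>'' s + (2 * real m / s) *\<^sub>R ext \<phi>' s)))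
        = integral {A..B} (\<lambda>s. g s * \<theta> s)"
    proof (intro integral_cong)
      fix s assume "s \<in> {A..B}"
      thus "s ^ (2 * m) *\<^sub>R (g s * (ext \<phi>'' s + (2 * real m / s) *\<^sub>R ext \<phi>' s)) = g s * \<theta> s"
        using p0[of s] by (simp add: ext_def \<phi>''_def flip: p_def)
    qed
    ultimately show ?thesis by simp
  qed
  finally have u\<theta>: "integral {A..B} (\<lambda>s. u s * \<theta> s) = 0"
  proof -
    assume *: "integral {A..B} (\<lambda>s. K s * \<theta> s) = integral {A..B} (\<lambda>s. g s * \<theta> s)"
    have "integral {A..B} (\<lambda>s. u s * \<theta> s) = integral {A..B} (\<lambda>s. g s * \<theta> s) - integral {A..B} (\<lambda>s. K s * \<theta> s)"
      unfolding u_def left_diff_distrib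
      by (intro integral_diff integrable_continuous_interval continuous_intros g cK c\<theta>)
    thus ?thesis using * by simp
  qed
  \<comment> \<open>\<open>e\<close> differs from \<open>u\<close> by a combination of 1 and
    \<open>S\<close>, and \<theta> annihilates \<open>u\<close>, 1 and \<open>S\<close>.\<close>
  have "integral {A..B} (\<lambda>s. e s * \<theta> s) = integral {A..B} (\<lambda>s. u s * \<theta> s - c1 * \<theta> s) - integral {A..B} (\<lambda>s. c2 * (S s *\<^sub>R \<theta> s))"
  proof (subst integral_diff[symmetric])
    show "integral {A..B} (\<lambda>s. e s * \<theta> s) = integral {A..B} (\<lambda>s. u s * \<theta> s - c1 * \<theta> s - c2 * (S s *\<^sub>R \<theta> s))"
      by (simp add: e_def algebra_simps scaleR_conv_of_real)
  qed (intro integrable_continuous_interval continuous_intros cu c\<theta> cS)+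
  also have "integral {A..B} (\<lambda>s. u s * \<theta> s - c1 * \<theta> s) = integral {A..B} (\<lambda>s. u s * \<theta> s) - integral {A..B} (\<lambda>s. c1 * \<theta> s)"
    by (intro integral_diff integrable_continuous_interval continuous_intros cu c\<theta>)
  also have "integral {A..B} (\<lambda>s. c2 * (S s *\<^sub>R \<theta> s)) = c2 * integral {A..B} (\<lambda>s. S s *\<^sub>R \<theta> s)"
    by (rule integral_mult_right)
  finally have e\<theta>: "integral {A..B} (\<lambda>s. e s * \<theta> s) = 0"
    using \<theta>S \<theta>1 u\<theta> by simp
  have int0: "integral {A..B} (\<lambda>s. (s - A) * (B - s) * (norm (e s))\<^sup>2) = 0"
  proof -
    have "(\<lambda>s. (s - A) * (B - s) * (norm (e s))\<^sup>2) integrable_on {A..B}"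
      by (intro integrable_continuous_interval continuous_intros ce)
    from integral_linear[OF this bounded_linear_of_real[where ?'a = complex]]
    have "of_real (integral {A..B} (\<lambda>s. (s - A) * (B - s) * (norm (e s))\<^sup>2))
        = integral {A..B} (\<lambda>s. complex_of_real ((s - A) * (B - s) * (norm (e s))\<^sup>2))"
      by (simp add: o_def)
    also have "\<dots> = integral {A..B} (\<lambda>s. e s * \<theta> s)"
      by (intro integral_cong) (simp only: \<theta>_def of_real_mult complex_norm_square mult_ac)
    finally show ?thesis using e\<theta> by simp
  qed
  have e0: "e s = 0" if "s \<in> {A<..<B}" for s
  proof -
    have "continuous_on {A..B} (\<lambda>s. (norm (e s))\<^sup>2)" by (intro continuous_intros ce)
    from weighted_integral_eq_0_imp_zero[OF this _ int0 that] show ?thesis by simp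
  qed
  \<comment> \<open>On the open interval g = K + c1 + c2 S, whose derivative this is.\<close>
  define g' where "g' s = K' s + c2 * of_real (inverse (p s))" for s
  have "(g has_vector_derivative g' s) (at s)" if s: "s \<in> {A<..<B}" for s
  proof -
    have "((\<lambda>s. K s + c1 + c2 * of_real (S s)) has_vector_derivative K' s + 0 + c2 * of_real (inverse (p s))) (at s)"
      using dK[OF int(1)[OF s]] dS[OF int(1)[OF s]] int(2)[OF s]
      by (intro has_vector_derivative_add has_vector_derivative_const
          bounded_linear.has_vector_derivative[OF bounded_linear_mult_right]
          bounded_linear.has_vector_derivative[OF bounded_linear_of_real]) auto
    hence "((\<lambda>s. K s + c1 + c2 * of_real (S s)) has_vector_derivative g' s) (at s)" by (simp add: g'_def)
    thus ?thesis
      by (rule has_vector_derivative_transform_within_open[where S = "{A<..<B}"])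
         (use s e0 in \<open>auto simp: e_def u_def algebra_simps\<close>)
  qed
  moreover have "(g' has_vector_derivative (g1 s - (2 * real m / s) *\<^sub>R g' s)) (at s)" if s: "s \<in> {A<..<B}" for s
  proof -
    have s': "s \<in> {A..B}" using s by simp
    have "((\<lambda>s. inverse (p s) *\<^sub>R (V s + c2)) has_vector_derivative
       inverse (p s) *\<^sub>R (p s *\<^sub>R g1 s + 0) + (- (2 * real m / s) * inverse (p s)) *\<^sub>R (V s + c2)) (at s)"
      using dV[OF s'] int(2)[OF s]
      by (intro has_vector_derivative_scaleR has_vector_derivative_add has_vector_derivative_const dp[OF s']) auto
    moreover have "(\<lambda>s. inverse (p s) *\<^sub>R (V s + c2)) = g'"
      by (auto simp: g'_def K'_def algebra_simps scaleR_conv_of_real)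
    moreover have "inverse (p s) *\<^sub>R (p s *\<^sub>R g1 s + 0) + (- (2 * real m / s) * inverse (p s)) *\<^sub>R (V s + c2)
        = g1 s - (2 * real m / s) *\<^sub>R (inverse (p s) *\<^sub>R (V s + c2))"
      using p0[OF s'] by (simp only: scaleR_scaleR scaleR_minus_left mult_minus_left) simp
    ultimately show ?thesis by (simp add: fun_eq_iff)
  qed
  ultimately show ?thesis by blast
qed

section \<open>Partial derivatives and Green's identity\<close>

lemma open_line_section:
  fixes x i :: "'a::real_normed_vector"
  assumes "open G" "x \<in> G"
  obtains T :: "real set" where "open T" "0 \<in> T" "\<And>t. t \<in> T \<Longrightarrow> x + t *\<^sub>R i \<in> G"
proof -
  have "open ((\<lambda>t::real. x + t *\<^sub>R i) -` G)"
    using \<open>open G\<close> by (intro open_vimage continuous_intros)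
  thus thesis by (rule that) (use assms(2) in auto)
qed

lemma partial_cong:
  assumes "open G" "x \<in> G" "\<And>y. y \<in> G \<Longrightarrow> f y = g y"
  shows "partial i f x = partial i g x"
proof -
  obtain T :: "real set" where "open T" "0 \<in> T" "\<And>t. t \<in> T \<Longrightarrow> x + t *\<^sub>R i \<in> G"
    using open_line_section[OF assms(1,2)] by metis
  hence "\<forall>\<^sub>F t in nhds 0. x + t *\<^sub>R i \<in> G"
    unfolding eventually_nhds by blast
  thus ?thesis
    unfolding partial_def
    by (intro vector_derivative_cong_eq) (auto elim!: eventually_mono intro: assms(3))
qed

lemma has_vector_derivative_partial:
  "(\<lambda>t. g (x + t *\<^sub>R i)) differentiable at 0 \<Longrightarrow> ((\<lambda>t. g (x + t *\<^sub>R i)) has_vector_derivative partial i g x) (at 0)"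
  unfolding partial_def by (rule vector_derivative_works[THEN iffD1])

lemma partialI:
  "((\<lambda>t. g (x + t *\<^sub>R i)) has_vector_derivative g') (at 0) \<Longrightarrow> partial i g x = g'"
  unfolding partial_def by (rule vector_derivative_at)

lemma partials_append: "partials (is @ js) g = partials is (partials js g)"
  by (induction "is") auto

lemma smooth_onD:
  assumes "smooth_on G g" "set is \<subseteq> Basis"
  shows "continuous_on G (partials is g)"
    and "x \<in> G \<Longrightarrow> i \<in> Basis \<Longrightarrow> (\<lambda>t. partials is g (x + t *\<^sub>R i)) differentiable at 0"
    and "x \<in> G \<Longrightarrow> i \<in> Basis \<Longrightarrow>
      ((\<lambda>t. partials is g (x + t *\<^sub>R i)) has_vector_derivative partials (i # is) g x) (at 0)"
  using assms unfolding smooth_on_def by (auto intro: has_vector_derivative_partial)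

lemma smooth_on_partial:
  assumes "smooth_on G g" "i \<in> Basis"
  shows "smooth_on G (partial i g)"
proof -
  have "partials is (partial i g) = partials (is @ [i]) g" for "is"
    by (simp add: partials_append)
  thus ?thesis using assms unfolding smooth_on_def by simp
qed

text \<open>Outside \<open>G\<close> differentiability is unknown and \<open>partial\<close> is an
  unspecified value, so linearity is claimed on \<open>G\<close> only. Openness of \<open>G\<close>
  keeps the induction hypothesis valid on a short segment through x.\<close>

lemma partials_sum:
  assumes "open G" and f: "\<And>j. j \<in> J \<Longrightarrow> smooth_on G (f j)"
    and "set is \<subseteq> Basis" "x \<in> G"
  shows "partials is (\<lambda>x. \<Sum>j\<in>J. f j x) x = (\<Sum>j\<in>J. partials is (f j) x)"
  using assms(3,4)
proof (induction "is" arbitrary: x)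
  case (Cons i "is")
  have "partial i (partials is (\<lambda>x. \<Sum>j\<in>J. f j x)) x = partial i (\<lambda>x. \<Sum>j\<in>J. partials is (f j) x) x"
    using Cons by (intro partial_cong[OF \<open>open G\<close>]) auto
  also have "\<dots> = (\<Sum>j\<in>J. partials (i # is) (f j) x)"
    using Cons.prems f by (intro partialI has_vector_derivative_sum smooth_onD(3)) auto
  finally show ?case by simp
qed simp

lemma smooth_on_sum:
  assumes "open G" and f: "\<And>j. j \<in> J \<Longrightarrow> smooth_on G (f j)"
  shows "smooth_on G (\<lambda>x. \<Sum>j\<in>J. f j x)"
  unfolding smooth_on_def
proof (intro allI impI conjI ballI)
  fix "is" :: "'a list" assume "is": "set is \<subseteq> Basis"
  have "continuous_on G (\<lambda>x. \<Sum>j\<in>J. partials is (f j) x)"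
    using f "is" by (intro continuous_on_sum smooth_onD(1))
  thus "continuous_on G (partials is (\<lambda>x. \<Sum>j\<in>J. f j x))"
    using partials_sum[of G J f, OF assms "is"] by (subst continuous_on_cong[OF refl]) auto
  fix x i :: 'a assume x: "x \<in> G" and i: "i \<in> Basis"
  obtain T :: "real set" where T: "open T" "0 \<in> T" "\<And>t. t \<in> T \<Longrightarrow> x + t *\<^sub>R i \<in> G"
    using open_line_section[OF \<open>open G\<close> x] by metis
  have "((\<lambda>t. \<Sum>j\<in>J. partials is (f j) (x + t *\<^sub>R i)) has_vector_derivative (\<Sum>j\<in>J. partials (i # is) (f j) x)) (at 0)"
    using f "is" x i by (intro has_vector_derivative_sum smooth_onD(3))
  hence "((\<lambda>t. partials is (\<lambda>x. \<Sum>j\<in>J. f j x) (x + t *\<^sub>R i)) has_vector_derivative (\<Sum>j\<in>J. partials (i # is) (f j) x)) (at 0)"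
    by (rule has_vector_derivative_transform_within_open[OF _ T(1,2)])
       (simp add: partials_sum[of G J f, OF assms "is"] T(3))
  thus "(\<lambda>t. partials is (\<lambda>x. \<Sum>j\<in>J. f j x) (x + t *\<^sub>R i)) differentiable at 0"
    by (rule differentiableI_vector)
qed

lemma smooth_on_lap:
  assumes "open G" "smooth_on G g"
  shows "smooth_on G (lap g)"
  unfolding lap_def[abs_def] using assms by (intro smooth_on_sum smooth_on_partial)

lemma smooth_on_lap_iterate:
  assumes "open G" "smooth_on G g"
  shows "smooth_on G ((lap ^^ p) g)"
  by (induction p) (use assms smooth_on_lap in auto)

lemma integral_zero_outside:
  fixes f :: "'a::euclidean_space \<Rightarrow> 'b::banach"
  assumes "\<And>x. x \<notin> S \<Longrightarrow> f x = 0"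
  shows "integral S f = integral UNIV f"
proof -
  have "(\<lambda>x. if x \<in> S then f x else 0) = f" using assms by auto
  thus ?thesis using integral_restrict_UNIV[of S f] by simp
qed

lemma continuous_on_UNIV_of_support:
  fixes h :: "'a::topological_space \<Rightarrow> 'b::real_normed_vector"
  assumes "open G" "closed K" "K \<subseteq> G" and h: "continuous_on G h" "\<And>x. x \<notin> K \<Longrightarrow> h x = 0"
  shows "continuous_on UNIV h"
proof -
  have "continuous_on (- K) h \<longleftrightarrow> continuous_on (- K) (\<lambda>_. 0 :: 'b)"
    by (rule continuous_on_cong) (use h in auto)
  hence "continuous_on (G \<union> - K) h"
    using assms by (intro continuous_on_open_Un) (auto simp: open_Compl)
  moreover have "G \<union> - K = UNIV" using \<open>K \<subseteq> G\<close> by blast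
  ultimately show ?thesis by simp
qed

text \<open>Translation invariance: the integral of v(x + t i) does not depend on small t, and
  differentiating under the integral at t = 0 gives the claim.\<close>

lemma integral_partial_eq_0:
  fixes v v' :: "'a::euclidean_space \<Rightarrow> complex"
  assumes i: "i \<in> Basis"
    and v: "\<And>x. ((\<lambda>t. v (x + t *\<^sub>R i)) has_vector_derivative v' x) (at 0)"
    and cv: "continuous_on UNIV v" and cv': "continuous_on UNIV v'"
    and supp: "\<And>x. R < norm x \<Longrightarrow> v x = 0 \<and> v' x = 0"
  shows "integral UNIV v' = 0"
proof -
  \<comment> \<open>The margin 1 beyond the support keeps the box large enough for all shifts with
    |t| < 1.\<close>
  define M where "M = \<bar>R\<bar> + 1"
  define C :: "'a set" where "C = cbox (- (M *\<^sub>R One)) (M *\<^sub>R One)"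
  have C: "x \<in> C" if "norm x \<le> M" for x
    unfolding C_def mem_box
  proof
    fix b :: 'a assume b: "b \<in> Basis"
    hence "(\<Sum>Basis) \<bullet> b = 1" by (simp add: inner_sum_left inner_Basis)
    thus "- (M *\<^sub>R One) \<bullet> b \<le> x \<bullet> b \<and> x \<bullet> b \<le> M *\<^sub>R One \<bullet> b"
      using Basis_le_norm[OF b, of x] that by auto
  qed
  have shift: "integral C (\<lambda>x. v (x + t *\<^sub>R i)) = integral UNIV v" if "\<bar>t\<bar> < 1" for t
  proof -
    have out: "v x = 0" if "x \<notin> (\<lambda>x. x + t *\<^sub>R i) ` C" for x
    proof -
      have "x - t *\<^sub>R i \<notin> C" using that by (metis (no_types, lifting) diff_add_cancel imageI)
      hence "norm (x - t *\<^sub>R i) > M" using C not_le by blast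
      moreover have "norm (t *\<^sub>R i) < 1" using \<open>\<bar>t\<bar> < 1\<close> i by simp
      ultimately have "norm x > R"
        using norm_triangle_ineq4[of x "t *\<^sub>R i"] by (simp add: M_def)
      thus ?thesis using supp by blast
    qed
    have "integral C (\<lambda>x. v (x + t *\<^sub>R i)) = integral (cbox (- (M *\<^sub>R One) + t *\<^sub>R i) (M *\<^sub>R One + t *\<^sub>R i)) v"
      unfolding C_def using integral_shift_cbox[of "- (M *\<^sub>R One) + t *\<^sub>R i" "t *\<^sub>R i" "M *\<^sub>R One + t *\<^sub>R i" v] by simp
    also have "cbox (- (M *\<^sub>R One) + t *\<^sub>R i) (M *\<^sub>R One + t *\<^sub>R i) = (\<lambda>x. x + t *\<^sub>R i) ` C"
      unfolding C_def by (metis (no_types) add.commute cbox_translation image_cong)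
    also have "integral ((\<lambda>x. x + t *\<^sub>R i) ` C) v = integral UNIV v"
      using out by (intro integral_zero_outside)
    finally show ?thesis .
  qed
  have line: "((\<lambda>t. v (x + t *\<^sub>R i)) has_vector_derivative v' (x + t *\<^sub>R i)) (at t)" for x t
  proof -
    have "((\<lambda>s. v ((x + t *\<^sub>R i) + s *\<^sub>R i)) \<circ> (\<lambda>s. s - t) has_vector_derivative 1 *\<^sub>R v' (x + t *\<^sub>R i)) (at t)"
      by (rule vector_diff_chain_at) (use v in \<open>auto intro!: derivative_eq_intros\<close>)
    thus ?thesis by (simp add: o_def algebra_simps)
  qed
  have "((\<lambda>t. integral (cbox (- (M *\<^sub>R One)) (M *\<^sub>R One)) (\<lambda>x. v (x + t *\<^sub>R i))) has_vector_derivative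
      integral (cbox (- (M *\<^sub>R One)) (M *\<^sub>R One)) (\<lambda>x. v' (x + 0 *\<^sub>R i))) (at 0 within UNIV)"
  proof (rule leibniz_rule_vector_derivative)
    show "(\<lambda>x. v (x + t *\<^sub>R i)) integrable_on cbox (- (M *\<^sub>R One)) (M *\<^sub>R One)" for t
      by (intro integrable_continuous continuous_on_compose2[OF cv] continuous_intros) auto
    show "continuous_on (UNIV \<times> cbox (- (M *\<^sub>R One)) (M *\<^sub>R One)) (\<lambda>(t, x). v' (x + t *\<^sub>R i))"
      unfolding case_prod_unfold by (intro continuous_on_compose2[OF cv'] continuous_intros) auto
  qed (use line in auto)
  moreover have "((\<lambda>t. integral C (\<lambda>x. v (x + t *\<^sub>R i))) has_vector_derivative 0) (at 0)"
    by (rule has_vector_derivative_transform_within_open[where f = "\<lambda>_. integral UNIV v" and S = "{-1<..<1}"])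
       (use shift in auto)
  ultimately have "integral C v' = 0"
    unfolding C_def by (intro vector_derivative_unique_at) simp_all
  moreover have "integral C v' = integral UNIV v'"
  proof (rule integral_zero_outside)
    show "v' x = 0" if "x \<notin> C" for x
    proof -
      have "norm x > M" using that C not_le by blast
      thus ?thesis using supp[of x] by (simp add: M_def)
    qed
  qed
  ultimately show ?thesis by simp
qed

text \<open>In each direction the difference of the two integrands is the derivative of \<partial>f
  \<psi> - f \<partial>\<psi>, the product of first derivatives cancelling. That function has
  compact support, so its derivative integrates to 0.\<close>

lemma green_identity:
  fixes f :: "'a::euclidean_space \<Rightarrow> complex" and \<psi> \<psi>2 :: "'a \<Rightarrow> complex" and \<psi>i \<psi>ii :: "'a \<Rightarrow> 'a \<Rightarrow> complex"
  assumes G: "open G" and f: "smooth_on G f"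
    and K: "compact K" "K \<subseteq> G"
    and d1: "\<And>x i. x \<in> G \<Longrightarrow> i \<in> Basis \<Longrightarrow> ((\<lambda>t. \<psi> (x + t *\<^sub>R i)) has_vector_derivative \<psi>i i x) (at 0)"
    and d2: "\<And>x i. x \<in> G \<Longrightarrow> i \<in> Basis \<Longrightarrow> ((\<lambda>t. \<psi>i i (x + t *\<^sub>R i)) has_vector_derivative \<psi>ii i x) (at 0)"
    and c: "continuous_on G \<psi>" "\<And>i. i \<in> Basis \<Longrightarrow> continuous_on G (\<psi>i i)" "\<And>i. i \<in> Basis \<Longrightarrow> continuous_on G (\<psi>ii i)"
    and z: "\<And>x. x \<notin> K \<Longrightarrow> \<psi> x = 0" "\<And>x i. i \<in> Basis \<Longrightarrow> x \<notin> K \<Longrightarrow> \<psi>i i x = 0" "\<And>x i. i \<in> Basis \<Longrightarrow> x \<notin> K \<Longrightarrow> \<psi>ii i x = 0"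
  shows "integral UNIV (\<lambda>x. lap f x * \<psi> x) = integral UNIV (\<lambda>x. f x * (\<Sum>i\<in>Basis. \<psi>ii i x))"
proof -
  have cf: "continuous_on G f" "\<And>i. i \<in> Basis \<Longrightarrow> continuous_on G (partial i f)"
      "\<And>i. i \<in> Basis \<Longrightarrow> continuous_on G (partial i (partial i f))"
    using smooth_onD(1)[OF f, of "[]"] smooth_onD(1)[OF f, of "[i]" for i] smooth_onD(1)[OF f, of "[i, i]" for i] by auto
  have df: "((\<lambda>t. f (x + t *\<^sub>R i)) has_vector_derivative partial i f x) (at 0)"
    "((\<lambda>t. partial i f (x + t *\<^sub>R i)) has_vector_derivative partial i (partial i f) x) (at 0)" if "x \<in> G" "i \<in> Basis" for x i
    using smooth_onD(3)[OF f, of "[]" x i] smooth_onD(3)[OF f, of "[i]" x i] that by auto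
  note cont = continuous_on_UNIV_of_support[OF G compact_imp_closed[OF K(1)] K(2)]
  obtain R where R: "\<And>x. x \<in> K \<Longrightarrow> norm x \<le> R"
    using compact_imp_bounded[OF K(1)] by (auto simp: bounded_iff)
  define w where "w i x = partial i (partial i f) x * \<psi> x - f x * \<psi>ii i x" for i x
  have cw: "continuous_on UNIV (w i)" if "i \<in> Basis" for i
    unfolding w_def using that z by (intro cont continuous_intros cf c) auto
  have "integral UNIV (w i) = 0" if i: "i \<in> Basis" for i
  proof (rule integral_partial_eq_0[OF i, where R = R and v = "\<lambda>x. partial i f x * \<psi> x - f x * \<psi>i i x"])
    show "continuous_on UNIV (\<lambda>x. partial i f x * \<psi> x - f x * \<psi>i i x)"
      using i z by (intro cont continuous_intros cf c) auto
    show "((\<lambda>t. partial i f (x + t *\<^sub>R i) * \<psi> (x + t *\<^sub>R i) - f (x + t *\<^sub>R i) * \<psi>i i (x + t *\<^sub>R i)) has_vector_derivative w i x) (at 0)" for x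
    proof (cases "x \<in> G")
      case True
      have "((\<lambda>t. partial i f (x + t *\<^sub>R i) * \<psi> (x + t *\<^sub>R i) - f (x + t *\<^sub>R i) * \<psi>i i (x + t *\<^sub>R i)) has_vector_derivative
         (partial i f (x + 0 *\<^sub>R i) * \<psi>i i x + partial i (partial i f) x * \<psi> (x + 0 *\<^sub>R i))
         - (f (x + 0 *\<^sub>R i) * \<psi>ii i x + partial i f x * \<psi>i i (x + 0 *\<^sub>R i))) (at 0)"
        by (intro has_vector_derivative_diff has_vector_derivative_mult df d1 d2 True i)
      thus ?thesis by (simp add: w_def algebra_simps)
    next
      case False
      \<comment> \<open>Nothing is known about f here, but x has a neighbourhood that misses
        \<open>K\<close>, where the whole product is 0.\<close>
      hence "x \<in> - K" using K by auto
      then obtain T :: "real set" where T: "open T" "0 \<in> T" "\<And>t. t \<in> T \<Longrightarrow> x + t *\<^sub>R i \<in> - K"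
        using open_line_section[of "- K" x i] K(1) by (metis compact_imp_closed open_Compl)
      have "w i x = 0" using z i \<open>x \<in> - K\<close> by (simp add: w_def)
      have "((\<lambda>t. 0) has_vector_derivative w i x) (at 0)"
        unfolding \<open>w i x = 0\<close> by (rule has_vector_derivative_const)
      thus ?thesis
      proof (rule has_vector_derivative_transform_within_open[OF _ T(1,2)])
        fix t assume "t \<in> T"
        hence "x + t *\<^sub>R i \<notin> K" using T(3) by blast
        thus "0 = partial i f (x + t *\<^sub>R i) * \<psi> (x + t *\<^sub>R i) - f (x + t *\<^sub>R i) * \<psi>i i (x + t *\<^sub>R i)"
          using z(1) z(2)[OF i] by simp
      qed
    qed
    show "partial i f x * \<psi> x - f x * \<psi>i i x = 0 \<and> w i x = 0" if "R < norm x" for x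
    proof -
      have "x \<notin> K" using R that by fastforce
      thus ?thesis using z i by (simp add: w_def)
    qed
  qed (use cw i in auto)
  hence "(\<Sum>i\<in>Basis. integral UNIV (w i)) = 0" by simp
  have int: "h integrable_on UNIV" if "continuous_on UNIV h" "\<And>x. x \<notin> K \<Longrightarrow> h x = 0" for h :: "'a \<Rightarrow> complex"
  proof -
    obtain a where a: "K \<subseteq> cbox (- a) a" 
      using bounded_subset_cbox_symmetric[OF compact_imp_bounded[OF K(1)]] by metis
    have "h integrable_on cbox (- a) a"
      using that(1) by (intro integrable_continuous) (auto intro: continuous_on_subset)
    thus ?thesis by (rule integrable_on_superset) (use a that(2) in auto)
  qed
  have "0 = integral UNIV (\<lambda>x. \<Sum>i\<in>Basis. w i x)"
    using \<open>(\<Sum>i\<in>Basis. integral UNIV (w i)) = 0\<close> cw z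
    by (subst integral_sum) (auto intro!: int simp: w_def)
  also have "\<dots> = integral UNIV (\<lambda>x. lap f x * \<psi> x - f x * (\<Sum>i\<in>Basis. \<psi>ii i x))"
    by (simp add: w_def lap_def sum_subtractf sum_distrib_left sum_distrib_right)
  also have "\<dots> = integral UNIV (\<lambda>x. lap f x * \<psi> x) - integral UNIV (\<lambda>x. f x * (\<Sum>i\<in>Basis. \<psi>ii i x))"
    unfolding lap_def using z
    by (intro integral_diff int cont continuous_intros cf c) (auto simp: sum.neutral)
  finally show ?thesis by simp
qed

section \<open>Harmonic homogeneous polynomials\<close>

text \<open>For \<open>\<alpha> i = 0\<close> the truncated exponent \<open>\<alpha> i - 1\<close>
  is harmless, because the factor in front is 0.\<close>

lemma monomial_has_partial:
  assumes i: "i \<in> Basis"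
  shows "((\<lambda>t. monomial \<alpha> (x + t *\<^sub>R i)) has_vector_derivative
     of_nat (\<alpha> i) * monomial (\<alpha>(i := \<alpha> i - 1)) x) (at 0)"
proof -
  define Q where "Q = (\<Prod>j\<in>Basis - {i}. complex_of_real (x \<bullet> j) ^ \<alpha> j)"
  have split: "monomial \<beta> y = complex_of_real (y \<bullet> i) ^ \<beta> i * (\<Prod>j\<in>Basis - {i}. complex_of_real (y \<bullet> j) ^ \<beta> j)" for \<beta> y
    unfolding monomial_def by (rule prod.remove) (use i in auto)
  have line: "monomial \<alpha> (x + t *\<^sub>R i) = (of_real (x \<bullet> i) + of_real t) ^ \<alpha> i * Q" for t
  proof -
    have "(\<Prod>j\<in>Basis - {i}. complex_of_real ((x + t *\<^sub>R i) \<bullet> j) ^ \<alpha> j) = Q"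
      unfolding Q_def using i by (intro prod.cong) (auto simp: inner_add_left inner_Basis)
    thus ?thesis using i by (simp add: split inner_add_left inner_Basis)
  qed
  have "((\<lambda>z. (of_real (x \<bullet> i) + z) ^ \<alpha> i * Q) has_field_derivative
      of_nat (\<alpha> i) * of_real (x \<bullet> i) ^ (\<alpha> i - 1) * Q) (at (of_real 0))"
    by (auto intro!: derivative_eq_intros)
  hence "((\<lambda>t. (of_real (x \<bullet> i) + of_real t) ^ \<alpha> i * Q) has_vector_derivative
      of_nat (\<alpha> i) * of_real (x \<bullet> i) ^ (\<alpha> i - 1) * Q) (at 0)"
    by (rule has_vector_derivative_real_field)
  moreover have "monomial (\<alpha>(i := \<alpha> i - 1)) x = of_real (x \<bullet> i) ^ (\<alpha> i - 1) * Q"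
    unfolding split[of "\<alpha>(i := \<alpha> i - 1)"] Q_def by (auto intro!: arg_cong2[where f = "(*)"] prod.cong)
  ultimately show ?thesis unfolding line by (simp add: mult.assoc)
qed

text \<open>Scalar multiples of monomials are closed under \<open>partial\<close>, so iterated
  partials never leave this class.\<close>

lemma smooth_on_monomial: "smooth_on UNIV (\<lambda>x. c * monomial \<alpha> x)"
proof -
  have "\<exists>c' \<beta>. partials is (\<lambda>x. c * monomial \<alpha> x) = (\<lambda>x. c' * monomial \<beta> x)" if "set is \<subseteq> Basis" for "is" :: "'a list"
    using that
  proof (induction "is")
    case (Cons i "is")
    then obtain c' \<beta> where "partials is (\<lambda>x. c * monomial \<alpha> x) = (\<lambda>x. c' * monomial \<beta> x)" by auto
    moreover have "partial i (\<lambda>x. c' * monomial \<beta> x) = (\<lambda>x. (c' * of_nat (\<beta> i)) * monomial (\<beta>(i := \<beta> i - 1)) x)"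
    proof (intro ext partialI)
      fix x
      have "i \<in> Basis" using Cons.prems by simp
      from bounded_linear.has_vector_derivative[OF bounded_linear_mult_right monomial_has_partial[OF this]]
      show "((\<lambda>t. c' * monomial \<beta> (x + t *\<^sub>R i)) has_vector_derivative
          (c' * of_nat (\<beta> i)) * monomial (\<beta>(i := \<beta> i - 1)) x) (at 0)"
        by (simp only: mult.assoc)
    qed
    ultimately show ?case by auto
  qed auto
  moreover have "continuous_on UNIV (\<lambda>x. c' * monomial \<beta> x)" for c' and \<beta> :: "'a \<Rightarrow> nat"
    unfolding monomial_def by (intro continuous_intros)
  moreover have "(\<lambda>t. c' * monomial \<beta> (x + t *\<^sub>R i)) differentiable at 0" if "i \<in> Basis" for c' \<beta> and x i :: 'a
    by (rule differentiableI_vector)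
       (rule bounded_linear.has_vector_derivative[OF bounded_linear_mult_right monomial_has_partial[OF that]])
  ultimately show ?thesis
    unfolding smooth_on_def by fastforce
qed

lemma monomial_scaleR:
  assumes "\<alpha> \<in> mono_exps k"
  shows "monomial \<alpha> (s *\<^sub>R x) = of_real s ^ k * monomial \<alpha> x"
  using assms by (simp add: monomial_def mono_exps_def power_mult_distrib prod.distrib flip: power_sum)

lemma monomial_euler:
  assumes "\<alpha> \<in> mono_exps k"
  shows "(\<Sum>i\<in>Basis. of_real (x \<bullet> i) * (of_nat (\<alpha> i) * monomial (\<alpha>(i := \<alpha> i - 1)) x)) = of_nat k * monomial \<alpha> x"
proof -
  have "of_real (x \<bullet> i) * (of_nat (\<alpha> i) * monomial (\<alpha>(i := \<alpha> i - 1)) x) = of_nat (\<alpha> i) * monomial \<alpha> x"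
    if i: "i \<in> Basis" for i
  proof (cases "\<alpha> i")
    case (Suc n)
    have split: "monomial \<beta> x = complex_of_real (x \<bullet> i) ^ \<beta> i * (\<Prod>j\<in>Basis - {i}. complex_of_real (x \<bullet> j) ^ \<beta> j)" for \<beta>
      unfolding monomial_def by (rule prod.remove) (use i in auto)
    have "(\<Prod>j\<in>Basis - {i}. complex_of_real (x \<bullet> j) ^ (\<alpha>(i := n)) j) = (\<Prod>j\<in>Basis - {i}. complex_of_real (x \<bullet> j) ^ \<alpha> j)"
      by (intro prod.cong) auto
    thus ?thesis unfolding split[of \<alpha>] split[of "\<alpha>(i := \<alpha> i - 1)"] by (simp add: Suc)
  qed simp
  hence "(\<Sum>i\<in>Basis. of_real (x \<bullet> i) * (of_nat (\<alpha> i) * monomial (\<alpha>(i := \<alpha> i - 1)) x))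
      = (\<Sum>i\<in>Basis. of_nat (\<alpha> i) * monomial \<alpha> x)"
    by (intro sum.cong refl)
  also have "\<dots> = of_nat (sum \<alpha> Basis) * monomial \<alpha> x" by (simp add: sum_distrib_right)
  also have "sum \<alpha> Basis = k" using assms by (simp add: mono_exps_def)
  finally show ?thesis .
qed

lemma harm_hom_poly_smooth:
  assumes "harm_hom_poly k q"
  shows "smooth_on UNIV q"
proof -
  obtain c where c: "q = (\<lambda>x. \<Sum>\<alpha>\<in>mono_exps k. c \<alpha> * monomial \<alpha> x)"
    using assms unfolding harm_hom_poly_def by (metis ext)
  show ?thesis unfolding c by (intro smooth_on_sum smooth_on_monomial) auto
qed

lemma harm_hom_poly_scaleR:
  assumes "harm_hom_poly k q"
  shows "q (s *\<^sub>R x) = of_real s ^ k * q x"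
proof -
  obtain c where c: "q = (\<lambda>x. \<Sum>\<alpha>\<in>mono_exps k. c \<alpha> * monomial \<alpha> x)"
    using assms unfolding harm_hom_poly_def by (metis ext)
  show ?thesis unfolding c by (simp add: monomial_scaleR sum_distrib_left mult.left_commute)
qed

lemma harm_hom_poly_euler:
  assumes "harm_hom_poly k q"
  shows "(\<Sum>i\<in>Basis. of_real (x \<bullet> i) * partial i q x) = of_nat k * q x"
proof -
  obtain c where c: "q = (\<lambda>x. \<Sum>\<alpha>\<in>mono_exps k. c \<alpha> * monomial \<alpha> x)"
    using assms unfolding harm_hom_poly_def by (metis ext)
  have "partial i q x = (\<Sum>\<alpha>\<in>mono_exps k. c \<alpha> * (of_nat (\<alpha> i) * monomial (\<alpha>(i := \<alpha> i - 1)) x))" if "i \<in> Basis" for i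
    unfolding c using that
    by (intro partialI has_vector_derivative_sum bounded_linear.has_vector_derivative[OF bounded_linear_mult_right]
        monomial_has_partial)
  hence "(\<Sum>i\<in>Basis. of_real (x \<bullet> i) * partial i q x) =
     (\<Sum>i\<in>Basis. \<Sum>\<alpha>\<in>mono_exps k. c \<alpha> * (of_real (x \<bullet> i) * (of_nat (\<alpha> i) * monomial (\<alpha>(i := \<alpha> i - 1)) x)))"
    by (simp add: sum_distrib_left mult.left_commute)
  also have "\<dots> = (\<Sum>\<alpha>\<in>mono_exps k. c \<alpha> * (\<Sum>i\<in>Basis. of_real (x \<bullet> i) * (of_nat (\<alpha> i) * monomial (\<alpha>(i := \<alpha> i - 1)) x)))"
    by (subst sum.swap) (simp add: sum_distrib_left)
  also have "\<dots> = (\<Sum>\<alpha>\<in>mono_exps k. c \<alpha> * (of_nat k * monomial \<alpha> x))"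
    by (intro sum.cong refl) (simp only: monomial_euler)
  finally show ?thesis by (simp add: c sum_distrib_left mult.left_commute)
qed

text \<open>The coefficients of f integrate against the conjugate of Y; since the Laplacian is real,
  that conjugate is an admissible factor \<open>q\<close> below.\<close>

lemma harm_hom_poly_cnj:
  assumes q: "harm_hom_poly k q"
  shows "harm_hom_poly k (\<lambda>x. cnj (q x))"
proof -
  obtain c where c: "q = (\<lambda>x. \<Sum>\<alpha>\<in>mono_exps k. c \<alpha> * monomial \<alpha> x)"
    using assms unfolding harm_hom_poly_def by (metis ext)
  have "cnj (q x) = (\<Sum>\<alpha>\<in>mono_exps k. cnj (c \<alpha>) * monomial \<alpha> x)" for x
    by (simp add: c monomial_def)
  moreover have cnj_partial: "partial i (\<lambda>x. cnj (h x)) = (\<lambda>x. cnj (partial i h x))"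
    if "smooth_on UNIV h" "i \<in> Basis" for h :: "'a \<Rightarrow> complex" and i
    using smooth_onD(3)[OF that(1), of "[]" _ i] that(2)
    by (intro ext partialI bounded_linear.has_vector_derivative[OF bounded_linear_cnj]) auto
  have "lap (\<lambda>x. cnj (q x)) x = cnj (lap q x)" for x
    unfolding lap_def using harm_hom_poly_smooth[OF q]
    by (simp add: cnj_partial smooth_on_partial)
  ultimately show ?thesis using q unfolding harm_hom_poly_def by auto
qed

section \<open>Green's identity with radial test functions\<close>

lemma has_vector_derivative_radial:
  fixes x :: "'a::euclidean_space"
  assumes x: "x \<noteq> 0" and \<phi>: "\<And>s. (\<phi> has_vector_derivative \<phi>' s) (at s)"
  shows "((\<lambda>t. \<phi> (norm (x + t *\<^sub>R i))) has_vector_derivative ((x \<bullet> i) / norm x) *\<^sub>R \<phi>' (norm x)) (at 0)"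
proof -
  have "((\<lambda>t. x + t *\<^sub>R i) has_derivative (\<lambda>t. t *\<^sub>R i)) (at 0)"
    by (auto intro!: derivative_eq_intros)
  moreover have "(norm has_derivative (\<lambda>h. h \<bullet> sgn x)) (at (x + 0 *\<^sub>R i))"
    using has_derivative_norm[OF x] by simp
  ultimately have "((\<lambda>t. norm (x + t *\<^sub>R i)) has_derivative (\<lambda>t. (t *\<^sub>R i) \<bullet> sgn x)) (at 0)"
    by (rule has_derivative_compose)
  moreover have "(\<lambda>t. (t *\<^sub>R i) \<bullet> sgn x) = (\<lambda>t. t *\<^sub>R ((x \<bullet> i) / norm x))"
    by (rule ext) (simp add: sgn_div_norm inner_commute[of i x] divide_inverse)
  ultimately have "((\<lambda>t. norm (x + t *\<^sub>R i)) has_vector_derivative (x \<bullet> i) / norm x) (at 0)"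
    by (simp add: has_vector_derivative_def)
  from vector_diff_chain_at[OF this \<phi>] show ?thesis by (simp add: o_def)
qed

text \<open>The radial operator is \<open>\<phi>'' + ((2 k + d - 1) / r) \<phi>'\<close> because \<open>\<Delta> (q \<phi>(|x|)) = \<Delta> q \<phi> +
  2 \<nabla>q \<bullet> \<nabla>\<phi>(|x|) + q \<Delta> \<phi>(|x|)\<close>, with \<open>q\<close> harmonic and homogeneous of degree \<open>k\<close>.\<close>

lemma green_identity_radial:
  fixes f q :: "'a::euclidean_space \<Rightarrow> complex"
  assumes G: "open G" "0 \<notin> G" and f: "smooth_on G f" and q: "harm_hom_poly k q"
    and K: "{x. A \<le> norm x \<and> norm x \<le> B} \<subseteq> G"
    and \<phi>: "\<And>s. (\<phi> has_vector_derivative \<phi>' s) (at s)" "\<And>s. (\<phi>' has_vector_derivative \<phi>'' s) (at s)"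
      "continuous_on UNIV \<phi>''"
    and z: "\<And>s. s \<notin> {A..B} \<Longrightarrow> \<phi> s = 0 \<and> \<phi>' s = 0 \<and> \<phi>'' s = 0"
  shows "integral UNIV (\<lambda>x. lap f x * (q x * \<phi> (norm x))) = integral UNIV (\<lambda>x. f x * (q x *
     (\<phi>'' (norm x) + ((2 * real k + real DIM('a) - 1) / norm x) *\<^sub>R \<phi>' (norm x))))"
proof -
  define \<psi> where "\<psi> x = q x * \<phi> (norm x)" for x
  \<comment> \<open>\<open>\<psi>i\<close> and \<open>\<psi>ii\<close> are the first and second
    derivatives of \<psi> in direction i; the bracket with the cubed norm is the derivative of the
    quotient of \<open>x \<bullet> i\<close> by \<open>norm x\<close>.\<close>
  define \<psi>i where "\<psi>i i x = q x * ((x \<bullet> i / norm x) *\<^sub>R \<phi>' (norm x)) + partial i q x * \<phi> (norm x)" for i x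
  define \<psi>ii where "\<psi>ii i x = q x * ((x \<bullet> i / norm x)\<^sup>2 *\<^sub>R \<phi>'' (norm x) + (1 / norm x - (x \<bullet> i)\<^sup>2 / norm x ^ 3) *\<^sub>R \<phi>' (norm x))
     + 2 * (partial i q x * ((x \<bullet> i / norm x) *\<^sub>R \<phi>' (norm x))) + partial i (partial i q) x * \<phi> (norm x)" for i x
  have nz: "x \<noteq> 0" if "x \<in> G" for x using that G by auto
  have sq: "smooth_on UNIV q" using q by (rule harm_hom_poly_smooth)
  have dq: "((\<lambda>t. q (x + t *\<^sub>R i)) has_vector_derivative partial i q x) (at 0)"
    "((\<lambda>t. partial i q (x + t *\<^sub>R i)) has_vector_derivative partial i (partial i q) x) (at 0)" if "i \<in> Basis" for x i
    using smooth_onD(3)[OF sq, of "[]" x i] smooth_onD(3)[OF sq, of "[i]" x i] that by auto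
  have cq: "continuous_on G q" "continuous_on G (partial i q)" "continuous_on G (partial i (partial i q))" if "i \<in> Basis" for i
    using smooth_onD(1)[OF sq, of "[]"] smooth_onD(1)[OF sq, of "[i]"] smooth_onD(1)[OF sq, of "[i, i]"] that
    by (auto intro: continuous_on_subset)
  have cq0: "continuous_on G q" using smooth_onD(1)[OF sq, of "[]"] by (auto intro: continuous_on_subset)
  have c\<phi>: "continuous_on G (\<lambda>x. \<phi> (norm x))" "continuous_on G (\<lambda>x. \<phi>' (norm x))" "continuous_on G (\<lambda>x. \<phi>'' (norm x))"
  proof -
    have "continuous_on UNIV \<phi>" "continuous_on UNIV \<phi>'"
      using continuous_on_vector_derivative[OF \<phi>(1)] continuous_on_vector_derivative[OF \<phi>(2)] by auto
    with \<phi>(3) show "continuous_on G (\<lambda>x. \<phi> (norm x))" "continuous_on G (\<lambda>x. \<phi>' (norm x))" "continuous_on G (\<lambda>x. \<phi>'' (norm x))"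
      by (auto intro!: continuous_on_compose2[of UNIV _ G norm] continuous_intros)
  qed
  have norm_line: "((\<lambda>t. norm (x + t *\<^sub>R i)) has_real_derivative x \<bullet> i / norm x) (at 0)" if "x \<noteq> 0" for x i :: 'a
    using has_vector_derivative_radial[OF that, of "\<lambda>s. s" "\<lambda>_. 1" i]
    by (simp add: has_real_derivative_iff_has_vector_derivative)
  have d1: "((\<lambda>t. \<psi> (x + t *\<^sub>R i)) has_vector_derivative \<psi>i i x) (at 0)" if "x \<in> G" "i \<in> Basis" for x i
  proof -
    have "((\<lambda>t. q (x + t *\<^sub>R i) * \<phi> (norm (x + t *\<^sub>R i))) has_vector_derivative
       q (x + 0 *\<^sub>R i) * ((x \<bullet> i / norm x) *\<^sub>R \<phi>' (norm x)) + partial i q x * \<phi> (norm (x + 0 *\<^sub>R i))) (at 0)"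
      by (intro has_vector_derivative_mult dq that has_vector_derivative_radial nz \<phi>)
    thus ?thesis by (simp add: \<psi>_def \<psi>i_def)
  qed
  have d2: "((\<lambda>t. \<psi>i i (x + t *\<^sub>R i)) has_vector_derivative \<psi>ii i x) (at 0)" if x: "x \<in> G" and i: "i \<in> Basis" for x i
  proof -
    have "((\<lambda>t. ((x + t *\<^sub>R i) \<bullet> i) / norm (x + t *\<^sub>R i)) has_real_derivative
       (1 * norm (x + 0 *\<^sub>R i) - ((x + 0 *\<^sub>R i) \<bullet> i) * (x \<bullet> i / norm x)) / (norm (x + 0 *\<^sub>R i) * norm (x + 0 *\<^sub>R i))) (at 0)"
      using nz[OF x] i
      by (intro DERIV_divide norm_line) (auto simp: inner_add_left inner_Basis intro!: derivative_eq_intros)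
    hence quot: "((\<lambda>t. ((x + t *\<^sub>R i) \<bullet> i) / norm (x + t *\<^sub>R i)) has_real_derivative (1 / norm x - (x \<bullet> i)\<^sup>2 / norm x ^ 3)) (at 0)"
      using nz[OF x] by (simp add: field_simps power2_eq_square power3_eq_cube)
    have "((\<lambda>t. q (x + t *\<^sub>R i) * ((((x + t *\<^sub>R i) \<bullet> i) / norm (x + t *\<^sub>R i)) *\<^sub>R \<phi>' (norm (x + t *\<^sub>R i)))
         + partial i q (x + t *\<^sub>R i) * \<phi> (norm (x + t *\<^sub>R i))) has_vector_derivative
       (q (x + 0 *\<^sub>R i) * ((((x + 0 *\<^sub>R i) \<bullet> i) / norm (x + 0 *\<^sub>R i)) *\<^sub>R ((x \<bullet> i / norm x) *\<^sub>R \<phi>'' (norm x)) + (1 / norm x - (x \<bullet> i)\<^sup>2 / norm x ^ 3) *\<^sub>R \<phi>' (norm (x + 0 *\<^sub>R i)))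
          + partial i q x * ((((x + 0 *\<^sub>R i) \<bullet> i) / norm (x + 0 *\<^sub>R i)) *\<^sub>R \<phi>' (norm (x + 0 *\<^sub>R i))))
       + (partial i q (x + 0 *\<^sub>R i) * ((x \<bullet> i / norm x) *\<^sub>R \<phi>' (norm x)) + partial i (partial i q) x * \<phi> (norm (x + 0 *\<^sub>R i)))) (at 0)"
      by (intro has_vector_derivative_add has_vector_derivative_mult has_vector_derivative_scaleR quot dq i
          has_vector_derivative_radial nz x \<phi>)
    thus ?thesis by (simp add: \<psi>i_def \<psi>ii_def algebra_simps power2_eq_square)
  qed
  \<comment> \<open>Summed over i, the squared direction cosines give 1, the brackets give (d - 1) /
    |x|, and Euler's identity turns the cross terms into 2k / |x|.\<close>
  have sum: "(\<Sum>i\<in>Basis. \<psi>ii i x) = q x * (\<phi>'' (norm x) + ((2 * real k + real DIM('a) - 1) / norm x) *\<^sub>R \<phi>' (norm x))"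
    if x: "x \<noteq> 0" for x
  proof -
    have n2: "(\<Sum>i\<in>Basis. (x \<bullet> i)\<^sup>2) = (norm x)\<^sup>2"
      by (simp add: norm_eq_sqrt_inner euclidean_inner[of x x] power2_eq_square sum_nonneg)
    have s1: "(\<Sum>i\<in>Basis. (x \<bullet> i / norm x)\<^sup>2) = 1"
      using x n2 by (simp add: power_divide flip: sum_divide_distrib)
    have s2: "(\<Sum>i\<in>Basis. 1 / norm x - (x \<bullet> i)\<^sup>2 / norm x ^ 3) = (real DIM('a) - 1) / norm x"
      using x n2 by (simp add: sum_subtractf power2_eq_square power3_eq_cube field_simps flip: sum_divide_distrib)
    have s3: "(\<Sum>i\<in>Basis. partial i q x * of_real (x \<bullet> i)) = of_nat k * q x"
      using harm_hom_poly_euler[OF q, of x] by (simp add: mult.commute)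
    have s4: "(\<Sum>i\<in>Basis. partial i (partial i q) x) = 0"
      using q by (simp add: harm_hom_poly_def lap_def)
    have "(\<Sum>i\<in>Basis. \<psi>ii i x) =
       q x * ((\<Sum>i\<in>Basis. (x \<bullet> i / norm x)\<^sup>2) *\<^sub>R \<phi>'' (norm x) + (\<Sum>i\<in>Basis. 1 / norm x - (x \<bullet> i)\<^sup>2 / norm x ^ 3) *\<^sub>R \<phi>' (norm x))
       + 2 * ((\<Sum>i\<in>Basis. partial i q x * of_real (x \<bullet> i)) * ((1 / norm x) *\<^sub>R \<phi>' (norm x)))
       + (\<Sum>i\<in>Basis. partial i (partial i q) x) * \<phi> (norm x)"
      unfolding \<psi>ii_def sum.distrib scaleR_sum_left sum_distrib_left sum_distrib_right distrib_left
      by (simp add: scaleR_conv_of_real mult_ac)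
    also have "\<dots> = q x * (\<phi>'' (norm x) + ((2 * real k + real DIM('a) - 1) / norm x) *\<^sub>R \<phi>' (norm x))"
      unfolding s1 s2 s3 s4 using x by (simp add: scaleR_conv_of_real field_simps)
    finally show ?thesis .
  qed
  have "integral UNIV (\<lambda>x. lap f x * \<psi> x) = integral UNIV (\<lambda>x. f x * (\<Sum>i\<in>Basis. \<psi>ii i x))"
  proof (rule green_identity[OF G(1) f _ K])
    have "{x::'a. A \<le> norm x \<and> norm x \<le> B} = cball 0 B - ball 0 A" by auto
    thus "compact {x::'a. A \<le> norm x \<and> norm x \<le> B}" by (simp add: compact_diff)
    show "continuous_on G \<psi>" unfolding \<psi>_def by (intro continuous_intros cq0 c\<phi>)
    show "continuous_on G (\<psi>i i)" if "i \<in> Basis" for i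
      unfolding \<psi>i_def using nz by (intro continuous_intros cq cq0 c\<phi> that) auto
    show "continuous_on G (\<psi>ii i)" if "i \<in> Basis" for i
      unfolding \<psi>ii_def using nz by (intro continuous_intros cq cq0 c\<phi> that) auto
  qed (use d1 d2 z in \<open>auto simp: \<psi>_def \<psi>i_def \<psi>ii_def\<close>)
  moreover have "f x * (\<Sum>i\<in>Basis. \<psi>ii i x) = f x * (q x *
     (\<phi>'' (norm x) + ((2 * real k + real DIM('a) - 1) / norm x) *\<^sub>R \<phi>' (norm x)))" for x
  proof (cases "x = 0")
    case True
    \<comment> \<open>The origin is outside \<open>G\<close>, hence outside the shell, so both sides
      are 0 there despite the division by \<open>norm x\<close>.\<close>
    hence "norm x \<notin> {A..B}" using subsetD[OF K, of 0] G(2) by auto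
    thus ?thesis using z by (simp add: \<psi>ii_def)
  next
    case False
    show ?thesis by (simp only: sum[OF False])
  qed
  ultimately show ?thesis by (simp add: \<psi>_def)
qed

section \<open>Spherical integrals and polar coordinates\<close>

text \<open>The substitution x = t y leaves \<open>g\<close> unchanged and contributes the Jacobian
  t^d. This is the exact computation behind the polar coordinates below.\<close>

lemma has_integral_ball_homogeneous:
  fixes g :: "'a::euclidean_space \<Rightarrow> 'b::banach"
  assumes g: "(g has_integral \<gamma>) (ball 0 1)" and hom: "\<And>c x. 0 < c \<Longrightarrow> g (c *\<^sub>R x) = g x" and t: "0 < t"
  shows "(g has_integral t ^ DIM('a) *\<^sub>R \<gamma>) (ball 0 t)"
proof -
  \<comment> \<open>The affine change of variables is available on boxes, so the ball is encoded by
    cutting \<open>g\<close> off inside a box.\<close>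
  define H where "H s x = (if x \<in> ball 0 s then g x else 0)" for s x
  have "bounded (ball (0::'a) 1)" by (rule bounded_ball)
  then obtain a :: 'a where a: "ball 0 1 \<subseteq> cbox (- a) a"
    by (rule bounded_subset_cbox_symmetric)
  have restrict: "(H s has_integral \<delta>) (cbox (- b) b) \<longleftrightarrow> (g has_integral \<delta>) (ball 0 s)"
    if "ball 0 s \<subseteq> cbox (- b) b" for s \<delta> b
    unfolding H_def by (rule has_integral_restrict[OF that])
  have H1: "(H 1 has_integral \<gamma>) (cbox (- a) a)" using g by (rule restrict[OF a, THEN iffD2])
  have pos: "0 < 1 / t" using t by simp
  have eq: "(\<lambda>x. H 1 ((1 / t) *\<^sub>R x + 0)) = H t"
  proof
    fix x :: 'a
    have "(1 / t) *\<^sub>R x \<in> ball 0 1 \<longleftrightarrow> x \<in> ball 0 t" using t by (simp add: divide_less_eq)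
    thus "H 1 ((1 / t) *\<^sub>R x + 0) = H t x"
      using hom[OF pos] by (simp only: H_def add_0_right)
  qed
  have scale: "\<gamma> /\<^sub>R (1 / t) ^ DIM('a) = t ^ DIM('a) *\<^sub>R \<gamma>"
    by (simp add: power_divide)
  have corners: "(- a - 0) /\<^sub>R (1 / t) = - (t *\<^sub>R a)" "(a - 0) /\<^sub>R (1 / t) = t *\<^sub>R a" by simp_all
  have "(H t has_integral t ^ DIM('a) *\<^sub>R \<gamma>) (cbox (- (t *\<^sub>R a)) (t *\<^sub>R a))"
    using has_integral_affinity'[OF H1 pos, of 0] unfolding eq scale corners .
  moreover have "ball 0 t \<subseteq> cbox (- (t *\<^sub>R a)) (t *\<^sub>R a)"
  proof
    fix x :: 'a assume "x \<in> ball 0 t"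
    hence "(1 / t) *\<^sub>R x \<in> ball 0 1" using t by (simp add: divide_less_eq)
    hence x: "(1 / t) *\<^sub>R x \<in> cbox (- a) a" using a by blast
    show "x \<in> cbox (- (t *\<^sub>R a)) (t *\<^sub>R a)"
      unfolding mem_box
    proof
      fix i :: 'a assume "i \<in> Basis"
      hence "- (a \<bullet> i) \<le> (x \<bullet> i) / t" "(x \<bullet> i) / t \<le> a \<bullet> i" using x by (auto simp: mem_box)
      thus "- (t *\<^sub>R a) \<bullet> i \<le> x \<bullet> i \<and> x \<bullet> i \<le> t *\<^sub>R a \<bullet> i"
        using t by (simp add: pos_divide_le_eq pos_le_divide_eq mult.commute)
    qed
  qed
  ultimately show ?thesis using restrict by blast
qed

text \<open>At the origin \<open>x /\<^sub>R norm x\<close> is 0 and not a unit vector. Dropping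
  this null set lets hypotheses on the sphere suffice.\<close>

lemma integral_ball_minus_zero:
  fixes h :: "'a::euclidean_space \<Rightarrow> complex"
  shows "integral (ball 0 1 - {0}) h = integral (ball 0 1) h"
    and "h integrable_on (ball 0 1 - {0}) \<longleftrightarrow> h integrable_on ball 0 1"
proof -
  have *: "negligible {x \<in> (ball 0 1 - {0}) - ball 0 1. h x \<noteq> 0}"
    "negligible {x \<in> ball (0::'a) 1 - (ball 0 1 - {0}). h x \<noteq> 0}"
    by (rule negligible_subset[of "{0}"]; auto)+
  show "integral (ball 0 1 - {0}) h = integral (ball 0 1) h" by (rule integral_spike_set[OF *])
  show "h integrable_on (ball 0 1 - {0}) \<longleftrightarrow> h integrable_on ball 0 1"
    by (rule integrable_spike_set_eq) (rule negligible_subset[of "{0}"]; auto)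
qed

lemma integrable_on_sphere_projection:
  fixes g :: "'a::euclidean_space \<Rightarrow> complex"
  assumes g: "continuous_on (sphere 0 1) g"
  shows "(\<lambda>x. g (x /\<^sub>R norm x)) integrable_on ball 0 1"
proof -
  let ?S = "ball (0::'a) 1 - {0}"
  have S: "?S \<in> lmeasurable" by (simp add: fmeasurable.Diff lmeasurable_ball bounded_set_imp_lmeasurable)
  have "compact (g ` sphere 0 1)" using g by (intro compact_continuous_image) auto
  hence "bounded (g ` sphere 0 1)" by (rule compact_imp_bounded)
  then obtain M where "\<forall>y\<in>g ` sphere 0 1. norm y \<le> M" unfolding bounded_iff ..
  hence M: "norm (g x) \<le> M" if "x \<in> sphere 0 1" for x using that by blast
  have "continuous_on ?S (\<lambda>x. g (x /\<^sub>R norm x))"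
    by (intro continuous_on_compose2[OF g] continuous_intros) (simp_all add: image_subset_iff)
  hence "(\<lambda>x. g (x /\<^sub>R norm x)) \<in> borel_measurable (lebesgue_on ?S)"
    using S by (intro continuous_imp_measurable_on_sets_lebesgue) auto
  moreover have "(\<lambda>_. M) integrable_on ?S"
    using S by (intro integrable_on_const)
  ultimately have "(\<lambda>x. g (x /\<^sub>R norm x)) absolutely_integrable_on ?S"
    using S M by (intro measurable_bounded_by_integrable_imp_absolutely_integrable[where g = "\<lambda>_. M"]) auto
  thus ?thesis
    using set_lebesgue_integral_eq_integral(1) integral_ball_minus_zero(2) by blast
qed

lemma normalize_in_sphere:
  fixes x :: "'a::real_normed_vector"
  assumes "x \<noteq> 0"
  shows "x /\<^sub>R norm x \<in> sphere 0 1"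
proof -
  have "norm (sgn x) = 1" using assms by (simp add: norm_sgn)
  thus ?thesis unfolding sgn_div_norm mem_sphere_0 .
qed

lemma sphere_integral_cong:
  fixes g h :: "'a::euclidean_space \<Rightarrow> complex"
  assumes "\<And>x. x \<in> sphere 0 1 \<Longrightarrow> g x = h x"
  shows "sphere_integral g = sphere_integral h"
proof -
  have "g (x /\<^sub>R norm x) = h (x /\<^sub>R norm x)" if "x \<in> ball 0 1 - {0}" for x
    using that by (intro assms normalize_in_sphere) blast
  hence "integral (ball 0 1 - {0}) (\<lambda>x. g (x /\<^sub>R norm x)) = integral (ball 0 1 - {0}) (\<lambda>x. h (x /\<^sub>R norm x))"
    by (rule integral_cong)
  thus ?thesis unfolding sphere_integral_def integral_ball_minus_zero(1) by simp
qed

lemma sphere_integral_mult: "sphere_integral (\<lambda>x. c * g x) = c * sphere_integral g"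
  by (simp add: sphere_integral_def mult.left_commute)

lemma sphere_integral_diff:
  assumes "continuous_on (sphere 0 1) g" "continuous_on (sphere 0 1) h"
  shows "sphere_integral (\<lambda>x. g x - h x) = sphere_integral g - sphere_integral h"
  unfolding sphere_integral_def right_diff_distrib[symmetric]
  by (subst integral_diff) (use assms in \<open>auto intro: integrable_on_sphere_projection\<close>)

text \<open>The constant is the area of the unit sphere, d times the volume of the unit
  ball.\<close>

lemma norm_sphere_integral_le:
  fixes g :: "'a::euclidean_space \<Rightarrow> complex"
  assumes g: "continuous_on (sphere 0 1) g" and M: "\<And>x. x \<in> sphere 0 1 \<Longrightarrow> norm (g x) \<le> M"
  shows "norm (sphere_integral g) \<le> (real DIM('a) * measure lebesgue (ball (0::'a) 1)) * M"
proof -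
  let ?S = "ball (0::'a) 1 - {0}"
  have S: "?S \<in> lmeasurable" by (simp add: fmeasurable.Diff lmeasurable_ball bounded_set_imp_lmeasurable)
  have int: "(\<lambda>x. g (x /\<^sub>R norm x)) integrable_on ?S"
    using integrable_on_sphere_projection[OF g] by (simp only: integral_ball_minus_zero(2))
  have bound: "norm (g (x /\<^sub>R norm x)) \<le> M" if "x \<in> ?S" for x
    using that by (intro M normalize_in_sphere) blast
  have "norm (integral ?S (\<lambda>x. g (x /\<^sub>R norm x))) \<le> integral ?S (\<lambda>_. 1 * M)"
    by (rule integral_norm_bound_integral[OF int]) (use integrable_on_const[OF S] bound in auto)
  also have "integral ?S (\<lambda>_. 1 * M) = integral ?S (\<lambda>_. 1) * M"
    by (rule integral_mult_left)
  also have "integral ?S (\<lambda>_. 1::real) = measure lebesgue ?S"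
    by (rule lmeasure_integral[OF S, symmetric])
  also have "measure lebesgue ?S = measure lebesgue (ball (0::'a) 1)"
  proof (rule measure_negligible_symdiff[symmetric, OF S])
    show "negligible (sym_diff (ball 0 1 - {0}) (ball (0::'a) 1))"
      by (rule negligible_subset[of "{0}"]) auto
  qed
  finally have "real DIM('a) * norm (integral (ball 0 1) (\<lambda>x. g (x /\<^sub>R norm x)))
      \<le> real DIM('a) * (measure lebesgue (ball (0::'a) 1) * M)"
    unfolding integral_ball_minus_zero(1) by (intro mult_left_mono) auto
  thus ?thesis by (simp add: sphere_integral_def norm_mult mult.assoc)
qed

lemma continuous_on_sphere_integral:
  fixes g :: "real \<Rightarrow> 'a::euclidean_space \<Rightarrow> complex"
  assumes X: "compact X" and g: "continuous_on (X \<times> sphere 0 1) (\<lambda>(r, x). g r x)"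
  shows "continuous_on X (\<lambda>r. sphere_integral (g r))"
proof -
  define W where "W = real DIM('a) * measure lebesgue (ball (0::'a) 1) + 1"
  have W: "W > 0" by (simp add: W_def add_nonneg_pos)
  have gr: "continuous_on (sphere 0 1) (g r)" if "r \<in> X" for r
  proof -
    have "continuous_on (sphere 0 1) (\<lambda>x. (\<lambda>(r, x). g r x) (r, x))"
      by (rule continuous_on_compose2[OF g]) (use that in \<open>auto intro!: continuous_intros\<close>)
    thus ?thesis by simp
  qed
  have uc: "uniformly_continuous_on (X \<times> sphere 0 1) (\<lambda>(r, x). g r x)"
    using X by (intro compact_uniformly_continuous g compact_Times) auto
  have "\<exists>\<delta>>0. \<forall>s\<in>X. dist s r < \<delta> \<longrightarrow> dist (sphere_integral (g s)) (sphere_integral (g r)) < \<epsilon>"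
    if r: "r \<in> X" and \<epsilon>: "\<epsilon> > 0" for r \<epsilon>
  proof -
    have "\<epsilon> / (2 * W) > 0" using \<epsilon> W by simp
    then obtain \<delta> where \<delta>: "\<delta> > 0" "\<forall>p\<in>X \<times> sphere 0 1. \<forall>q\<in>X \<times> sphere 0 1. dist q p < \<delta> \<longrightarrow>
        dist (case q of (r, x) \<Rightarrow> g r x) (case p of (r, x) \<Rightarrow> g r x) < \<epsilon> / (2 * W)"
      using uc unfolding uniformly_continuous_on_def by blast
    have "dist (sphere_integral (g s)) (sphere_integral (g r)) < \<epsilon>" if s: "s \<in> X" "dist s r < \<delta>" for s
    proof -
      have "norm (g s x - g r x) \<le> \<epsilon> / (2 * W)" if "x \<in> sphere 0 1" for x
        using \<delta>(2)[rule_format, of "(r, x)" "(s, x)"] r s that by (simp add: dist_norm dist_Pair_Pair)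
      hence "norm (sphere_integral (\<lambda>x. g s x - g r x)) \<le> (real DIM('a) * measure lebesgue (ball (0::'a) 1)) * (\<epsilon> / (2 * W))"
        using gr r s by (intro norm_sphere_integral_le continuous_intros)
      also have "\<dots> \<le> W * (\<epsilon> / (2 * W))"
        using \<epsilon> W by (intro mult_right_mono) (auto simp: W_def)
      also have "\<dots> < \<epsilon>" using \<epsilon> W by simp
      finally show ?thesis using gr r s by (simp add: dist_norm sphere_integral_diff)
    qed
    thus ?thesis using \<delta>(1) by blast
  qed
  thus ?thesis unfolding continuous_on_iff by blast
qed

text \<open>Freezing v at radius s along rays gives \<open>G\<close>, homogeneous of degree 0, whose
  integral over the ball of radius t is exactly t^d \<gamma>. Its derivative at s is the claimed
  value, and the error \<open>D\<close> has derivative 0.\<close>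

lemma sphere_integral_eq_ball_derivative:
  fixes v :: "'a::euclidean_space \<Rightarrow> complex"
  assumes v: "continuous_on UNIV v" and s: "0 < s"
  shows "((\<lambda>t. integral (ball 0 t) v) has_vector_derivative
     s ^ (DIM('a) - 1) *\<^sub>R sphere_integral (\<lambda>x. v (s *\<^sub>R x))) (at s)"
proof -
  let ?d = "DIM('a)"
  define G where "G x = v (s *\<^sub>R (x /\<^sub>R norm x))" for x
  define \<gamma> where "\<gamma> = integral (ball 0 1) G"
  define \<omega> where "\<omega> = measure lebesgue (ball (0::'a) 1)"
  have cvs: "continuous_on (sphere 0 1) (\<lambda>x. v (s *\<^sub>R x))"
    by (intro continuous_on_compose2[OF v] continuous_intros) auto
  have "(G has_integral \<gamma>) (ball 0 1)"
    using integrable_on_sphere_projection[OF cvs] unfolding \<gamma>_def G_def by (rule integrable_integral)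
  hence G: "(G has_integral t ^ ?d *\<^sub>R \<gamma>) (ball 0 t)" if "t > 0" for t
  proof (rule has_integral_ball_homogeneous[OF _ _ that])
    fix c :: real and x :: 'a assume "0 < c"
    hence "(c *\<^sub>R x) /\<^sub>R norm (c *\<^sub>R x) = x /\<^sub>R norm x" by (simp add: field_simps)
    thus "G (c *\<^sub>R x) = G x" by (simp only: G_def)
  qed
  have "((\<lambda>_. 1::real) has_integral \<omega>) (ball (0::'a) 1)"
  proof -
    have "(\<lambda>_. 1::real) integrable_on ball (0::'a) 1" by (intro integrable_on_const lmeasurable_ball)
    thus ?thesis unfolding \<omega>_def lmeasure_integral[OF lmeasurable_ball] by (rule integrable_integral)
  qed
  hence one: "((\<lambda>_. 1::real) has_integral t ^ ?d *\<^sub>R \<omega>) (ball (0::'a) t)" if "t > 0" for t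
    by (rule has_integral_ball_homogeneous[OF _ refl that])
  have vint: "v integrable_on ball 0 t" for t
  proof -
    have "bounded (ball (0::'a) t)" by (rule bounded_ball)
    then obtain a :: 'a where a: "ball 0 t \<subseteq> cbox (- a) a"
      by (rule bounded_subset_cbox_symmetric)
    have "v absolutely_integrable_on cbox (- a) a"
      by (intro absolutely_integrable_continuous continuous_on_subset[OF v]) auto
    hence "v absolutely_integrable_on ball 0 t" by (rule set_integrable_subset) (use a in auto)
    thus ?thesis using set_lebesgue_integral_eq_integral(1) by blast
  qed
  define D where "D t = integral (ball 0 t) v - t ^ ?d *\<^sub>R \<gamma>" for t
  have shell: "norm (D b - D a) \<le> e * \<omega> * (b ^ ?d - a ^ ?d)"
    if ab: "0 < a" "a \<le> b" and le: "\<And>x. x \<in> ball 0 b - ball 0 a \<Longrightarrow> norm (v x - G x) \<le> e" for a b e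
  proof -
    have sub: "negligible (ball 0 a - ball (0::'a) b)" using ab by (auto simp: ball_subset_ball_iff)
    have D: "((\<lambda>x. v x - G x) has_integral D t) (ball 0 t)" if "t > 0" for t
      unfolding D_def using that by (intro has_integral_diff G integrable_integral vint)
    have v: "((\<lambda>x. v x - G x) has_integral D b - D a) (ball 0 b - ball 0 a)"
      using ab sub by (intro has_integral_setdiff D) auto
    have e: "((\<lambda>x. e * 1) has_integral e * (b ^ ?d *\<^sub>R \<omega> - a ^ ?d *\<^sub>R \<omega>)) (ball (0::'a) b - ball 0 a)"
      using ab sub by (intro has_integral_mult_right has_integral_setdiff one) auto
    have "norm (integral (ball 0 b - ball 0 a) (\<lambda>x. v x - G x)) \<le> integral (ball 0 b - ball 0 a) (\<lambda>x::'a. e * 1)"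
      using v e le by (intro integral_norm_bound_integral) (auto simp: has_integral_iff)
    thus ?thesis
      unfolding integral_unique[OF v] integral_unique[OF e] by (simp add: algebra_simps)
  qed
  \<comment> \<open>\<open>v\<close> and its degree-0 homogeneous freezing \<open>G\<close> at radius \<open>s\<close> differ little on thin shells.\<close>
  have "(D has_derivative (\<lambda>_. 0)) (at s)"
    unfolding has_derivative_at_alt
  proof (intro conjI allI impI bounded_linear_zero)
    fix e :: real assume e: "e > 0"
    \<comment> \<open>One more than the slope of t^d at s, hence a Lipschitz constant for t near s;
      \<open>e'\<close> is then chosen so that e' (\<omega> + 1) L = e.\<close>
    define L where "L = real ?d * s ^ (?d - 1) + 1"
    have L: "L > 0" using s by (simp add: L_def add_nonneg_pos)
    define e' where "e' = e / (L * (\<omega> + 1))"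
    have \<omega>: "\<omega> \<ge> 0" by (simp add: \<omega>_def)
    have e': "e' > 0" using e L \<omega> by (simp add: e'_def add_nonneg_pos)
    have "uniformly_continuous_on (cball 0 (2 * s)) v"
      by (intro compact_uniformly_continuous continuous_on_subset[OF v]) auto
    then obtain \<delta> where \<delta>: "\<delta> > 0"
      "\<forall>x\<in>cball 0 (2 * s). \<forall>y\<in>cball 0 (2 * s). dist y x < \<delta> \<longrightarrow> dist (v y) (v x) < e'"
      using e' unfolding uniformly_continuous_on_def by auto
    have "((\<lambda>t. t ^ ?d) has_real_derivative real ?d * s ^ (?d - 1)) (at s)"
      by (auto intro!: derivative_eq_intros)
    hence "((\<lambda>t. t ^ ?d) has_derivative (*) (real ?d * s ^ (?d - 1))) (at s)"
      by (simp add: has_field_derivative_def)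
    hence "\<forall>e>0. \<exists>d>0. \<forall>t. norm (t - s) < d \<longrightarrow>
        norm (t ^ ?d - s ^ ?d - real ?d * s ^ (?d - 1) * (t - s)) \<le> e * norm (t - s)"
      unfolding has_derivative_at_alt by simp
    from this[rule_format, OF zero_less_one] obtain \<eta> where \<eta>: "\<eta> > 0" "\<And>t. norm (t - s) < \<eta> \<Longrightarrow>
        norm (t ^ ?d - s ^ ?d - real ?d * s ^ (?d - 1) * (t - s)) \<le> 1 * norm (t - s)"
      by blast
    have "norm (D t - D s - 0) \<le> e * norm (t - s)" if t: "norm (t - s) < min (min \<delta> \<eta>) s" for t
    proof -
      have t0: "t > 0" "t < 2 * s" using t by auto
      define a b where "a = min s t" and "b = max s t"
      have ab: "0 < a" "a \<le> b" "b < 2 * s" using s t0 by (auto simp: a_def b_def)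
      have "norm (v x - G x) \<le> e'" if x: "x \<in> ball 0 b - ball 0 a" for x
      proof -
        have x': "a \<le> norm x" "norm x < b" using x by auto
        hence x0: "norm x > 0" using ab by linarith
        have "x - s *\<^sub>R (x /\<^sub>R norm x) = (norm x - s) *\<^sub>R (x /\<^sub>R norm x)"
          using x0 by (simp add: scaleR_diff_left left_diff_distrib)
        hence "norm (x - s *\<^sub>R (x /\<^sub>R norm x)) = \<bar>norm x - s\<bar>"
          using x0 by (simp only: norm_scaleR) simp
        also have "\<dots> < \<delta>" using x' t by (auto simp: a_def b_def min_def max_def split: if_splits)
        finally have "dist (v x) (v (s *\<^sub>R (x /\<^sub>R norm x))) < e'"
          using x' ab x0 s by (intro \<delta>(2)[rule_format]) (auto simp: dist_norm)
        thus ?thesis by (simp add: G_def dist_norm)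
      qed
      from shell[OF ab(1,2) this] have "norm (D b - D a) \<le> e' * \<omega> * (b ^ ?d - a ^ ?d)" by simp
      also have "norm (D b - D a) = norm (D t - D s)"
        by (auto simp: a_def b_def min_def max_def norm_minus_commute)
      also have "b ^ ?d - a ^ ?d = \<bar>t ^ ?d - s ^ ?d\<bar>"
        using power_mono[of s t ?d] power_mono[of t s ?d] s t0 by (auto simp: a_def b_def min_def max_def)
      also have "e' * \<omega> * \<bar>t ^ ?d - s ^ ?d\<bar> \<le> e' * (\<omega> + 1) * (L * \<bar>t - s\<bar>)"
      proof (intro mult_mono)
        define c where "c = real ?d * s ^ (?d - 1)"
        have "\<bar>c * (t - s)\<bar> = c * \<bar>t - s\<bar>"
          using s by (simp add: c_def abs_mult)
        moreover have "\<bar>t ^ ?d - s ^ ?d - c * (t - s)\<bar> \<le> \<bar>t - s\<bar>"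
          using \<eta>(2)[of t] t by (simp add: c_def)
        moreover have "L * \<bar>t - s\<bar> = c * \<bar>t - s\<bar> + \<bar>t - s\<bar>"
          by (simp add: L_def c_def distrib_right)
        ultimately show "\<bar>t ^ ?d - s ^ ?d\<bar> \<le> L * \<bar>t - s\<bar>" by linarith
      qed (use e' \<omega> in auto)
      also have "\<dots> = e * norm (t - s)" using L \<omega> by (simp add: e'_def)
      finally show ?thesis by simp
    qed
    thus "\<exists>d>0. \<forall>y. norm (y - s) < d \<longrightarrow> norm (D y - D s - 0) \<le> e * norm (y - s)"
      using \<delta>(1) \<eta>(1) s by (intro exI[of _ "min (min \<delta> \<eta>) s"]) auto
  qed
  hence "(D has_vector_derivative 0) (at s)" by (simp add: has_vector_derivative_def)
  moreover have "((\<lambda>t. t ^ ?d *\<^sub>R \<gamma>) has_vector_derivative (real ?d * s ^ (?d - 1)) *\<^sub>R \<gamma>) (at s)"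
    by (auto intro!: derivative_eq_intros simp: has_vector_derivative_def)
  ultimately have "((\<lambda>t. D t + t ^ ?d *\<^sub>R \<gamma>) has_vector_derivative 0 + (real ?d * s ^ (?d - 1)) *\<^sub>R \<gamma>) (at s)"
    by (rule has_vector_derivative_add)
  moreover have "(real ?d * s ^ (?d - 1)) *\<^sub>R \<gamma> = s ^ (?d - 1) *\<^sub>R sphere_integral (\<lambda>x. v (s *\<^sub>R x))"
    by (simp add: sphere_integral_def \<gamma>_def G_def[abs_def] scaleR_conv_of_real mult_ac)
  ultimately show ?thesis by (simp add: D_def)
qed

lemma integral_polar:
  fixes v :: "'a::euclidean_space \<Rightarrow> complex"
  assumes v: "continuous_on UNIV v" and AB: "0 < A" "A \<le> B"
    and z: "\<And>x. norm x \<notin> {A<..<B} \<Longrightarrow> v x = 0"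
  shows "integral UNIV v = integral {A..B} (\<lambda>s. s ^ (DIM('a) - 1) *\<^sub>R sphere_integral (\<lambda>x. v (s *\<^sub>R x)))"
proof -
  have "((\<lambda>s. s ^ (DIM('a) - 1) *\<^sub>R sphere_integral (\<lambda>x. v (s *\<^sub>R x))) has_integral
     integral (ball 0 B) v - integral (ball 0 A) v) {A..B}"
  proof (rule fundamental_theorem_of_calculus[OF AB(2)])
    fix s assume "s \<in> {A..B}"
    hence "0 < s" using AB by simp
    from sphere_integral_eq_ball_derivative[OF v this]
    show "((\<lambda>t. integral (ball 0 t) v) has_vector_derivative
        s ^ (DIM('a) - 1) *\<^sub>R sphere_integral (\<lambda>x. v (s *\<^sub>R x))) (at s within {A..B})"
      by (rule has_vector_derivative_at_within)
  qed
  moreover have "integral (ball 0 A) v = integral (ball 0 A) (\<lambda>_ :: 'a. 0)"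
    by (rule integral_cong) (rule z, simp)
  moreover have "integral (ball 0 B) v = integral UNIV v"
    by (rule integral_zero_outside) (rule z, simp)
  ultimately show ?thesis by (simp add: has_integral_iff)
qed

section \<open>From the power series to the two-part expansion\<close>

lemma inv2_iff: "0 \<le> t \<Longrightarrow> ereal x < inv2 t \<longleftrightarrow> 2 * t * x < 1"
  by (auto simp: inv2_def field_simps)

lemma summable_restrict:
  fixes a :: "nat \<Rightarrow> 'b::banach"
  assumes "summable (\<lambda>n. norm (a n))"
  shows "summable (\<lambda>n. if P n then a n else 0)"
  by (rule summable_comparison_test'[OF assms]) auto

text \<open>Absolute convergence separates the even from the odd terms. The even ones vanish up to
  2m and can be shifted to start there, so both halves run over the same j.\<close>

lemma sums_even_odd_split:
  fixes u :: "nat \<Rightarrow> complex"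
  assumes u: "summable (\<lambda>n. norm (u n))" "u sums s"
    and zero: "\<And>n. n < 2 * m \<Longrightarrow> even n \<Longrightarrow> u n = 0"
  shows "(\<lambda>j. u (2 * j + 2 * m) + u (2 * j + 1)) sums s"
proof -
  have "summable (\<lambda>j. norm (u (2 * j)))" "summable (\<lambda>j. norm (u (2 * j + 1)))"
    using summable_reindex[OF u(1), of "\<lambda>j. 2 * j"] summable_reindex[OF u(1), of "\<lambda>j. 2 * j + 1"]
    by (auto simp: inj_on_def o_def)
  hence "summable (\<lambda>j. u (2 * j))" "summable (\<lambda>j. u (2 * j + 1))"
    by (auto intro: summable_norm_cancel)
  then obtain e o' where eo: "(\<lambda>j. u (2 * j)) sums e" "(\<lambda>j. u (2 * j + 1)) sums o'"
    by (auto simp: summable_def)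
  have "(\<lambda>j. \<Sum>i\<in>{j*2..<j*2+2}. u i) sums s" by (rule sums_group[OF u(2)]) simp
  moreover have "(\<Sum>i\<in>{j*2..<j*2+2}. u i) = u (2 * j) + u (2 * j + 1)" for j
    by (simp add: numeral_2_eq_2 mult.commute)
  ultimately have "(\<lambda>j. u (2 * j) + u (2 * j + 1)) sums s" by simp
  hence s: "s = e + o'" using sums_add[OF eo] sums_unique2 by blast
  have "(\<lambda>j. u (2 * (j + m))) sums e"
    using zero by (subst sums_zero_iff_shift) (auto simp: eo)
  from sums_add[OF this eo(2)] show ?thesis by (simp add: s algebra_simps)
qed

lemma power_series_imp_expansion:
  fixes b :: "nat \<Rightarrow> complex" and k d m :: nat
  assumes \<tau>: "0 \<le> \<tau>" and m: "2 * m + 1 = 2 * k + d"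
    and b: "\<And>z. 2 * \<tau> * norm z < 1 \<Longrightarrow> summable (\<lambda>n. b n * z ^ n)"
    and b0: "\<And>n. n < 2 * m \<Longrightarrow> even n \<Longrightarrow> b n = 0"
  shows "\<exists>c. let g = (\<lambda>j z. c (2*j) * z ^ (k + 2*j) + c (2*j+1) * z powi (2 * int j - int k - int d + 2))
    in conv_radius (\<lambda>n. if even n then c n else 0) \<ge> inv2 \<tau>
     \<and> conv_radius (\<lambda>n. if even n then c (n+1) else 0) \<ge> inv2 \<tau>
     \<and> (\<forall>K. compact K \<and> K \<subseteq> {z. 0 < norm z \<and> ereal (norm z) < inv2 \<tau>} \<longrightarrow>
          uniform_limit K (\<lambda>n z. \<Sum>j<n. g j z) (\<lambda>z. \<Sum>j. g j z) sequentially
        \<and> uniform_limit K (\<lambda>n z. \<Sum>j<n. norm (g j z)) (\<lambda>z. \<Sum>j. norm (g j z)) sequentially)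
     \<and> (\<forall>z. z \<noteq> 0 \<longrightarrow> 2 * \<tau> * norm z < 1 \<longrightarrow> z powi (int k - 2 * int m) * (\<Sum>n. b n * z ^ n) = (\<Sum>j. g j z))"
proof -
  have babs: "summable (\<lambda>n. norm (b n * z ^ n))" if z: "2 * \<tau> * norm z < 1" for z
  proof -
    obtain s where s: "norm z < s" "2 * \<tau> * s < 1"
      using increase_below_reciprocal[of "2 * \<tau>" "norm z"] z \<tau> by (auto simp: mult.commute)
    have "0 < s" using s(1) norm_ge_zero[of z] by linarith
    show ?thesis
      by (rule powser_insidea[where x = "of_real s"]) (use s \<open>0 < s\<close> b in auto)
  qed
  \<comment> \<open>The even part of the series really starts at 2m and is moved down to index 0;
    the odd part starts at 1 and keeps its indices.\<close>
  define c where "c n = (if even n then b (n + 2 * m) else b n)" for n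
  define g where "g j z = c (2*j) * z ^ (k + 2*j) + c (2*j+1) * z powi (2 * int j - int k - int d + 2)" for j z
  have g: "g j z = z powi (int k - 2 * int m) * (b (2 * j + 2 * m) * z ^ (2 * j + 2 * m) + b (2 * j + 1) * z ^ (2 * j + 1))"
    if z: "z \<noteq> 0" for j z
  proof -
    have "z ^ (k + 2 * j) = z powi (int k - 2 * int m) * z ^ (2 * j + 2 * m)"
    proof -
      have "z ^ (k + 2 * j) = z powi int (k + 2 * j)" by (rule power_int_of_nat[symmetric])
      also have "int (k + 2 * j) = (int k - 2 * int m) + int (2 * j + 2 * m)" by simp
      finally show ?thesis by (simp only: power_int_add[OF disjI1[OF z]] power_int_of_nat)
    qed
    moreover have "z powi (2 * int j - int k - int d + 2) = z powi (int k - 2 * int m) * z ^ (2 * j + 1)"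
    proof -
      have "2 * int m + 1 = 2 * int k + int d" using m by linarith
      hence "2 * int j - int k - int d + 2 = (int k - 2 * int m) + int (2 * j + 1)" by simp
      thus ?thesis by (simp only: power_int_add[OF disjI1[OF z]] power_int_of_nat)
    qed
    ultimately show ?thesis by (simp add: g_def c_def algebra_simps)
  qed
  \<comment> \<open>Serves both series: i = 2m for the even coefficients and i = 1 for the odd ones.
    Dividing by r^i undoes the shift.\<close>
  have radius: "inv2 \<tau> \<le> conv_radius (\<lambda>n. if even n then b (n + i) else 0)" for i
  proof (rule conv_radius_geI_ex)
    fix r :: real assume r: "0 < r" "ereal r < inv2 \<tau>"
    hence "summable (\<lambda>n. norm (b n * of_real r ^ n))" using \<tau> by (intro babs) (simp add: inv2_iff)
    hence "summable (\<lambda>n. norm (b (n + i) * of_real r ^ (n + i)))" by (rule summable_ignore_initial_segment)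
    hence "summable (\<lambda>n. if even n then b (n + i) * of_real r ^ (n + i) else 0)" by (rule summable_restrict)
    hence "summable (\<lambda>n. (if even n then b (n + i) * of_real r ^ (n + i) else 0) / of_real r ^ i)"
      by (rule summable_divide)
    moreover have "(if even n then b (n + i) * of_real r ^ (n + i) else 0) / of_real r ^ i
       = (if even n then b (n + i) else 0) * complex_of_real r ^ n" for n
      using r by (simp add: power_add)
    ultimately show "\<exists>z. norm z = r \<and> summable (\<lambda>n. (if even n then b (n + i) else 0) * z ^ n)"
      using r by (intro exI[of _ "of_real r"]) simp
  qed
  have "(\<lambda>n. if even n then c n else 0) = (\<lambda>n. if even n then b (n + 2 * m) else 0)"
    "(\<lambda>n. if even n then c (n+1) else 0) = (\<lambda>n. if even n then b (n + 1) else 0)"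
    by (auto simp: c_def)
  with radius have rad: "conv_radius (\<lambda>n. if even n then c n else 0) \<ge> inv2 \<tau>"
    "conv_radius (\<lambda>n. if even n then c (n+1) else 0) \<ge> inv2 \<tau>"
    by metis+
  have unif: "uniform_limit K (\<lambda>n z. \<Sum>j<n. g j z) (\<lambda>z. \<Sum>j. g j z) sequentially
      \<and> uniform_limit K (\<lambda>n z. \<Sum>j<n. norm (g j z)) (\<lambda>z. \<Sum>j. norm (g j z)) sequentially"
    if K: "compact K" "K \<subseteq> {z. 0 < norm z \<and> ereal (norm z) < inv2 \<tau>}" for K
  proof (cases "K = {}")
    case False
    have "continuous_on K (\<lambda>z. norm z)" by (intro continuous_intros)
    from continuous_attains_sup[OF K(1) False this]
    obtain z1 where z1: "z1 \<in> K" "\<And>z. z \<in> K \<Longrightarrow> norm z \<le> norm z1" by blast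
    have "continuous_on K (\<lambda>z. norm (z powi (int k - 2 * int m)))"
      using K(2) by (intro continuous_intros) auto
    from continuous_attains_sup[OF K(1) False this]
    obtain z2 :: complex where z2: "\<And>z. z \<in> K \<Longrightarrow> norm (z powi (int k - 2 * int m)) \<le> norm (z2 powi (int k - 2 * int m))" by blast
    define D where "D = norm (z2 powi (int k - 2 * int m))"
    \<comment> \<open>A majorant on \<open>K\<close>: the terms b_n z^n are largest in norm at the
      point \<open>z1\<close> farthest from 0, while the prefactor, whose exponent may be negative,
      is maximised separately at \<open>z2\<close>.\<close>
    define M where "M j = D * (norm (b (2 * j + 2 * m) * z1 ^ (2 * j + 2 * m)) + norm (b (2 * j + 1) * z1 ^ (2 * j + 1)))" for j
    have bound: "norm (g j z) \<le> M j" if z: "z \<in> K" for j z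
    proof -
      have "z \<noteq> 0" using K(2) z by auto
      have "norm (b n * z ^ n) \<le> norm (b n * z1 ^ n)" for n
        using z1(2)[OF z] by (simp add: norm_mult norm_power mult_left_mono power_mono)
      hence "norm (b (2 * j + 2 * m) * z ^ (2 * j + 2 * m) + b (2 * j + 1) * z ^ (2 * j + 1))
          \<le> norm (b (2 * j + 2 * m) * z1 ^ (2 * j + 2 * m)) + norm (b (2 * j + 1) * z1 ^ (2 * j + 1))"
        by (intro norm_triangle_le add_mono)
      thus ?thesis
        unfolding g[OF \<open>z \<noteq> 0\<close>] M_def norm_mult[of "z powi _"] D_def
        using z2[OF z] by (intro mult_mono) auto
    qed
    have "2 * \<tau> * norm z1 < 1" using z1(1) K(2) \<tau> by (auto simp: inv2_iff)
    note s = babs[OF this]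
    have "summable (\<lambda>j. norm (b (2 * j + 2 * m) * z1 ^ (2 * j + 2 * m)))" "summable (\<lambda>j. norm (b (2 * j + 1) * z1 ^ (2 * j + 1)))"
      using summable_reindex[OF s, of "\<lambda>j. 2 * j + 2 * m"] summable_reindex[OF s, of "\<lambda>j. 2 * j + 1"]
      by (simp_all add: inj_on_def o_def)
    hence M: "summable M" unfolding M_def by (intro summable_mult summable_add)
    show ?thesis
      using Weierstrass_m_test[OF bound M] Weierstrass_m_test[of K "\<lambda>j z. norm (g j z)" M, OF _ M] bound by simp
  qed simp
  have value_eq: "z powi (int k - 2 * int m) * (\<Sum>n. b n * z ^ n) = (\<Sum>j. g j z)"
    if z: "z \<noteq> 0" "2 * \<tau> * norm z < 1" for z
  proof -
    have "(\<lambda>j. b (2 * j + 2 * m) * z ^ (2 * j + 2 * m) + b (2 * j + 1) * z ^ (2 * j + 1)) sums (\<Sum>n. b n * z ^ n)"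
      using b0 by (intro sums_even_odd_split[of "\<lambda>n. b n * z ^ n"] babs z summable_sums b) auto
    from sums_mult[OF this, of "z powi (int k - 2 * int m)"] show ?thesis
      unfolding g[OF z(1)] by (simp add: sums_iff)
  qed
  show ?thesis
    unfolding Let_def
    by (intro exI[of _ c] conjI allI impI rad) (use unif value_eq in \<open>unfold g_def, blast+\<close>)
qed

section \<open>The spherical coefficients of f\<close>

lemma open_annulus: "open (annulus r0 r1 :: 'a::euclidean_space set)"
  unfolding annulus_def by (intro open_Collect_conj open_Collect_less continuous_intros)

text \<open>The weight collects the Jacobian s^(d-1), the factor s^k from homogeneity of
  \<open>q\<close>, and another s^k that compensates the division by s^k: together s^(2m).\<close>

lemma integral_polar_homogeneous:
  fixes h q :: "'a::euclidean_space \<Rightarrow> complex" and k m :: nat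
  assumes m: "2 * m + 1 = 2 * k + DIM('a)"
    and G: "open G" "0 \<notin> G" and h: "continuous_on G h" and q: "harm_hom_poly k q"
    and AB: "0 < A" "A < B" and K: "{x. A \<le> norm x \<and> norm x \<le> B} \<subseteq> G"
    and \<eta>: "continuous_on {0<..} \<eta>" and z: "\<And>s. s \<notin> {A<..<B} \<Longrightarrow> \<eta> s = 0"
  shows "integral UNIV (\<lambda>x. h x * (q x * \<eta> (norm x))) =
    integral {A..B} (\<lambda>s. s ^ (2 * m) *\<^sub>R ((sphere_integral (\<lambda>x. h (s *\<^sub>R x) * q x) /\<^sub>R s ^ k) * \<eta> s))"
proof -
  have annular: "{x::'a. A \<le> norm x \<and> norm x \<le> B} = cball 0 B - ball 0 A" by auto
  have cont: "continuous_on UNIV (\<lambda>x. h x * (q x * \<eta> (norm x)))"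
  proof (rule continuous_on_UNIV_of_support[OF G(1) _ K])
    show "closed {x::'a. A \<le> norm x \<and> norm x \<le> B}" unfolding annular by (intro closed_Diff) auto
    have "continuous_on G q"
      using smooth_onD(1)[OF harm_hom_poly_smooth[OF q], of "[]"] by (auto intro: continuous_on_subset)
    moreover have "continuous_on G (\<lambda>x. \<eta> (norm x))"
    proof (rule continuous_on_compose2[OF \<eta>])
      show "norm ` G \<subseteq> {0<..}" using G(2) by auto
    qed (intro continuous_intros)
    ultimately show "continuous_on G (\<lambda>x. h x * (q x * \<eta> (norm x)))"
      by (intro continuous_on_mult h)
  qed (use z in auto)
  have "integral UNIV (\<lambda>x. h x * (q x * \<eta> (norm x))) = integral {A..B} (\<lambda>s. s ^ (DIM('a) - 1) *\<^sub>R
      sphere_integral (\<lambda>x. h (s *\<^sub>R x) * (q (s *\<^sub>R x) * \<eta> (norm (s *\<^sub>R x)))))"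
    by (rule integral_polar[OF cont]) (use AB z in auto)
  also have "\<dots> = integral {A..B} (\<lambda>s. s ^ (2 * m) *\<^sub>R ((sphere_integral (\<lambda>x. h (s *\<^sub>R x) * q x) /\<^sub>R s ^ k) * \<eta> s))"
  proof (rule integral_cong)
    fix s assume "s \<in> {A..B}"
    hence s: "0 < s" using AB by simp
    have "sphere_integral (\<lambda>x. h (s *\<^sub>R x) * (q (s *\<^sub>R x) * \<eta> (norm (s *\<^sub>R x))))
        = sphere_integral (\<lambda>x. (of_real s ^ k * \<eta> s) * (h (s *\<^sub>R x) * q x))"
      by (rule sphere_integral_cong) (use s in \<open>simp add: harm_hom_poly_scaleR[OF q] mult_ac\<close>)
    also have "\<dots> = (of_real s ^ k * \<eta> s) * sphere_integral (\<lambda>x. h (s *\<^sub>R x) * q x)"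
      by (rule sphere_integral_mult)
    finally have eq: "sphere_integral (\<lambda>x. h (s *\<^sub>R x) * (q (s *\<^sub>R x) * \<eta> (norm (s *\<^sub>R x)))) = \<dots>" .
    have "DIM('a) - 1 + k + k = 2 * m" using m DIM_positive[where 'a = 'a] by linarith
    hence "s ^ (2 * m) = s ^ (DIM('a) - 1) * s ^ k * s ^ k" by (simp flip: power_add)
    thus "s ^ (DIM('a) - 1) *\<^sub>R sphere_integral (\<lambda>x. h (s *\<^sub>R x) * (q (s *\<^sub>R x) * \<eta> (norm (s *\<^sub>R x))))
        = s ^ (2 * m) *\<^sub>R ((sphere_integral (\<lambda>x. h (s *\<^sub>R x) * q x) /\<^sub>R s ^ k) * \<eta> s)"
      unfolding eq using s by (simp add: scaleR_conv_of_real)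
  qed
  finally show ?thesis .
qed

lemma Icc_subset_einterval:
  assumes "x \<in> einterval a b" "y \<in> einterval a b"
  shows "{x..y} \<subseteq> einterval a b"
  using assms is_interval_einterval by (meson atLeastAtMost_iff is_interval_1 subsetI)

lemma annulus_shell_subset:
  assumes "r0 < x" "ereal y < r1"
  shows "{z::'a::euclidean_space. x \<le> norm z \<and> norm z \<le> y} \<subseteq> annulus r0 r1"
proof
  fix z :: 'a assume "z \<in> {z. x \<le> norm z \<and> norm z \<le> y}"
  hence "x \<le> norm z" "ereal (norm z) \<le> ereal y" by auto
  thus "z \<in> annulus r0 r1"
    using assms le_less_trans[of "ereal (norm z)" "ereal y" r1] by (simp add: annulus_def)
qed

text \<open>Polar coordinates, Green's identity, and polar coordinates again give the weak equation
  on every [A, B] inside the interval; regularity of weak solutions makes it classical. The growth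
  bound passes through the integral.\<close>

lemma sphere_coefficients_bessel_tower:
  fixes f q :: "'a::euclidean_space \<Rightarrow> complex" and k m :: nat
  assumes m: "2 * m + 1 = 2 * k + DIM('a)"
    and r0: "0 \<le> r0" and f: "polyharmonic_inf (annulus r0 r1) \<tau> f" and q: "harm_hom_poly k q"
  defines "g \<equiv> \<lambda>p r. sphere_integral (\<lambda>x. (lap ^^ p) f (r *\<^sub>R x) * q x) /\<^sub>R r ^ k"
  shows "\<exists>g'. bessel_tower m \<tau> (einterval (ereal r0) r1) g g'"
proof -
  let ?G = "annulus r0 r1 :: 'a set"
  let ?I = "einterval (ereal r0) r1"
  have G: "open ?G" "0 \<notin> ?G" using open_annulus r0 by (auto simp: annulus_def)
  have sf: "smooth_on ?G ((lap ^^ p) f)" for p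
    using f smooth_on_lap_iterate[OF G(1)] by (simp add: polyharmonic_inf_def)
  have cq: "continuous_on (sphere 0 1) q"
    using smooth_onD(1)[OF harm_hom_poly_smooth[OF q], of "[]"] by (auto intro: continuous_on_subset)
  have cf: "continuous_on ?G ((lap ^^ p) f)" for p
    using smooth_onD(1)[OF sf, of "[]"] by simp
  have shell: "s *\<^sub>R x \<in> ?G" if "s \<in> ?I" "x \<in> sphere 0 1" for s and x :: 'a
    using that r0 by (auto simp: annulus_def einterval_iff)
  have csphere: "continuous_on {A..B} (\<lambda>r. sphere_integral (\<lambda>x. (lap ^^ p) f (r *\<^sub>R x) * q x))"
    if "{A..B} \<subseteq> ?I" for A B p
  proof (rule continuous_on_sphere_integral)
    have "continuous_on ({A..B} \<times> sphere 0 1) (\<lambda>y. (lap ^^ p) f (fst y *\<^sub>R snd y) * q (snd y))"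
      using that shell
      by (intro continuous_on_mult continuous_on_compose2[OF cf] continuous_on_compose2[OF cq] continuous_intros) auto
    thus "continuous_on ({A..B} \<times> sphere 0 1) (\<lambda>(r, x). (lap ^^ p) f (r *\<^sub>R x) * q x)"
      by (simp add: case_prod_unfold)
  qed simp
  have eq: "\<exists>g'. \<forall>s\<in>{A<..<B}. (g p has_vector_derivative g' s) (at s) \<and>
      (g' has_vector_derivative (g (Suc p) s - (2 * real m / s) *\<^sub>R g' s)) (at s)"
    if AB: "0 < A" "A < B" "A \<in> ?I" "B \<in> ?I" for A B p
  proof (rule weak_bessel_equation[where g = "g p" and ?g1.0 = "g (Suc p)", OF AB(1,2)])
    have sub: "{A..B} \<subseteq> ?I"
      using AB(3,4) by (rule Icc_subset_einterval)
    have K: "{x::'a. A \<le> norm x \<and> norm x \<le> B} \<subseteq> ?G"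
      using AB by (intro annulus_shell_subset) (auto simp: einterval_iff)
    have cg: "continuous_on {A..B} (g n)" for n
      unfolding g_def using AB(1) by (intro continuous_intros csphere[OF sub]) auto
    show "continuous_on {A..B} (g p)" "continuous_on {A..B} (g (Suc p))" by (rule cg)+
    fix \<phi> \<phi>' \<phi>'' :: "real \<Rightarrow> complex"
    assume d: "\<And>s. (\<phi> has_vector_derivative \<phi>' s) (at s)" "\<And>s. (\<phi>' has_vector_derivative \<phi>'' s) (at s)"
      and c: "continuous_on UNIV \<phi>''"
      and z: "\<And>s. s \<notin> {A<..<B} \<Longrightarrow> \<phi> s = 0 \<and> \<phi>' s = 0 \<and> \<phi>'' s = 0"
    have c\<phi>: "continuous_on {0<..} \<phi>" "continuous_on {0<..} \<phi>'" "continuous_on {0<..} \<phi>''"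
      using continuous_on_vector_derivative[of UNIV \<phi> \<phi>'] continuous_on_vector_derivative[of UNIV \<phi>' \<phi>''] d c
      by (auto intro: continuous_on_subset)
    have "integral {A..B} (\<lambda>s. s ^ (2 * m) *\<^sub>R (g (Suc p) s * \<phi> s))
        = integral UNIV (\<lambda>x. (lap ^^ Suc p) f x * (q x * \<phi> (norm x)))"
      unfolding g_def
      by (rule integral_polar_homogeneous[OF m G cf q AB(1,2) K c\<phi>(1), symmetric]) (use z in blast)
    also have "(lap ^^ Suc p) f = lap ((lap ^^ p) f)" by simp
    also have "integral UNIV (\<lambda>x. lap ((lap ^^ p) f) x * (q x * \<phi> (norm x))) = integral UNIV (\<lambda>x. (lap ^^ p) f x * (q x *
        (\<phi>'' (norm x) + ((2 * real k + real DIM('a) - 1) / norm x) *\<^sub>R \<phi>' (norm x))))"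
    proof (rule green_identity_radial[OF G sf q K d c])
      show "\<phi> s = 0 \<and> \<phi>' s = 0 \<and> \<phi>'' s = 0" if "s \<notin> {A..B}" for s
        by (rule z) (use that in auto)
    qed
    also have "2 * real k + real DIM('a) - 1 = 2 * real m"
      using arg_cong[OF m, of real] by simp
    also have "integral UNIV (\<lambda>x. (lap ^^ p) f x * (q x * (\<phi>'' (norm x) + (2 * real m / norm x) *\<^sub>R \<phi>' (norm x))))
        = integral {A..B} (\<lambda>s. s ^ (2 * m) *\<^sub>R (g p s * (\<phi>'' s + (2 * real m / s) *\<^sub>R \<phi>' s)))"
      unfolding g_def
    proof (rule integral_polar_homogeneous[OF m G cf q AB(1,2) K])
      show "continuous_on {0<..} (\<lambda>s. \<phi>'' s + (2 * real m / s) *\<^sub>R \<phi>' s)"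
        by (intro continuous_on_add continuous_on_scaleR continuous_on_divide continuous_on_const continuous_on_id c\<phi>) auto
      show "\<phi>'' s + (2 * real m / s) *\<^sub>R \<phi>' s = 0" if "s \<notin> {A<..<B}" for s
        using z[OF that] by simp
    qed
    finally show "integral {A..B} (\<lambda>s. s ^ (2 * m) *\<^sub>R (g (Suc p) s * \<phi> s))
        = integral {A..B} (\<lambda>s. s ^ (2 * m) *\<^sub>R (g p s * (\<phi>'' s + (2 * real m / s) *\<^sub>R \<phi>' s)))" .
  qed
  \<comment> \<open>Each small interval yields its own derivative function; the canonical
    \<open>vector_derivative\<close> agrees with all of them and glues them together.\<close>
  define g' where "g' p s = vector_derivative (g p) (at s)" for p s
  have "(g p has_vector_derivative g' p s) (at s) \<and>
      (g' p has_vector_derivative (g (Suc p) s - (2 * real m / s) *\<^sub>R g' p s)) (at s)" if s: "s \<in> ?I" for p s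
  proof -
    obtain e where e: "e > 0" "cball s e \<subseteq> ?I"
      using open_contains_cball[of ?I] open_einterval s by blast
    have AB: "s - e \<in> ?I" "s + e \<in> ?I" using e by (auto simp: subset_eq dist_real_def)
    hence "ereal r0 < ereal (s - e)" by (simp add: einterval_iff)
    hence "0 < s - e" using r0 by simp
    moreover have "s - e < s + e" using e by simp
    ultimately obtain G' where G0: "\<forall>t\<in>{s - e<..<s + e}. (g p has_vector_derivative G' t) (at t) \<and>
        (G' has_vector_derivative (g (Suc p) t - (2 * real m / t) *\<^sub>R G' t)) (at t)"
      using eq[OF _ _ AB, of p] by blast
    hence G': "(g p has_vector_derivative G' t) (at t)"
        "(G' has_vector_derivative (g (Suc p) t - (2 * real m / t) *\<^sub>R G' t)) (at t)"
      if "t \<in> {s - e<..<s + e}" for t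
      using that by auto
    have G'_eq: "G' t = g' p t" if "t \<in> {s - e<..<s + e}" for t
      unfolding g'_def using vector_derivative_at[OF G'(1)[OF that]] by simp
    have s': "s \<in> {s - e<..<s + e}" using e by simp
    have "(g' p has_vector_derivative (g (Suc p) s - (2 * real m / s) *\<^sub>R G' s)) (at s)"
      by (rule has_vector_derivative_transform_within_open[OF G'(2)[OF s'] _ s']) (use G'_eq in auto)
    with G'(1)[OF s'] show ?thesis by (simp add: G'_eq[OF s'])
  qed
  moreover have "factorial_growth \<tau> ?I g"
    unfolding factorial_growth_def
  proof (intro ballI allI impI)
    fix x y \<epsilon> :: real assume xy: "x \<in> ?I" "y \<in> ?I" and \<epsilon>: "0 < \<epsilon>"
    have \<tau>: "0 \<le> \<tau>" using f by (simp add: polyharmonic_inf_def)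
    have x0: "0 < x" using xy einterval_subset_pos[of "ereal r0" r1] r0 by auto
    define K :: "'a set" where "K = {z. x \<le> norm z \<and> norm z \<le> y}"
    have "K = cball 0 y - ball 0 x" by (auto simp: K_def)
    hence "compact K" by (simp add: compact_diff)
    moreover have "K \<subseteq> ?G"
      unfolding K_def using xy by (intro annulus_shell_subset) (auto simp: einterval_iff)
    moreover have "\<forall>K. compact K \<and> K \<subseteq> ?G \<longrightarrow> (\<forall>\<epsilon>>0. \<exists>C>0. \<forall>p. \<forall>x\<in>K.
        norm ((lap ^^ p) f x) \<le> C * fact (2 * p) * (\<tau> + \<epsilon>) ^ (2 * p))"
      using f unfolding polyharmonic_inf_def by (elim conjE)
    ultimately have "\<exists>C>0. \<forall>p. \<forall>x\<in>K. norm ((lap ^^ p) f x) \<le> C * fact (2 * p) * (\<tau> + \<epsilon>) ^ (2 * p)"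
      using \<epsilon> by simp
    then obtain C where C0: "C > 0"
      "\<forall>p. \<forall>x\<in>K. norm ((lap ^^ p) f x) \<le> C * fact (2 * p) * (\<tau> + \<epsilon>) ^ (2 * p)" by blast
    note C = C0(1) C0(2)[rule_format]
    have "compact (q ` sphere 0 1)" using cq by (intro compact_continuous_image) auto
    hence "bounded (q ` sphere 0 1)" by (rule compact_imp_bounded)
    then obtain Q where Q0: "\<forall>y\<in>q ` sphere 0 1. norm y \<le> Q" unfolding bounded_iff ..
    have Q: "norm (q z) \<le> \<bar>Q\<bar>" if "z \<in> sphere 0 1" for z
      using bspec[OF Q0 imageI[OF that]] by linarith
    define W where "W = real DIM('a) * measure lebesgue (ball (0::'a) 1)"
    \<comment> \<open>Area of the sphere times the bounds of \<Delta>^p f and \<open>q\<close>, with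
      x^k the smallest value of r^k on the interval; the 1 ensures positivity.\<close>
    define L where "L = W * C * \<bar>Q\<bar> / x ^ k + 1"
    have W: "W \<ge> 0" by (simp add: W_def)
    have L: "L > 0" using W C(1) x0 by (auto simp: L_def intro!: add_nonneg_pos)
    have "norm (g p r) \<le> L * fact (2 * p) * (\<tau> + \<epsilon>) ^ (2 * p)" if r: "r \<in> {x..y}" for p r
    proof -
      define E where "E = fact (2 * p) * (\<tau> + \<epsilon>) ^ (2 * p)"
      have E: "E \<ge> 0" using \<tau> \<epsilon> by (simp add: E_def)
      have r': "r \<in> ?I" using Icc_subset_einterval[OF xy] r by blast
      have r0': "0 < r" using r x0 by auto
      have "norm (sphere_integral (\<lambda>z. (lap ^^ p) f (r *\<^sub>R z) * q z)) \<le> W * (C * E * \<bar>Q\<bar>)"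
        unfolding W_def
      proof (rule norm_sphere_integral_le)
        show "continuous_on (sphere 0 1) (\<lambda>z. (lap ^^ p) f (r *\<^sub>R z) * q z)"
          using shell[OF r'] by (intro continuous_on_mult continuous_on_compose2[OF cf] cq continuous_intros) auto
        fix z :: 'a assume z: "z \<in> sphere 0 1"
        have "r *\<^sub>R z \<in> K" using r z r0' by (simp add: K_def)
        from C(2)[OF this, of p] have "norm ((lap ^^ p) f (r *\<^sub>R z)) \<le> C * E"
          by (simp only: E_def mult.assoc)
        thus "norm ((lap ^^ p) f (r *\<^sub>R z) * q z) \<le> C * E * \<bar>Q\<bar>"
          unfolding norm_mult by (rule mult_mono[OF _ Q[OF z]]) (use C(1) E in simp_all)
      qed
      hence "norm (g p r) \<le> W * (C * E * \<bar>Q\<bar>) / r ^ k"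
        using r0' unfolding g_def norm_scaleR by (simp add: divide_right_mono flip: divide_inverse_commute)
      also have "\<dots> \<le> W * (C * E * \<bar>Q\<bar>) / x ^ k"
      proof (rule divide_left_mono)
        show "x ^ k \<le> r ^ k" using r x0 by (intro power_mono) auto
        show "0 \<le> W * (C * E * \<bar>Q\<bar>)" using W C(1) E by simp
        show "0 < r ^ k * x ^ k" using r0' x0 by simp
      qed
      also have "\<dots> = (L - 1) * E" by (simp add: L_def)
      also have "\<dots> \<le> L * E" using E by (intro mult_right_mono) auto
      finally show ?thesis by (simp add: E_def mult.assoc)
    qed
    thus "\<exists>C>0. \<forall>p. \<forall>r\<in>{x..y}. norm (g p r) \<le> C * fact (2 * p) * (\<tau> + \<epsilon>) ^ (2 * p)"
      using L by blast
  qed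
  ultimately have "bessel_tower m \<tau> ?I g g'" by (simp add: bessel_tower_def)
  thus ?thesis by blast
qed

theorem mainTheorem15:
  fixes f :: "'a::euclidean_space \<Rightarrow> complex" and r0 :: real and r1 :: ereal and \<tau> :: real
    and Y :: "nat \<Rightarrow> nat \<Rightarrow> 'a \<Rightarrow> complex" and a :: "nat \<Rightarrow> nat"
  assumes "odd DIM('a)" and "DIM('a) > 1"
    and "0 \<le> r0" and "ereal r0 < r1"
    and "polyharmonic_inf (annulus r0 r1) \<tau> f"
    and "ereal \<tau> < inv2 r0"
    and "\<forall>k. sph_ONB k (a k) (Y k)"
  shows "\<forall>k. \<forall>l\<in>{1..a k}. \<exists>c :: nat \<Rightarrow> complex.
     (let g = (\<lambda>j z. c (2*j) * z ^ (k + 2*j)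
                  + c (2*j+1) * z powi (2 * int j - int k - int DIM('a) + 2))
      in conv_radius (\<lambda>n. if even n then c n else 0) \<ge> inv2 \<tau>
       \<and> conv_radius (\<lambda>n. if even n then c (n+1) else 0) \<ge> inv2 \<tau>
       \<and> (\<forall>K. compact K \<and> K \<subseteq> {z. 0 < norm z \<and> ereal (norm z) < inv2 \<tau>} \<longrightarrow>
            uniform_limit K (\<lambda>n z. \<Sum>j<n. g j z) (\<lambda>z. \<Sum>j. g j z) sequentially
          \<and> uniform_limit K (\<lambda>n z. \<Sum>j<n. norm (g j z)) (\<lambda>z. \<Sum>j. norm (g j z)) sequentially)
       \<and> (\<forall>r. r0 < r \<and> ereal r < r1 \<and> ereal r < inv2 \<tau> \<longrightarrow>
            sph_coeff f (Y k l) r = (\<Sum>j. g j (complex_of_real r))))"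
    (is "\<forall>k. \<forall>l\<in>{1..a k}. ?P k l")
proof (intro allI ballI)
  fix k l assume l: "l \<in> {1..a k}"
  define q where "q x = cnj (Y k l x)" for x
  have q: "harm_hom_poly k q"
    unfolding q_def using assms(7) l by (intro harm_hom_poly_cnj) (simp add: sph_ONB_def)
  have \<tau>: "0 \<le> \<tau>" using assms(5) by (simp add: polyharmonic_inf_def)
  \<comment> \<open>For odd d this is k + (d - 1)/2.\<close>
  define m where "m = k + DIM('a) div 2"
  have m: "2 * m + 1 = 2 * k + DIM('a)"
    using odd_two_times_div_two_succ[OF assms(1)] by (simp add: m_def)
  \<comment> \<open>Both \<tau> < 1/(2 r0) and r0 < 1/(2 \<tau>) say 2 \<tau> r0 < 1, so a centre
    \<rho> exists between r0 and the smaller of r1 and 1/(2 \<tau>).\<close>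
  have "ereal r0 < inv2 \<tau>"
    using assms(3,6) \<tau> by (simp add: inv2_iff mult.commute mult.left_commute)
  then obtain \<rho> where \<rho>: "ereal r0 < ereal \<rho>" "ereal \<rho> < r1" "2 * \<tau> * \<rho> < 1"
    using ereal_dense2[of "ereal r0" "min r1 (inv2 \<tau>)"] assms(4) \<tau> by (auto simp: inv2_iff)
  define g where "g p r = sphere_integral (\<lambda>x. (lap ^^ p) f (r *\<^sub>R x) * q x) /\<^sub>R r ^ k" for p r
  obtain g' where T: "bessel_tower m \<tau> (einterval (ereal r0) r1) g g'"
    using sphere_coefficients_bessel_tower[OF m assms(3,5) q] unfolding g_def by blast
  have r0': "0 \<le> ereal r0" using assms(3) by simp
  obtain b where b: "\<forall>z. 2 * \<tau> * norm z < 1 \<longrightarrow> summable (\<lambda>n. b n * z ^ n)"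
    and bg: "\<forall>r\<in>einterval (ereal r0) r1. 2 * \<tau> * r < 1 \<longrightarrow>
        (\<lambda>n. b n * of_real r ^ n) sums (of_real r ^ (2 * m) * g 0 r)"
    and b0: "\<forall>n<2*m. even n \<longrightarrow> b n = 0"
    using bessel_tower_power_series[OF T \<tau> r0' \<rho>] by (elim exE conjE)
  have coeff: "sph_coeff f (Y k l) r = of_real r powi (int k - 2 * int m) * (\<Sum>n. b n * of_real r ^ n)"
    if r: "r0 < r" "ereal r < r1" "ereal r < inv2 \<tau>" for r
  proof -
    have "0 < r" using r assms(3) by simp
    have "(\<Sum>n. b n * of_real r ^ n) = of_real r ^ (2 * m) * g 0 r"
      using bg r \<tau> by (simp add: einterval_iff inv2_iff sums_iff)
    moreover have "g 0 r = sph_coeff f (Y k l) r / of_real r ^ k"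
      by (simp add: g_def sph_coeff_def q_def scaleR_conv_of_real divide_inverse mult.commute)
    moreover have "complex_of_real r powi (int k - 2 * int m) = of_real r ^ k / of_real r ^ (2 * m)"
    proof -
      have "int k - 2 * int m = int k - int (2 * m)" by simp
      thus ?thesis
        using \<open>0 < r\<close> power_int_diff[of "complex_of_real r" "int k" "int (2 * m)"] by (simp only: power_int_of_nat) simp
    qed
    ultimately show ?thesis using \<open>0 < r\<close> by simp
  qed
  show "?P k l"
  proof -
    have value_eq: "sph_coeff f (Y k l) r = s (complex_of_real r)"
      if "\<forall>z. z \<noteq> 0 \<longrightarrow> 2 * \<tau> * norm z < 1 \<longrightarrow> z powi (int k - 2 * int m) * (\<Sum>n. b n * z ^ n) = s z"
        and r: "r0 < r" "ereal r < r1" "ereal r < inv2 \<tau>" for s r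
    proof -
      have "2 * \<tau> * r < 1" "0 < r" using r \<tau> assms(3) by (auto simp: inv2_iff)
      thus ?thesis using that(1)[rule_format, of "of_real r"] coeff[OF r] by simp
    qed
    note expansion = power_series_imp_expansion[OF \<tau> m, of b, unfolded Let_def]
    show ?thesis
      unfolding Let_def
      by (rule ex_forward[OF expansion])
         (simp add: b, simp add: b0, elim conjE, intro conjI,
           (assumption | (intro allI impI, elim conjE, erule value_eq, assumption+))+)
  qed
qed

end
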